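(* Let $\Omega\subset\mathbb{R}^N$ be a bounded open set with Lipschitz boundary satisfying the uniform exterior sphere condition. Let $k<0$, $\lambda\in\mathbb{R}$, and let $u\in\mathcal{H}_0^{\ln}(\Omega)\setminus\{0\}$ be the global least-energy (weak) solution (unique up to sign) of $$(I-\Delta)^{\ln}u=\lambda u+k\,u\ln|u|\ \text{ in }\Omega,\qquad u=0\ \text{ in }\mathbb{R}^N\setminus\Omega .$$ Then $u\in C(\Omega)\cap L^\infty(\Omega)$, and there exist $\beta=\beta(\Omega)\in(0,1)$ and a constant $C=C(N,\lambda,k,\Omega)>0$ such that $$\sup_{\substack{x,y\in\mathbb{R}^N\\ x\neq y}}\frac{|u(x)-u(y)|}{\ell(|x-y|)^{\beta}}\le C\|u\|_{L^2(\mathbb{R}^N)}\qquad\text{and}\qquad \|u\|_{L^\infty(\Omega)}\le C\|u\|_{L^2(\Omega)},$$ where $\ell(\rho):=\dfrac{1}{|\ln(\min\{\rho,\frac1{10}\})|}$.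
   Context: All functions are real-valued, defined on $\mathbb{R}^N$ (extended by $0$ outside $\Omega$), and pointwise statements refer to a suitable a.e.-representative. Let $K_\nu$ be the modified Bessel function of the second kind, $d_N:=\pi^{-N/2}$, $\omega(r):=2^{1-N/2}r^{N/2}K_{N/2}(r)$ and $J(y):=d_N\,\omega(|y|)/|y|^N$. The logarithmic Schrödinger operator is $(I-\Delta)^{\ln}u(x)=\int_{\mathbb{R}^N}(u(x)-u(x+y))J(y)\,dy$; it has Fourier symbol $\ln(1+|\xi|^2)$. Set $$\mathcal{E}_\omega(u,v)=\tfrac12\int_{\mathbb{R}^N}\int_{\mathbb{R}^N}(u(x)-u(y))(v(x)-v(y))J(x-y)\,dx\,dy,$$ $H^{\ln}(\mathbb{R}^N)=\{u\in L^2(\mathbb{R}^N):\mathcal{E}_\omega(u,u)<\infty\}$ and $\mathcal{H}_0^{\ln}(\Omega)=\{u\in H^{\ln}(\mathbb{R}^N):u\equiv0\text{ in }\mathbb{R}^N\setminus\Omega\}$. Convention: $t\ln|t|=0$ and $t^2\ln t^2=0$ at $t=0$. A function $u\in\mathcal{H}_0^{\ln}(\Omega)$ is a weak solution if $\mathcal{E}_\omega(u,\varphi)=\lambda\int_\Omega u\varphi\,dx+k\int_\Omega\varphi u\ln|u|\,dx$ for all $\varphi\in\mathcal{H}_0^{\ln}(\Omega)$. With $$J_{\ln}(u)=\tfrac12\mathcal{E}_\omega(u,u)-\tfrac\lambda2\int_\Omega u^2dx+\tfrac k4\int_\Omega u^2dx-\tfrac k4\int_\Omega u^2\ln u^2dx,$$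 a nontrivial solution $u$ is a global least-energy solution if $J_{\ln}(u)=\inf_{\mathcal{H}_0^{\ln}(\Omega)}J_{\ln}$. For $k<0$ such a solution exists and is unique up to a sign. *)

theory Defs
  imports "HOL-Analysis.Analysis" "HOL-Probability.Essential_Supremum"
begin

text \<open>
  The space \<open>\<real>\<^sup>N\<close> is a type \<open>'a\<close> of class \<^class>\<open>euclidean_space\<close>, with \<open>N = DIM('a)\<close>.
  Elements of \<open>L\<^sup>2\<close> and of its subspaces are represented by Lebesgue measurable functions
  \<open>'a \<Rightarrow> real\<close>, and all the notions below are invariant under changes on null sets.
\<close>

section \<open>Domains\<close>

text \<open>
  Near every boundary point the set is, after a rotation, the strict epigraph of a Lipschitz
  function. The direction \<open>e\<close> plays the role of the last coordinate axis: \<open>x \<bullet> e\<close> is the last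
  coordinate of \<open>x\<close>, and \<open>x - (x \<bullet> e) *\<^sub>R e\<close> stands for its first \<open>N - 1\<close> coordinates.
\<close>

definition lipschitz_boundary :: "'a::euclidean_space set \<Rightarrow> bool" where
  "lipschitz_boundary \<Omega> \<longleftrightarrow>
    (\<forall>x0 \<in> frontier \<Omega>. \<exists>r>0. \<exists>e \<gamma> L. norm e = 1 \<and> L-lipschitz_on {z. z \<bullet> e = 0} \<gamma> \<and>
       \<Omega> \<inter> ball x0 r = {x \<in> ball x0 r. \<gamma> (x - (x \<bullet> e) *\<^sub>R e) < x \<bullet> e})"

definition uniform_exterior_sphere :: "'a::euclidean_space set \<Rightarrow> bool" where
  "uniform_exterior_sphere \<Omega> \<longleftrightarrow>
    (\<exists>r>0. \<forall>x0 \<in> frontier \<Omega>. \<exists>y. cball y r \<inter> closure \<Omega> = {x0})"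

section \<open>The kernel\<close>

text \<open>
  Modified Bessel function of the second kind, for real order \<open>\<nu>\<close> and argument \<open>r > 0\<close>, given
  by its classical integral formula \<open>K\<^sub>\<nu>(r) = \<integral>\<^sub>0\<^sup>\<infinity> e\<^bsup>-r cosh t\<^esup> cosh (\<nu> t) dt\<close>.
\<close>

definition bessel_K :: "real \<Rightarrow> real \<Rightarrow> real" where
  "bessel_K \<nu> r = (LBINT t:{0..}. exp (- r * cosh t) * cosh (\<nu> * t))"

definition omega :: "nat \<Rightarrow> real \<Rightarrow> real" where
  "omega N r = 2 powr (1 - real N / 2) * r powr (real N / 2) * bessel_K (real N / 2) r"

definition J :: "'a::euclidean_space \<Rightarrow> real" where
  "J y = pi powr (- real DIM('a) / 2) * omega DIM('a) (norm y) / norm y ^ DIM('a)"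

section \<open>Function spaces and norms\<close>

definition L2_norm :: "'a::euclidean_space set \<Rightarrow> ('a \<Rightarrow> real) \<Rightarrow> real" where
  "L2_norm S u = sqrt (LINT x:S|lebesgue. (u x)\<^sup>2)"

definition Linf_norm :: "'a::euclidean_space set \<Rightarrow> ('a \<Rightarrow> real) \<Rightarrow> ereal" where
  "Linf_norm S u = esssup (lebesgue_on S) (\<lambda>x. ereal \<bar>u x\<bar>)"

definition Linf_space :: "'a::euclidean_space set \<Rightarrow> ('a \<Rightarrow> real) set" where
  "Linf_space S = {u. u \<in> borel_measurable (lebesgue_on S) \<and> Linf_norm S u < \<infinity>}"

definition energy :: "('a::euclidean_space \<Rightarrow> real) \<Rightarrow> ('a \<Rightarrow> real) \<Rightarrow> real" where
  "energy u v =
    1 / 2 * (LINT x|lebesgue. LINT y|lebesgue. (u x - u y) * (v x - v y) * J (x - y))"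

text \<open>
  Finiteness of the energy of \<open>u\<close> is expressed with the nonnegative integral, since the Bochner
  integral in \<^const>\<open>energy\<close> is \<open>0\<close> when the integrand is not integrable.
\<close>

definition H_ln :: "('a::euclidean_space \<Rightarrow> real) set" where
  "H_ln = {u. u \<in> borel_measurable lebesgue \<and> integrable lebesgue (\<lambda>x. (u x)\<^sup>2) \<and>
     (\<integral>\<^sup>+ x. \<integral>\<^sup>+ y. ennreal ((u x - u y)\<^sup>2 * J (x - y)) \<partial>lebesgue \<partial>lebesgue) < \<infinity>}"

definition H0_ln :: "'a::euclidean_space set \<Rightarrow> ('a \<Rightarrow> real) set" where
  "H0_ln \<Omega> = {u \<in> H_ln. AE x in lebesgue. x \<notin> \<Omega> \<longrightarrow> u x = 0}"

section \<open>Solutions\<close>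

text \<open>
  The conventions \<open>t ln |t| = 0\<close> and \<open>t\<^sup>2 ln t\<^sup>2 = 0\<close> at \<open>t = 0\<close> hold automatically, because
  \<^term>\<open>ln (0::real)\<close> is a real number.
\<close>

definition weak_solution ::
    "'a::euclidean_space set \<Rightarrow> real \<Rightarrow> real \<Rightarrow> ('a \<Rightarrow> real) \<Rightarrow> bool" where
  "weak_solution \<Omega> k lam u \<longleftrightarrow> u \<in> H0_ln \<Omega> \<and>
    (\<forall>\<phi> \<in> H0_ln \<Omega>. energy u \<phi> =
       lam * (LINT x:\<Omega>|lebesgue. u x * \<phi> x) + k * (LINT x:\<Omega>|lebesgue. \<phi> x * u x * ln \<bar>u x\<bar>))"

definition J_ln :: "'a::euclidean_space set \<Rightarrow> real \<Rightarrow> real \<Rightarrow> ('a \<Rightarrow> real) \<Rightarrow> real" where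
  "J_ln \<Omega> k lam u = 1 / 2 * energy u u - lam / 2 * (LINT x:\<Omega>|lebesgue. (u x)\<^sup>2)
     + k / 4 * (LINT x:\<Omega>|lebesgue. (u x)\<^sup>2)
     - k / 4 * (LINT x:\<Omega>|lebesgue. (u x)\<^sup>2 * ln ((u x)\<^sup>2))"

text \<open>
  The infimum is taken in the extended reals, where it is meaningful without assuming that
  the functional is bounded below.
\<close>

definition global_least_energy_solution ::
    "'a::euclidean_space set \<Rightarrow> real \<Rightarrow> real \<Rightarrow> ('a \<Rightarrow> real) \<Rightarrow> bool" where
  "global_least_energy_solution \<Omega> k lam u \<longleftrightarrow> weak_solution \<Omega> k lam u \<and>
     \<not> (AE x in lebesgue. u x = 0) \<and>
     ereal (J_ln \<Omega> k lam u) = (INF v \<in> H0_ln \<Omega>. ereal (J_ln \<Omega> k lam v))"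

section \<open>The modulus of continuity\<close>

definition ell :: "real \<Rightarrow> real" where
  "ell \<rho> = 1 / \<bar>ln (min \<rho> (1 / 10))\<bar>"

end

theory Submission
  imports Defs
begin

text \<open>
  Testing the equation with a truncation of \<open>(\<bar>u\<bar> - e\<^sup>-\<^sup>\<lambda>\<^sup>/\<^sup>k)\<^sup>+\<close>, on whose support the right-hand side has
  the sign opposite to \<open>u\<close>, bounds \<open>u\<close> by \<open>e\<^sup>-\<^sup>\<lambda>\<^sup>/\<^sup>k\<close>; so \<open>u\<close> solves \<open>(I - \<Delta>)\<^sup>l\<^sup>n u = f\<close> with \<open>f\<close> bounded.

  Boundary decay. The kernel is comparable to \<open>\<bar>y\<bar>\<^sup>-\<^sup>N\<close> near \<open>0\<close>, so each dyadic shell carries a comparable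
  mass. At a boundary point \<open>x0\<close> with exterior ball \<open>B\<close>, compare \<open>u\<close> with multiples of
  \<open>\<psi> x = (1 + log\<^sub>2 (1 / (\<bar>x - x0\<bar> + \<eta>)))\<^sup>-\<^sup>\<beta>\<close>. Since \<open>u = 0\<close> on \<open>B\<close>, the comparison gains \<open>\<psi> x\<close> times the mass of
  \<open>B - x\<close>, of order \<open>\<psi> x log (1/\<rho>)\<close> with \<open>\<rho> = \<bar>x - x0\<bar> + \<eta>\<close>, and loses only \<open>O(\<beta>)\<close> times this to the growth
  of \<open>\<psi>\<close>. Hence a small \<open>\<beta>\<close>, depending only on \<open>N\<close>, works.

  Modulus of continuity. For \<open>w = u(\<cdot> + h) - u\<close> replace \<open>J\<close> by a sum \<open>j \<le> J\<close> of normalised indicators of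
  dyadic balls with radii from \<open>1\<close> down to about \<open>\<bar>h\<bar>\<close>. Its mass is of order \<open>log (1/\<bar>h\<bar>)\<close>, while its
  translate by \<open>h\<close> differs from it by \<open>O(1)\<close> in \<open>L\<^sup>1\<close>. At a positive maximum \<open>m\<close> of \<open>w\<close> away from the boundary this
  gives \<open>m log (1/\<bar>h\<bar>) \<le> C\<close>, and near the boundary the decay estimate applies.

  Finally, testing with \<open>u\<close> gives \<open>J_ln u = (k/4) \<parallel>u\<parallel>\<^sup>2\<close>, so all global least-energy solutions have the same
  \<open>L\<^sup>2\<close> norm, and bounds by constants become bounds by multiples of \<open>\<parallel>u\<parallel>\<close>.
\<close>

section \<open>The kernel\<close>

text \<open>The solution is only an element of the energy space, so no argument can be made at a
  maximum point. Each comparison tests the equation with the positive part of an excess and ends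
  with a nonpositive integral of a function that is positive wherever the test function is nonzero.
  A further obstacle is that \<open>J\<close> is not integrable at the origin: terms such as the
  integrals of \<open>u (x) * J (x - y)\<close> and \<open>u (y) * J (x - y)\<close> cannot be
  separated. Since an excess and its positive part have increments of the same sign,
  \<open>J\<close> may be lowered to an integrable minorant, and for that kernel splitting and
  translation under the integral are legitimate. Away from the boundary the balance of mass against
  translation error yields the modulus \<open>ell\<close> itself; the exponent \<beta> comes from
  the barrier alone. It is fixed by comparing the lower and upper constants of the kernel, before
  the radius of the exterior balls, \<open>k\<close> or \<open>lam\<close> appear. The shift \<eta>
  makes the barrier Lipschitz, so that its integrals against \<open>J\<close> converge. The decay
  estimate is uniform in \<eta>, which permits its removal.\<close>

lemma power_le_fact_exp:
  fixes x :: real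
  assumes "0 \<le> x"
  shows "x ^ m \<le> fact m * exp x"
proof (cases m)
  case 0 with assms show ?thesis by simp
next
  case (Suc n)
  have "x ^ m / fact m \<le> exp x"
  proof -
    have s: "(\<lambda>n. inverse (fact n) * x ^ n) sums exp x"
      unfolding exp_def by (simp add: summable_exp summable_sums divide_inverse mult.commute)
    have "inverse (fact m) * x ^ m \<le> exp x"
      using s sum_le_suminf[OF summable_exp[of x], of "{m}"] assms
      by (auto simp: sums_iff)
    then show ?thesis by (simp add: field_simps)
  qed
  then show ?thesis by (simp add: field_simps)
qed

text \<open>Since \<open>\<nu> \<ge> 1/2\<close>, the power vanishes at the origin at least as fast
  as \<open>sqrt x\<close>, and the exponential absorbs any power at infinity. The profile
  \<open>sqrt x / (1 + x)\<close> is chosen because, with \<open>x = r * exp t\<close>, it has the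
  antiderivative \<open>2 * arctan (sqrt r * exp (t / 2))\<close> in \<open>t\<close>, whose range
  is bounded independently of \<open>r\<close>.\<close>

lemma powr_exp_bound:
  fixes \<nu> :: real
  assumes "1/2 \<le> \<nu>"
  shows "\<exists>C>0. \<forall>x>0. x powr \<nu> * exp (- x / 4) \<le> C * (sqrt x / (1 + x))"
proof -
  obtain m :: nat where m: "\<nu> + 1/2 \<le> real m" using real_arch_simple by blast
  define C where "C = 4 ^ m * fact m * exp (1/4 :: real)"
  have "x powr \<nu> * exp (- x / 4) \<le> C * (sqrt x / (1 + x))" if x: "x > 0" for x
  proof -
    have "x powr \<nu> = x powr (\<nu> - 1/2) * sqrt x"
      using x by (simp add: powr_half_sqrt[symmetric] powr_add[symmetric])
    also have "x powr (\<nu> - 1/2) \<le> (1 + x) powr (\<nu> - 1/2)"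
      using x assms by (intro powr_mono2) auto
    also have "(1 + x) powr (\<nu> - 1/2) = (1 + x) powr (\<nu> + 1/2) / (1 + x)"
      using x powr_diff[of "1+x" "\<nu>+1/2" 1] by simp
    also have "(1 + x) powr (\<nu> + 1/2) \<le> (1 + x) powr (real m)"
      using x m by (intro powr_mono) auto
    also have "\<dots> = 4 ^ m * ((1 + x) / 4) ^ m" using x by (simp add: powr_realpow power_divide)
    also have "((1 + x) / 4) ^ m \<le> fact m * exp ((1 + x) / 4)"
      using x by (intro power_le_fact_exp) auto
    also have "4 ^ m * (fact m * exp ((1 + x) / 4)) = C * exp (x / 4)"
      by (simp add: C_def add_divide_distrib exp_add algebra_simps)
    finally have "x powr \<nu> \<le> C * exp (x / 4) / (1 + x) * sqrt x"
      using x by (simp add: divide_right_mono mult_right_mono)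
    then have "x powr \<nu> * exp (- x / 4) \<le> C * exp (x / 4) / (1 + x) * sqrt x * exp (- x / 4)"
      by (intro mult_right_mono) auto
    also have "\<dots> = C * (sqrt x / (1 + x)) * (exp (x / 4) * exp (- x / 4))" by (simp add: field_simps)
    also have "exp (x / 4) * exp (- x / 4) = 1" by (simp add: exp_add[symmetric])
    finally show ?thesis by simp
  qed
  moreover have "C > 0" by (simp add: C_def)
  ultimately show ?thesis by blast
qed

lemma nn_integral_sqrt_exp:
  fixes r :: real
  assumes "r > 0"
  shows "(\<integral>\<^sup>+t. ennreal (sqrt (r * exp t) / (1 + r * exp t)) * indicator {0..} t \<partial>lborel) \<le> ennreal pi"
proof -
  define F where "F t = 2 * arctan (sqrt r * exp (t / 2))" for t :: real
  have e: "exp t = exp (t/2) * exp (t/2)" for t :: real by (simp add: exp_add[symmetric])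
  have sq: "sqrt (r * exp t) = sqrt r * exp (t / 2)" for t
    by (subst e) (simp add: real_sqrt_mult)
  have d: "DERIV F t :> sqrt (r * exp t) / (1 + r * exp t)" for t
  proof -
    have "(sqrt r * exp (t / 2))\<^sup>2 = r * exp t"
      using assms by (subst e) (simp add: power_mult_distrib power2_eq_square)
    moreover have "1 + r * exp t > 0" using assms by (simp add: add_pos_pos)
    ultimately show ?thesis unfolding F_def sq
      by (auto intro!: derivative_eq_intros simp: divide_simps)
  qed
  have "filterlim (\<lambda>t. sqrt r * exp (t / 2)) at_top at_top"
    using assms by (intro filterlim_tendsto_pos_mult_at_top[OF tendsto_const]
        filterlim_compose[OF exp_at_top] filterlim_at_top_mult_tendsto_pos[OF tendsto_const, of "1/2" "\<lambda>x. x", simplified] ) (auto simp: filterlim_ident)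
  then have lim: "(F \<longlongrightarrow> 2 * (pi / 2)) at_top"
    unfolding F_def by (intro tendsto_mult tendsto_const filterlim_compose[OF tendsto_arctan_at_top])
  have "(\<integral>\<^sup>+t. ennreal (sqrt (r * exp t) / (1 + r * exp t)) * indicator {0..} t \<partial>lborel) = ennreal (2 * (pi / 2) - F 0)"
    using assms by (intro nn_integral_FTC_atLeast[OF _ d _ lim]) (auto intro!: divide_nonneg_nonneg add_nonneg_nonneg)
  also have "\<dots> \<le> ennreal pi"
    using assms by (intro ennreal_leI) (auto simp: F_def)
  finally show ?thesis .
qed

text \<open>From \<open>cosh t \<ge> exp t / 2\<close> and \<open>exp t \<ge> 1\<close>, the
  exponent \<open>r * cosh t\<close> dominates \<open>r / 4 + r * exp t / 4\<close>. The first part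
  is kept as decay in \<open>r\<close>; the second is spent on absorbing
  \<open>(r * exp t) powr \<nu>\<close>.\<close>

lemma bessel_integrand_le:
  fixes \<nu> :: real
  assumes C: "\<forall>x>0. x powr \<nu> * exp (- x / 4) \<le> C * (sqrt x / (1 + x))"
    and "r > 0" "t \<ge> 0" "\<nu> \<ge> 0"
  shows "r powr \<nu> * (exp (- r * cosh t) * cosh (\<nu> * t)) \<le> exp (- r / 4) * (C * (sqrt (r * exp t) / (1 + r * exp t)))"
proof -
  have 1: "cosh (\<nu> * t) \<le> exp (\<nu> * t)"
    using assms by (simp add: cosh_def field_simps)
  have "exp t / 2 \<le> cosh t" "1 \<le> exp t" using assms by (simp_all add: cosh_def field_simps)
  then have "r * (exp t / 2) \<le> r * cosh t" "r * 1 \<le> r * exp t" using assms by (auto simp only: mult_left_mono less_imp_le)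
  then have 2: "- r * cosh t \<le> - r / 4 + - (r * exp t) / 4" by simp
  have "r powr \<nu> * (exp (- r * cosh t) * cosh (\<nu> * t)) \<le> r powr \<nu> * (exp (- r / 4 + - (r * exp t) / 4) * exp (\<nu> * t))"
    using 1 2 by (intro mult_left_mono mult_mono) (auto simp: cosh_def)
  also have "\<dots> = exp (- r / 4) * ((r * exp t) powr \<nu> * exp (- (r * exp t) / 4))"
    using assms by (simp only: powr_mult exp_add exp_powr_real mult_ac)
  also have "\<dots> \<le> exp (- r / 4) * (C * (sqrt (r * exp t) / (1 + r * exp t)))"
    using C assms by (intro mult_left_mono) auto
  finally show ?thesis .
qed

text \<open>The weight \<open>r powr \<nu>\<close> compensates the singularity at the origin, so one
  estimate covers small and large \<open>r\<close>. Integrability is recorded as well, because the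
  Bochner integral of a non-integrable function is \<open>0\<close>, a value that the lower bound
  has to exclude.\<close>

lemma bessel_K_integrable_and_upper:
  fixes \<nu> :: real
  assumes "1/2 \<le> \<nu>"
  shows "\<exists>C>0. \<forall>r>0. set_integrable lborel {0..} (\<lambda>t. exp (- r * cosh t) * cosh (\<nu> * t)) \<and>
    r powr \<nu> * bessel_K \<nu> r \<le> C * exp (- r / 4)"
proof -
  obtain C where "C > 0" and C: "\<forall>x>0. x powr \<nu> * exp (- x / 4) \<le> C * (sqrt x / (1 + x))"
    using powr_exp_bound[OF assms] by blast
  have "set_integrable lborel {0..} (\<lambda>t. exp (- r * cosh t) * cosh (\<nu> * t)) \<and>
    r powr \<nu> * bessel_K \<nu> r \<le> (C * pi) * exp (- r / 4)" if r: "r > 0" for r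
  proof -
    define q where "q t = exp (- r / 4) * (C * (sqrt (r * exp t) / (1 + r * exp t)))" for t
    have nn: "(\<integral>\<^sup>+t. ennreal (indicator {0..} t *\<^sub>R q t) \<partial>lborel) \<le> ennreal ((C * pi) * exp (- r / 4))"
    proof -
      have "(\<integral>\<^sup>+t. ennreal (indicator {0..} t *\<^sub>R q t) \<partial>lborel)
        = (\<integral>\<^sup>+t. ennreal (exp (- r / 4) * C) * (ennreal (sqrt (r * exp t) / (1 + r * exp t)) * indicator {0..} t) \<partial>lborel)"
        using r \<open>C > 0\<close> by (intro nn_integral_cong)
          (auto simp: q_def indicator_def ennreal_mult[symmetric] mult_ac add_nonneg_nonneg intro!: arg_cong[where f=ennreal])
      also have "\<dots> = ennreal (exp (- r / 4) * C) * (\<integral>\<^sup>+t. (ennreal (sqrt (r * exp t) / (1 + r * exp t)) * indicator {0..} t) \<partial>lborel)"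
        by (rule nn_integral_cmult) measurable
      also have "\<dots> \<le> ennreal (exp (- r / 4) * C) * ennreal pi"
        using nn_integral_sqrt_exp[OF r] by (intro mult_left_mono) auto
      also have "\<dots> = ennreal ((C * pi) * exp (- r / 4))" using \<open>C>0\<close> by (simp add: ennreal_mult[symmetric] mult_ac)
      finally show ?thesis .
    qed
    have qnn: "0 \<le> indicator {0..} t *\<^sub>R q t" for t
      using r \<open>C>0\<close> by (auto simp: q_def indicator_def intro!: mult_nonneg_nonneg divide_nonneg_nonneg add_nonneg_nonneg)
    have iq: "integrable lborel (\<lambda>t. indicator {0..} t *\<^sub>R q t)"
      using nn qnn by (intro integrableI_nonneg) (auto simp: q_def intro: le_less_trans)
    have Iq: "(LINT t|lborel. indicator {0..} t *\<^sub>R q t) \<le> (C * pi) * exp (- r / 4)"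
      using nn qnn \<open>C > 0\<close> by (intro integral_real_bounded) auto
    have le: "norm (r powr \<nu> * (indicator {0..} t *\<^sub>R (exp (- r * cosh t) * cosh (\<nu> * t)))) \<le> norm (indicator {0..} t *\<^sub>R q t)" for t
    proof (cases "t \<in> {0..}")
      case True
      have "0 \<le> r powr \<nu> * (exp (- r * cosh t) * cosh (\<nu> * t))" by (simp add: cosh_def)
      moreover have "r powr \<nu> * (exp (- r * cosh t) * cosh (\<nu> * t)) \<le> q t"
        using bessel_integrand_le[OF C r, of t] assms True by (simp add: q_def)
      ultimately show ?thesis using True by (simp add: abs_of_nonneg)
    qed simp
    have cb: "(\<lambda>t::real. cosh (c * t)) \<in> borel_measurable borel" for c :: real unfolding cosh_def by measurable
    have cb': "(cosh :: real \<Rightarrow> real) \<in> borel_measurable borel" using cb[of 1] by simp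
    have i1: "integrable lborel (\<lambda>t. r powr \<nu> * (indicator {0..} t *\<^sub>R (exp (- r * cosh t) * cosh (\<nu> * t))))"
      using iq by (rule Bochner_Integration.integrable_bound) (use le cb cb' in \<open>auto intro!: AE_I2 borel_measurable_times borel_measurable_exp simp del: mult_minus_left\<close>)
    have i2: "set_integrable lborel {0..} (\<lambda>t. exp (- r * cosh t) * cosh (\<nu> * t))"
      using i1 r by (simp add: set_integrable_def)
    have "r powr \<nu> * bessel_K \<nu> r = (LINT t|lborel. r powr \<nu> * (indicator {0..} t *\<^sub>R (exp (- r * cosh t) * cosh (\<nu> * t))))"
      by (simp add: bessel_K_def set_lebesgue_integral_def)
    also have "\<dots> \<le> (LINT t|lborel. indicator {0..} t *\<^sub>R q t)"
      using le qnn by (intro integral_mono i1 iq) (smt (verit) real_norm_def)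
    finally show ?thesis using i2 Iq by simp
  qed
  then show ?thesis using \<open>C > 0\<close> by (intro exI[of _ "C * pi"]) auto
qed

text \<open>The mass sits where \<open>r * exp t\<close> is of order one: on the unit interval from
  \<open>- ln r\<close> to \<open>1 - ln r\<close> one has
  \<open>1 \<le> r * exp t \<le> exp 1\<close>, and there the weighted integrand is at least
  \<open>exp (- exp 1) / 2\<close>.\<close>

lemma bessel_K_lower:
  fixes \<nu> :: real
  assumes "1/2 \<le> \<nu>" "0 < r" "r \<le> 1"
  shows "exp (- exp 1) / 2 \<le> r powr \<nu> * bessel_K \<nu> r"
proof -
  have int: "set_integrable lborel {0..} (\<lambda>t. exp (- r * cosh t) * cosh (\<nu> * t))"
    using bessel_K_integrable_and_upper[OF assms(1)] assms by blast
  have "(LINT t|lborel. indicator {- ln r..1 - ln r} t *\<^sub>R (exp (- exp 1) / 2))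
    \<le> (LINT t|lborel. r powr \<nu> * (indicator {0..} t *\<^sub>R (exp (- r * cosh t) * cosh (\<nu> * t))))"
  proof (intro integral_mono integrable_mult_right)
    show "integrable lborel (\<lambda>t. indicator {0..} t *\<^sub>R (exp (- r * cosh t) * cosh (\<nu> * t)))"
      using int by (simp add: set_integrable_def)
    show "integrable lborel (\<lambda>t. indicator {- ln r..1 - ln r} t *\<^sub>R (exp (- exp 1) / 2 :: real))"
      by (intro integrable_scaleR_left integrable_real_indicator) (auto simp: emeasure_lborel_Icc_eq)
    fix t
    show "indicator {- ln r..1 - ln r} t *\<^sub>R (exp (- exp 1) / 2) \<le> r powr \<nu> * (indicator {0..} t *\<^sub>R (exp (- r * cosh t) * cosh (\<nu> * t)))"
    proof (cases "t \<in> {- ln r..1 - ln r}")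
      case False then show ?thesis using assms by (auto simp: indicator_def cosh_def)
    next
      case True
      have lr: "ln r \<le> 0" using assms by simp
      have t: "t \<ge> 0" using True lr by auto
      have e: "r * exp t = exp (t + ln r)" using assms by (simp add: exp_add mult.commute)
      have "cosh t \<le> exp t" using t by (simp add: cosh_def field_simps)
      then have "r * cosh t \<le> exp 1"
        using mult_left_mono[of "cosh t" "exp t" r] True assms e by (smt (verit) atLeastAtMost_iff exp_le_cancel_iff)
      then have A: "exp (- exp 1) \<le> exp (- r * cosh t)" by simp
      have "1 \<le> (r * exp t) powr \<nu>" using True assms unfolding e by (intro ge_one_powr_ge_zero) auto
      also have "\<dots> = r powr \<nu> * exp (\<nu> * t)" using assms by (simp add: powr_mult exp_powr_real mult.commute)
      also have "\<dots> \<le> r powr \<nu> * (2 * cosh (\<nu> * t))" by (intro mult_left_mono) (auto simp: cosh_def)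
      finally have B: "1/2 \<le> r powr \<nu> * cosh (\<nu> * t)" by simp
      have "exp (- exp 1) * (1/2) \<le> exp (- r * cosh t) * (r powr \<nu> * cosh (\<nu> * t))"
        using A B by (intro mult_mono) auto
      then show ?thesis using True t by (simp add: mult_ac)
    qed
  qed
  also have "(LINT t|lborel. indicator {- ln r..1 - ln r} t *\<^sub>R (exp (- exp 1) / 2)) = (exp (- exp 1) / 2 :: real)"
    by simp
  also have "(LINT t|lborel. r powr \<nu> * (indicator {0..} t *\<^sub>R (exp (- r * cosh t) * cosh (\<nu> * t)))) = r powr \<nu> * bessel_K \<nu> r"
    by (simp add: bessel_K_def set_lebesgue_integral_def)
  finally show ?thesis .
qed

lemma bessel_K_nonneg: "0 \<le> bessel_K \<nu> r"
  unfolding bessel_K_def set_lebesgue_integral_def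
  by (intro integral_nonneg_AE AE_I2) (auto simp: cosh_def indicator_def)

lemma borel_measurable_bessel_K [measurable]: "bessel_K \<nu> \<in> borel_measurable borel"
proof -
  have "(\<lambda>p::real\<times>real. indicator {0..} (snd p) *\<^sub>R (exp (- fst p * cosh (snd p)) * cosh (\<nu> * snd p))) \<in> borel_measurable (borel \<Otimes>\<^sub>M lborel)"
    unfolding cosh_def by measurable
  then have "(\<lambda>x. LINT t|lborel. indicator {0..} t *\<^sub>R (exp (- x * cosh t) * cosh (\<nu> * t))) \<in> borel_measurable borel"
    using lborel.borel_measurable_lebesgue_integral[where f="\<lambda>x t. indicator {0..} t *\<^sub>R (exp (- x * cosh t) * cosh (\<nu> * t))" and N=borel]
    by (simp add: case_prod_unfold)
  then show ?thesis by (simp add: bessel_K_def[abs_def] set_lebesgue_integral_def)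
qed

lemma borel_measurable_J [measurable]: "(J :: 'a::euclidean_space \<Rightarrow> real) \<in> borel_measurable borel"
  unfolding J_def[abs_def] omega_def by measurable

lemma J_nonneg [simp]: "0 \<le> J x"
  unfolding J_def omega_def by (simp add: bessel_K_nonneg)

lemma J_minus_commute: "J (x - y) = J (y - x)"
  unfolding J_def by (simp add: norm_minus_commute)

text \<open>The first bound has the right order near the origin. The second, which trades
  \<open>exp (- r / 4)\<close> for \<open>4 / r\<close>, makes the kernel integrable at infinity.
  The shell decomposition in \<open>nn_integral_J_le\<close> uses one inside and the other outside
  the unit ball.\<close>

lemma J_upper:
  "\<exists>C>0. \<forall>y::'a::euclidean_space. y \<noteq> 0 \<longrightarrow> J y \<le> C / norm y ^ DIM('a) \<and> J y \<le> C / norm y ^ Suc DIM('a)"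
proof -
  let ?\<nu> = "real DIM('a) / 2"
  have "1/2 \<le> ?\<nu>" using DIM_positive[where 'a='a] by linarith
  then obtain C where "C > 0" and C: "\<And>r. r > 0 \<Longrightarrow> r powr ?\<nu> * bessel_K ?\<nu> r \<le> C * exp (- r / 4)"
    using bessel_K_integrable_and_upper by blast
  define a where "a = pi powr (- real DIM('a) / 2) * 2 powr (1 - ?\<nu>)"
  have a: "a > 0" by (simp add: a_def)
  have "J y \<le> (4 * a * C) / norm y ^ DIM('a) \<and> J y \<le> (4 * a * C) / norm y ^ Suc DIM('a)" if "y \<noteq> 0" for y :: 'a
  proof -
    define r where "r = norm y"
    have r: "r > 0" using that by (simp add: r_def)
    have J: "J y = a * (r powr ?\<nu> * bessel_K ?\<nu> r) / r ^ DIM('a)"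
      by (simp add: J_def omega_def a_def r_def)
    have e1: "exp (- r / 4) \<le> 4" using r by (smt (verit) divide_neg_pos one_le_exp_iff exp_le_cancel_iff exp_zero)
    have "r / 4 \<le> exp (r / 4)" using exp_ge_add_one_self[of "r/4"] by linarith
    then have e2: "exp (- r / 4) \<le> 4 / r" using r by (simp add: exp_minus field_simps)
    have "r powr ?\<nu> * bessel_K ?\<nu> r \<le> C * 4"
      using C[OF r] mult_left_mono[OF e1, of C] \<open>C>0\<close> by linarith
    then have 1: "J y \<le> a * (C * 4) / r ^ DIM('a)"
      unfolding J using a r by (intro divide_right_mono mult_left_mono) auto
    have "r powr ?\<nu> * bessel_K ?\<nu> r \<le> C * (4 / r)"
      using C[OF r] mult_left_mono[OF e2, of C] \<open>C>0\<close> by linarith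
    then have "J y \<le> a * (C * (4 / r)) / r ^ DIM('a)"
      unfolding J using a r by (intro divide_right_mono mult_left_mono) auto
    with 1 show ?thesis unfolding r_def[symmetric] by (simp add: mult_ac)
  qed
  moreover have "4 * a * C > 0" using a \<open>C>0\<close> by simp
  ultimately show ?thesis by blast
qed

lemma J_lower:
  "\<exists>c>0. \<forall>y::'a::euclidean_space. y \<noteq> 0 \<longrightarrow> norm y \<le> 1 \<longrightarrow> c / norm y ^ DIM('a) \<le> J y"
proof -
  let ?\<nu> = "real DIM('a) / 2"
  have nu: "1/2 \<le> ?\<nu>" using DIM_positive[where 'a='a] by linarith
  define a where "a = pi powr (- real DIM('a) / 2) * 2 powr (1 - ?\<nu>)"
  have a: "a > 0" by (simp add: a_def)
  have "a * (exp (- exp 1) / 2) / norm y ^ DIM('a) \<le> J y" if "y \<noteq> 0" "norm y \<le> 1" for y :: 'a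
  proof -
    have J: "J y = a * (norm y powr ?\<nu> * bessel_K ?\<nu> (norm y)) / norm y ^ DIM('a)"
      by (simp add: J_def omega_def a_def)
    show ?thesis unfolding J using a that bessel_K_lower[OF nu]
      by (intro divide_right_mono mult_left_mono) auto
  qed
  moreover have "a * (exp (- exp 1) / 2) > 0" using a by simp
  ultimately show ?thesis by blast
qed

section \<open>Dyadic truncations of the kernel\<close>

lemma power_of_two_bracket:
  fixes r :: real
  assumes "1 \<le> r"
  obtains i :: nat where "2 ^ i \<le> r" "r < 2 ^ Suc i"
proof -
  define i where "i = nat \<lfloor>log 2 r\<rfloor>"
  have "0 \<le> \<lfloor>log 2 r\<rfloor>" using assms by simp
  then have i: "real i \<le> log 2 r" "log 2 r < real i + 1" unfolding i_def by linarith+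
  have "2 powr real i \<le> r" "r < 2 powr (real i + 1)"
    using i assms by (simp_all add: le_log_iff log_less_iff)
  then show ?thesis using that[of i] by (simp add: powr_realpow powr_add mult.commute)
qed

text \<open>A stand-in for \<open>J\<close> cut off at the scale \<open>1 / 2 ^ n\<close>. Every
  summand has the volume of the unit ball as its integral, so the total mass is exactly proportional
  to \<open>n\<close>.\<close>

definition dyadic_kernel :: "nat \<Rightarrow> 'a::euclidean_space \<Rightarrow> real" where
  "dyadic_kernel n y = (\<Sum>i<n. 2 ^ (i * DIM('a)) * indicator (ball 0 (1 / 2 ^ i)) y)"

lemma dyadic_kernel_nonneg [simp]: "0 \<le> dyadic_kernel n y"
  unfolding dyadic_kernel_def by (intro sum_nonneg) auto

lemma borel_measurable_dyadic_kernel [measurable]: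
  "(dyadic_kernel n :: 'a::euclidean_space \<Rightarrow> real) \<in> borel_measurable borel"
  unfolding dyadic_kernel_def[abs_def]
  by (intro borel_measurable_sum borel_measurable_times borel_measurable_const borel_measurable_indicator) auto

lemma dyadic_kernel_minus_commute: "dyadic_kernel n (x - y) = dyadic_kernel n (y - x)"
  unfolding dyadic_kernel_def by (simp add: indicator_def norm_minus_commute)

text \<open>If \<open>y\<close> lies outside the smallest ball, the new summand is zero and the
  induction hypothesis applies. Otherwise the whole geometric sum, of ratio at least
  \<open>2\<close>, is at most twice its last term, and \<open>2 ^ n < 1 / norm y\<close>.\<close>

lemma dyadic_kernel_le:
  fixes y :: "'a::euclidean_space"
  assumes "y \<noteq> 0"
  shows "dyadic_kernel n y \<le> 2 / norm y ^ DIM('a)"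
proof (induction n)
  case 0 show ?case by (simp add: dyadic_kernel_def)
next
  case (Suc n)
  show ?case
  proof (cases "norm y < 1 / 2 ^ n")
    case False
    then have "dyadic_kernel (Suc n) y = dyadic_kernel n y" by (simp add: dyadic_kernel_def)
    then show ?thesis using Suc by simp
  next
    case True
    let ?b = "2 ^ DIM('a) :: real"
    have b: "2 \<le> ?b" using power_increasing[of 1 "DIM('a)" "2::real"] DIM_positive[where 'a='a] by (simp add: Suc_le_eq)
    have s: "(\<Sum>i<Suc m. ?b ^ i) \<le> 2 * ?b ^ m" for m
    proof (induction m)
      case (Suc m)
      have "2 * ?b ^ m \<le> ?b * ?b ^ m" using b by (intro mult_right_mono) auto
      then have "2 * ?b ^ m + 2 * ?b ^ m \<le> 2 * ?b ^ Suc m" by simp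
      then show ?case using Suc by (simp only: sum.lessThan_Suc[of _ "Suc m"])
    qed simp
    have "dyadic_kernel (Suc n) y \<le> (\<Sum>i<Suc n. 2 ^ (i * DIM('a)))"
      unfolding dyadic_kernel_def by (intro sum_mono) (auto simp: indicator_def)
    also have "\<dots> = (\<Sum>i<Suc n. ?b ^ i)" by (simp add: power_mult[symmetric] mult.commute)
    also have "\<dots> \<le> 2 * ?b ^ n" by (rule s)
    also have "?b ^ n = (2 ^ n) ^ DIM('a)" by (simp add: power_mult[symmetric] mult.commute)
    also have "\<dots> \<le> (1 / norm y) ^ DIM('a)"
      using True assms by (intro power_mono) (auto simp: field_simps)
    finally show ?thesis by (simp add: power_divide)
  qed
qed

text \<open>The dyadic kernel lives in the unit ball, so the local bound \<open>J_lower\<close>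
  suffices. The point \<open>y = 0\<close> is excluded because \<open>J 0 = 0\<close> by division by
  zero, whereas the dyadic kernel is positive there for \<open>n > 0\<close>; hence the separate
  treatment of the diagonal wherever the two kernels are compared.\<close>

lemma dyadic_kernel_le_J:
  "\<exists>c>0. \<forall>n. \<forall>y::'a::euclidean_space. y \<noteq> 0 \<longrightarrow> c * dyadic_kernel n y \<le> J y"
proof -
  obtain c where "c > 0" and c: "\<And>y::'a. y \<noteq> 0 \<Longrightarrow> norm y \<le> 1 \<Longrightarrow> c / norm y ^ DIM('a) \<le> J y"
    using J_lower by blast
  have "c / 2 * dyadic_kernel n y \<le> J y" if "y \<noteq> 0" for n and y :: 'a
  proof (cases "norm y \<le> 1")
    case True
    have "c / 2 * dyadic_kernel n y \<le> c / 2 * (2 / norm y ^ DIM('a))"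
      using dyadic_kernel_le[OF that] \<open>c > 0\<close> by (intro mult_left_mono) auto
    also have "\<dots> \<le> J y" using c[OF that True] by simp
    finally show ?thesis .
  next
    case False
    have "\<not> norm y < 1 / 2 ^ i" for i
    proof -
      have "1 / 2 ^ i \<le> (1::real)" by simp
      with False show ?thesis by linarith
    qed
    then have "dyadic_kernel n y = 0" by (simp add: dyadic_kernel_def)
    then show ?thesis by simp
  qed
  then show ?thesis using \<open>c > 0\<close> by (intro exI[of _ "c/2"]) auto
qed

lemma has_bochner_integral_indicator_ball:
  fixes c :: "'a::euclidean_space"
  assumes "0 \<le> s"
  shows "has_bochner_integral lborel (indicator (ball c s)) (unit_ball_vol DIM('a) * s ^ DIM('a) :: real)"
proof -
  have "has_bochner_integral lborel (indicator (ball c s) :: 'a \<Rightarrow> real) (measure lborel (ball c s))"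
    by (intro has_bochner_integral_real_indicator) (auto simp: emeasure_ball assms)
  then show ?thesis using assms by (simp add: measure_def emeasure_ball)
qed

lemma has_bochner_integral_dyadic_kernel:
  "has_bochner_integral lborel (dyadic_kernel n :: 'a::euclidean_space \<Rightarrow> real) (real n * unit_ball_vol DIM('a))"
proof -
  have "has_bochner_integral lborel (\<lambda>y. \<Sum>i<n. 2 ^ (i * DIM('a)) * indicator (ball (0::'a) (1 / 2 ^ i)) y)
     (\<Sum>i<n. 2 ^ (i * DIM('a)) * (unit_ball_vol DIM('a) * (1 / 2 ^ i) ^ DIM('a)) :: real)"
    by (intro has_bochner_integral_sum has_bochner_integral_mult_right has_bochner_integral_indicator_ball) auto
  also have "(\<Sum>i<n. 2 ^ (i * DIM('a)) * (unit_ball_vol DIM('a) * (1 / 2 ^ i) ^ DIM('a)) :: real) = real n * unit_ball_vol DIM('a)"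
    by (simp add: power_mult power_divide)
  finally show ?thesis by (simp add: dyadic_kernel_def[abs_def])
qed

lemma integrable_dyadic_kernel: "integrable lborel (dyadic_kernel n :: 'a::euclidean_space \<Rightarrow> real)"
  and integral_dyadic_kernel: "(LINT y|lborel. dyadic_kernel n (y::'a)) = real n * unit_ball_vol DIM('a)"
  using has_bochner_integral_dyadic_kernel[of n, where 'a='a] by (auto simp: has_bochner_integral_iff)

text \<open>The ball of radius \<open>r - norm h\<close> lies in both balls, so the symmetric
  difference has at most twice the volume of an annulus of width \<open>norm h\<close>. Bernoulli's
  inequality linearises that volume in \<open>norm h\<close>.\<close>

lemma integral_indicator_ball_translate_diff:
  fixes h :: "'a::euclidean_space"
  assumes "norm h \<le> r"
  shows "integrable lborel (\<lambda>y. \<bar>indicator (ball 0 r) (y + h) - indicator (ball 0 r) y\<bar> :: real)"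
    and "(LINT y|lborel. \<bar>indicator (ball 0 r) (y + h) - indicator (ball 0 r) y\<bar>)
      \<le> 2 * unit_ball_vol DIM('a) * DIM('a) * norm h * r ^ (DIM('a) - 1)"
proof -
  let ?V = "unit_ball_vol DIM('a)" and ?N = "DIM('a)"
  have r: "0 \<le> r" using assms norm_ge_zero order_trans by blast
  define f g :: "'a \<Rightarrow> real" where "f y = indicator (ball 0 r) (y + h)" and "g y = indicator (ball 0 (r - norm h)) y" for y
  have f: "f = indicator (ball (- h) r)"
    by (auto simp: f_def indicator_def fun_eq_iff dist_norm norm_minus_commute add.commute)

  let ?R = "\<lambda>y. (f y - g y) + (indicator (ball 0 r) y - g y)"
  have B: "has_bochner_integral lborel ?R ((?V * r ^ ?N - ?V * (r - norm h) ^ ?N) + (?V * r ^ ?N - ?V * (r - norm h) ^ ?N))"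
    unfolding f g_def using assms r
    by (intro has_bochner_integral_add has_bochner_integral_diff has_bochner_integral_indicator_ball) auto
  have le: "\<bar>f y - indicator (ball 0 r) y\<bar> \<le> ?R y" for y
  proof (cases "y \<in> ball 0 (r - norm h)")
    case True
    have "norm (y + h) \<le> norm y + norm h" by (rule norm_triangle_ineq)
    then have "norm (y + h) < r" "norm y < r" using True norm_ge_zero[of h] by (simp_all del: norm_ge_zero)
    then show ?thesis by (simp add: f_def g_def indicator_def)
  qed (auto simp: f_def g_def indicator_def)
  have m: "(\<lambda>y. \<bar>f y - indicator (ball 0 r) y\<bar>) \<in> borel_measurable lborel" unfolding f
    by (intro borel_measurable_abs borel_measurable_diff borel_measurable_indicator) auto
  have iR: "integrable lborel ?R" using B by (simp add: has_bochner_integral_iff)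
  show i: "integrable lborel (\<lambda>y. \<bar>indicator (ball 0 r) (y + h) - indicator (ball 0 r) y :: real\<bar>)"
    unfolding f_def[symmetric] by (rule Bochner_Integration.integrable_bound[OF iR m]) (use le in \<open>auto intro!: AE_I2 intro: order_trans[OF _ abs_ge_self]\<close>)
  have "(LINT y|lborel. \<bar>f y - indicator (ball 0 r) y\<bar>) \<le> (LINT y|lborel. ?R y)"
    using i le unfolding f_def[symmetric] by (intro integral_mono iR) auto
  also have "\<dots> = 2 * ?V * (r ^ ?N - (r - norm h) ^ ?N)"
    using B by (simp add: has_bochner_integral_iff algebra_simps)
  also have "r ^ ?N - (r - norm h) ^ ?N \<le> ?N * norm h * r ^ (?N - 1)"
  proof (cases "r = 0")
    case True then show ?thesis using assms by simp
  next
    case False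
    then have r: "r > 0" using r by simp
    have rr: "r ^ ?N = r * r ^ (?N - 1)" by (metis DIM_positive power_eq_if less_numeral_extra(3))
    have "1 + real ?N * (- (norm h / r)) \<le> (1 + (- (norm h / r))) ^ ?N"
      using assms r by (intro Bernoulli_inequality) (simp add: field_simps)
    then have "r ^ ?N * (1 + real ?N * (- (norm h / r))) \<le> r ^ ?N * (1 + (- (norm h / r))) ^ ?N"
      using r by (intro mult_left_mono) auto
    also have "\<dots> = (r - norm h) ^ ?N" using r by (simp add: power_mult_distrib[symmetric] field_simps)
    also have "r ^ ?N * (1 + real ?N * (- (norm h / r))) = r ^ ?N - ?N * norm h * r ^ (?N - 1)"
      using r unfolding rr by (simp add: field_simps)
    finally show ?thesis by simp
  qed
  finally show "(LINT y|lborel. \<bar>indicator (ball 0 r) (y + h) - indicator (ball 0 r) y\<bar>)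
      \<le> 2 * ?V * ?N * norm h * r ^ (?N - 1)"
    unfolding f_def by (simp add: mult_ac mult_left_mono)
qed

text \<open>Scale \<open>i\<close> contributes a multiple of \<open>norm h * 2 ^ i\<close>. The sum
  is geometric and dominated by its finest scale, where \<open>norm h * 2 ^ n \<le> 1\<close>; so
  the bound stays fixed while the mass of the kernel grows with \<open>n\<close>.\<close>

lemma integral_dyadic_kernel_translate_diff:
  fixes h :: "'a::euclidean_space"
  assumes "norm h * 2 ^ n \<le> 1"
  shows "integrable lborel (\<lambda>y. \<bar>dyadic_kernel n (y + h) - dyadic_kernel n y\<bar>)"
    and "(LINT y|lborel. \<bar>dyadic_kernel n (y + h) - dyadic_kernel n y\<bar>) \<le> 2 * unit_ball_vol DIM('a) * DIM('a)"
proof -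
  let ?V = "unit_ball_vol DIM('a)" and ?N = "DIM('a)"
  let ?d = "\<lambda>i y. \<bar>indicator (ball 0 (1 / 2 ^ i)) (y + h) - indicator (ball 0 (1 / 2 ^ i)) y\<bar> :: real"
  have h: "norm h \<le> 1 / 2 ^ i" if "i < n" for i
  proof -
    have "norm h * 2 ^ i \<le> norm h * 2 ^ n" using that by (intro mult_left_mono power_increasing) auto
    then show ?thesis using assms by (simp add: field_simps)
  qed
  have le: "\<bar>dyadic_kernel n (y + h) - dyadic_kernel n y\<bar> \<le> (\<Sum>i<n. 2 ^ (i * ?N) * ?d i y)" for y
    unfolding dyadic_kernel_def sum_subtractf[symmetric] right_diff_distrib[symmetric]
    by (rule order_trans[OF sum_abs]) (simp add: abs_mult)
  have iS: "integrable lborel (\<lambda>y. \<Sum>i<n. 2 ^ (i * ?N) * ?d i y)"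
    by (intro Bochner_Integration.integrable_sum integrable_mult_right integral_indicator_ball_translate_diff h) auto
  show i: "integrable lborel (\<lambda>y. \<bar>dyadic_kernel n (y + h) - dyadic_kernel n y\<bar>)"
    by (rule Bochner_Integration.integrable_bound[OF iS])
      (use le in \<open>auto intro!: AE_I2 intro: order_trans[OF _ abs_ge_self]\<close>)
  have "(LINT y|lborel. \<bar>dyadic_kernel n (y + h) - dyadic_kernel n y\<bar>) \<le> (LINT y|lborel. (\<Sum>i<n. 2 ^ (i * ?N) * ?d i y))"
    by (intro integral_mono i iS le)
  also have "\<dots> = (\<Sum>i<n. 2 ^ (i * ?N) * (LINT y|lborel. ?d i y))"
    by (subst Bochner_Integration.integral_sum) (auto intro!: integrable_mult_right integral_indicator_ball_translate_diff h)
  also have "\<dots> \<le> (\<Sum>i<n. 2 ^ (i * ?N) * (2 * ?V * ?N * norm h * (1 / 2 ^ i) ^ (?N - 1)))"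
    by (intro sum_mono mult_left_mono integral_indicator_ball_translate_diff h) auto
  also have "\<dots> = (\<Sum>i<n. 2 * ?V * ?N * norm h * 2 ^ i)"
  proof (intro sum.cong refl)
    fix i
    obtain M where M: "?N = Suc M" using DIM_positive[where 'a='a] gr0_implies_Suc by blast
    have "(2::real) ^ (i * ?N) = 2 ^ i * (2 ^ i) ^ (?N - 1)" by (simp add: M power_add power_mult)
    then show "2 ^ (i * ?N) * (2 * ?V * ?N * norm h * (1 / 2 ^ i) ^ (?N - 1)) = 2 * ?V * ?N * norm h * 2 ^ i"
      by (simp add: power_divide)
  qed
  also have "\<dots> = 2 * ?V * ?N * norm h * (2 ^ n - 1)"
  proof -
    have "(\<Sum>i<n. 2 ^ i :: real) = 2 ^ n - 1" by (induction n) auto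
    then show ?thesis by (simp add: sum_distrib_left[symmetric])
  qed
  also have "\<dots> \<le> 2 * ?V * ?N * 1"
  proof -
    have "norm h * (2 ^ n - 1) \<le> norm h * 2 ^ n" by (intro mult_left_mono) auto
    then have "norm h * (2 ^ n - 1) \<le> 1" using assms by linarith
    then have "2 * ?V * ?N * (norm h * (2 ^ n - 1)) \<le> 2 * ?V * ?N * 1" by (intro mult_left_mono) auto
    then show ?thesis by (simp only: mult_ac)
  qed
  finally show "(LINT y|lborel. \<bar>dyadic_kernel n (y + h) - dyadic_kernel n y\<bar>) \<le> 2 * ?V * ?N" by simp
qed

section \<open>Upper bounds for integrals against the kernel\<close>

lemma J_zero [simp]: "J 0 = 0"
  by (simp add: J_def)

text \<open>The estimate is one-sided: \<open>ennreal\<close> sends negative values to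
  \<open>0\<close>, so the integral sees only the positive part of \<open>h\<close>. Naming the
  property keeps \<open>C\<close> outside the quantifiers over \<open>H\<close>,
  \<open>\<Lambda>\<close> and \<open>h\<close>.\<close>

definition dyadic_J_bound :: "real \<Rightarrow> (real \<Rightarrow> real) \<Rightarrow> real \<Rightarrow> ('a::euclidean_space \<Rightarrow> real) \<Rightarrow> bool" where
  "dyadic_J_bound C H \<Lambda> h \<longleftrightarrow> (h \<in> borel_measurable borel \<longrightarrow> (\<forall>y. h y \<le> H (norm y)) \<longrightarrow> mono H \<longrightarrow>
     (\<forall>r. H r \<le> \<Lambda>) \<longrightarrow> (\<forall>r\<ge>0. 0 \<le> H r) \<longrightarrow>
     (\<integral>\<^sup>+y. ennreal (h y * J y) \<partial>lborel) \<le> ennreal C * ((\<Sum>i. ennreal (H (1 / 2 ^ i))) + ennreal \<Lambda>))"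

text \<open>On the shell with \<open>norm y\<close> between \<open>1 / 2 ^ Suc i\<close> and
  \<open>1 / 2 ^ i\<close> the kernel is at most of the order of the inverse of the volume, so the
  shell contributes at most a multiple of \<open>H (1 / 2 ^ i)\<close>. Outside the unit ball the
  bound \<open>\<Lambda>\<close> and the faster decay of \<open>J\<close> leave a geometric
  series.\<close>

lemma nn_integral_J_le: "\<exists>C>0. \<forall>H \<Lambda>. \<forall>h :: 'a::euclidean_space \<Rightarrow> real. dyadic_J_bound C H \<Lambda> h"
proof -
  let ?V = "unit_ball_vol DIM('a)" and ?N = "DIM('a)"
  obtain C where "C > 0" and C: "\<And>y::'a. y \<noteq> 0 \<Longrightarrow> J y \<le> C / norm y ^ ?N"
      "\<And>y::'a. y \<noteq> 0 \<Longrightarrow> J y \<le> C / norm y ^ Suc ?N"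
    using J_upper by blast
  have V: "?V > 0" by simp
  define D where "D = 2 * C * ?V * 2 ^ ?N"
  have "D > 0" using \<open>C > 0\<close> V by (simp add: D_def)
  have "(\<integral>\<^sup>+y. ennreal (h y * J y) \<partial>lborel) \<le> ennreal D * ((\<Sum>i. ennreal (H (1 / 2 ^ i))) + ennreal \<Lambda>)"
    if h: "h \<in> borel_measurable borel" "\<forall>y. h y \<le> H (norm y)" "mono H" "\<forall>r. H r \<le> \<Lambda>" and Hnn: "\<forall>r\<ge>0. 0 \<le> H r" for h :: "'a \<Rightarrow> real" and H \<Lambda>
  proof -
    have "\<Lambda> \<ge> 0" using Hnn h(4) order_trans by blast
    \<comment> \<open>Full balls stand in for the shells: only an upper bound is sought, and the
      volumes are of the same order.\<close>
    define a where "a i y = ennreal (C * 2 ^ ?N * (2 ^ i) ^ ?N * H (1 / 2 ^ i)) * indicator (cball 0 (1 / 2 ^ i)) y" for i and y :: 'a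
    define b where "b i y = ennreal (C * \<Lambda> * (1 / 2 ^ i) ^ Suc ?N) * indicator (cball 0 (2 ^ Suc i)) y" for i and y :: 'a
    have ma [measurable]: "a i \<in> borel_measurable borel" and mb [measurable]: "b i \<in> borel_measurable borel" for i
      unfolding a_def b_def
      by (intro borel_measurable_times_ennreal borel_measurable_const borel_measurable_indicator; simp)+
    have pw: "ennreal (h y * J y) \<le> (\<Sum>i. a i y) + (\<Sum>i. b i y)" for y :: 'a
    proof (cases "y = 0")
      case False
      show ?thesis
      proof (cases "norm y \<le> 1")
        case True
        then have "1 \<le> 1 / norm y" using False by (simp add: field_simps)
        then obtain i where i: "2 ^ i \<le> 1 / norm y" "1 / norm y < 2 ^ Suc i" using power_of_two_bracket by metis
        have n: "norm y \<le> 1 / 2 ^ i" using i(1) False by (simp add: field_simps)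
        have "h y \<le> H (1 / 2 ^ i)" using h(2) monoD[OF h(3) n] order_trans by blast
        then have "h y * J y \<le> H (1 / 2 ^ i) * J y" by (intro mult_right_mono) auto
        also have "J y \<le> C * (2 ^ Suc i) ^ ?N"
        proof -
          have "J y \<le> C * (1 / norm y) ^ ?N" using C(1)[OF False] by (simp add: power_divide)
          also have "\<dots> \<le> C * (2 ^ Suc i) ^ ?N" using i \<open>C > 0\<close> by (intro mult_left_mono power_mono) auto
          finally show ?thesis .
        qed
        finally have "h y * J y \<le> H (1 / 2 ^ i) * (C * (2 ^ Suc i) ^ ?N)"
          using Hnn by (simp add: mult_left_mono)
        then have "h y * J y \<le> C * 2 ^ ?N * (2 ^ i) ^ ?N * H (1 / 2 ^ i)"
          by (simp add: power_mult_distrib mult_ac)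
        then have "ennreal (h y * J y) \<le> a i y" using n by (simp add: a_def ennreal_leI)
        also have "\<dots> \<le> (\<Sum>i. a i y)" using sum_le_suminf[of "\<lambda>i. a i y" "{i}"] by simp
        finally show ?thesis by (simp add: add_increasing2)
      next
        case False
        then obtain i where i: "2 ^ i \<le> norm y" "norm y < 2 ^ Suc i" using power_of_two_bracket[of "norm y"] by auto
        have y0: "y \<noteq> 0" using False by auto
        have "h y \<le> \<Lambda>" using h order_trans by blast
        then have "h y * J y \<le> \<Lambda> * J y" by (intro mult_right_mono) auto
        also have "J y \<le> C * (1 / 2 ^ i) ^ Suc ?N"
        proof -
          have "C / norm y ^ Suc ?N \<le> C / (2 ^ i) ^ Suc ?N"
            using i \<open>C > 0\<close> y0 by (intro divide_left_mono power_mono) auto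
          then show ?thesis using C(2)[OF y0] by (simp only: power_divide power_one times_divide_eq_right mult_1_right)
        qed
        finally have "h y * J y \<le> \<Lambda> * (C * (1 / 2 ^ i) ^ Suc ?N)"
          using \<open>\<Lambda>\<ge>0\<close> by (simp add: mult_left_mono)
        then have "h y * J y \<le> C * \<Lambda> * (1 / 2 ^ i) ^ Suc ?N" by (simp only: mult_ac)
        then have "ennreal (h y * J y) \<le> b i y" using i by (simp add: b_def ennreal_leI)
        also have "\<dots> \<le> (\<Sum>i. b i y)" using sum_le_suminf[of "\<lambda>i. b i y" "{i}"] by simp
        finally show ?thesis by (simp add: add_increasing)
      qed
    qed simp
    have A: "(\<integral>\<^sup>+y. a i y \<partial>lborel) = ennreal (C * 2 ^ ?N * ?V) * ennreal (H (1 / 2 ^ i))" for i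
    proof -
      have "(\<integral>\<^sup>+y. a i y \<partial>lborel) = ennreal (C * 2 ^ ?N * (2 ^ i) ^ ?N * H (1 / 2 ^ i)) * ennreal (?V * (1 / 2 ^ i) ^ ?N)"
        unfolding a_def by (subst nn_integral_cmult_indicator) (auto simp: emeasure_cball)
      also have "\<dots> = ennreal (C * 2 ^ ?N * (2 ^ i) ^ ?N * H (1 / 2 ^ i) * (?V * (1 / 2 ^ i) ^ ?N))"
        using \<open>C>0\<close> Hnn by (intro ennreal_mult[symmetric]) auto
      also have "C * 2 ^ ?N * (2 ^ i) ^ ?N * H (1 / 2 ^ i) * (?V * (1 / 2 ^ i) ^ ?N) = C * 2 ^ ?N * ?V * H (1 / 2 ^ i)"
        by (simp add: power_divide)
      also have "ennreal \<dots> = ennreal (C * 2 ^ ?N * ?V) * ennreal (H (1 / 2 ^ i))"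
        using \<open>C>0\<close> Hnn by (intro ennreal_mult) auto
      finally show ?thesis .
    qed
    have B: "(\<integral>\<^sup>+y. b i y \<partial>lborel) = ennreal (C * 2 ^ ?N * ?V * \<Lambda> * (1/2) ^ i)" for i
    proof -
      have "(\<integral>\<^sup>+y. b i y \<partial>lborel) = ennreal (C * \<Lambda> * (1 / 2 ^ i) ^ Suc ?N) * ennreal (?V * (2 ^ Suc i) ^ ?N)"
        unfolding b_def by (subst nn_integral_cmult_indicator) (auto simp: emeasure_cball)
      also have "\<dots> = ennreal (C * \<Lambda> * (1 / 2 ^ i) ^ Suc ?N * (?V * (2 ^ Suc i) ^ ?N))"
        using \<open>C>0\<close> \<open>\<Lambda>\<ge>0\<close> by (intro ennreal_mult[symmetric]) auto
      also have "C * \<Lambda> * (1 / 2 ^ i) ^ Suc ?N * (?V * (2 ^ Suc i) ^ ?N) = C * 2 ^ ?N * ?V * \<Lambda> * (1/2) ^ i"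
        by (simp add: power_divide power_mult_distrib)
      finally show ?thesis .
    qed
    have gs: "(\<lambda>i. C * 2 ^ ?N * ?V * \<Lambda> * (1/2) ^ i) sums (C * 2 ^ ?N * ?V * \<Lambda> * 2)"
      using geometric_sums[of "1/2::real"] by (intro sums_mult) simp
    have "(\<integral>\<^sup>+y. ennreal (h y * J y) \<partial>lborel) \<le> (\<integral>\<^sup>+y. (\<Sum>i. a i y) + (\<Sum>i. b i y) \<partial>lborel)"
      by (intro nn_integral_mono pw)
    also have "\<dots> = (\<integral>\<^sup>+y. (\<Sum>i. a i y) \<partial>lborel) + (\<integral>\<^sup>+y. (\<Sum>i. b i y) \<partial>lborel)"
      by (intro nn_integral_add) measurable
    also have "(\<integral>\<^sup>+y. (\<Sum>i. a i y) \<partial>lborel) = (\<Sum>i. ennreal (C * 2 ^ ?N * ?V) * ennreal (H (1 / 2 ^ i)))"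
      by (subst nn_integral_suminf) (auto simp: A[symmetric])
    also have "(\<integral>\<^sup>+y. (\<Sum>i. b i y) \<partial>lborel) = (\<Sum>i. ennreal (C * 2 ^ ?N * ?V * \<Lambda> * (1/2) ^ i))"
      by (subst nn_integral_suminf) (auto simp: B[symmetric])
    also have "\<dots> = ennreal (C * 2 ^ ?N * ?V * \<Lambda> * 2)"
      using \<open>C>0\<close> \<open>\<Lambda>\<ge>0\<close> gs by (intro suminf_ennreal_eq) auto
    also have "(\<Sum>i. ennreal (C * 2 ^ ?N * ?V) * ennreal (H (1 / 2 ^ i))) = ennreal (C * 2 ^ ?N * ?V) * (\<Sum>i. ennreal (H (1 / 2 ^ i)))"
      by simp
    also have "\<dots> \<le> ennreal D * (\<Sum>i. ennreal (H (1 / 2 ^ i)))"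
      using \<open>C>0\<close> by (intro mult_right_mono ennreal_leI) (auto simp: D_def)
    also have "ennreal (C * 2 ^ ?N * ?V * \<Lambda> * 2) = ennreal D * ennreal \<Lambda>"
      using \<open>C>0\<close> \<open>\<Lambda>\<ge>0\<close> by (simp add: D_def ennreal_mult[symmetric] mult_ac)
    finally show ?thesis by (simp add: distrib_left)
  qed
  then show ?thesis using \<open>D > 0\<close> unfolding dyadic_J_bound_def by blast
qed

section \<open>The energy form\<close>

abbreviation lborel2 :: "('a::euclidean_space \<times> 'a) measure" where
  "lborel2 \<equiv> lborel \<Otimes>\<^sub>M lborel"

section \<open>Reflections and translations of Lebesgue measure\<close>

lemma lborel_reflect:
  fixes c :: "'a::euclidean_space"
  shows "distr lborel borel (\<lambda>y. c - y) = lborel"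
  using lborel_affine[of "-1" c] by (simp add: density_1)

lemma lborel_translate:
  fixes c :: "'a::euclidean_space"
  shows "distr lborel borel (\<lambda>y. y + c) = lborel"
proof -
  have "(\<lambda>y. y + c) = (+) c" by (auto simp: add.commute)
  then show ?thesis using lborel_distr_plus[of c] by simp
qed

lemma nn_integral_lborel_reflect:
  fixes f :: "'a::euclidean_space \<Rightarrow> ennreal"
  assumes "f \<in> borel_measurable borel"
  shows "(\<integral>\<^sup>+y. f (c - y) \<partial>lborel) = (\<integral>\<^sup>+y. f y \<partial>lborel)"
  by (subst (2) lborel_reflect[of c, symmetric], subst nn_integral_distr) (use assms in auto)

lemma integral_lborel_reflect:
  fixes f :: "'a::euclidean_space \<Rightarrow> real"
  assumes "f \<in> borel_measurable borel"
  shows "(LINT y|lborel. f (c - y)) = (LINT y|lborel. f y)"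
  by (subst (2) lborel_reflect[of c, symmetric], subst integral_distr) (use assms in auto)

lemma integrable_lborel_reflect:
  fixes f :: "'a::euclidean_space \<Rightarrow> real"
  assumes "integrable lborel f"
  shows "integrable lborel (\<lambda>y. f (c - y))"
  using assms by (subst (asm) lborel_reflect[of c, symmetric], subst (asm) integrable_distr_eq) auto

lemma integral_lborel_translate:
  fixes f :: "'a::euclidean_space \<Rightarrow> real"
  assumes "f \<in> borel_measurable borel"
  shows "(LINT y|lborel. f (y + c)) = (LINT y|lborel. f y)"
  by (subst (2) lborel_translate[of c, symmetric], subst integral_distr) (use assms in auto)

lemma integrable_lborel_translate:
  fixes f :: "'a::euclidean_space \<Rightarrow> real"
  assumes "integrable lborel f"
  shows "integrable lborel (\<lambda>y. f (y + c))"
  using assms by (subst (asm) lborel_translate[of c, symmetric], subst (asm) integrable_distr_eq) auto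

lemma AE_lborel_translate:
  fixes c :: "'a::euclidean_space"
  assumes "AE x in lborel. P x"
  shows "AE x in lborel. P (x + c)"
proof -
  have "AE x in distr lborel borel (\<lambda>y. y + c). P x" unfolding lborel_translate by (rule assms)
  then show ?thesis by (rule AE_distrD[rotated]) simp
qed

lemma integrable_pair_translate:
  fixes F :: "'a::euclidean_space \<times> 'a \<Rightarrow> real"
  assumes "integrable lborel2 F"
  shows "integrable lborel2 (\<lambda>p. F (fst p + c, snd p + c))"
proof -
  have "(\<lambda>p. F (fst p + c, snd p + c)) = (\<lambda>p. F (p + (c, c)))" by (auto simp: fun_eq_iff)
  then show ?thesis using integrable_lborel_translate[of F "(c, c)"] assms unfolding lborel_prod by simp
qed

lemma integral_pair_translate:
  fixes F :: "'a::euclidean_space \<times> 'a \<Rightarrow> real"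
  assumes "F \<in> borel_measurable lborel2"
  shows "(LINT p|lborel2. F (fst p + c, snd p + c)) = (LINT p|lborel2. F p)"
proof -
  have "(\<lambda>p. F (fst p + c, snd p + c)) = (\<lambda>p. F (p + (c, c)))" by (auto simp: fun_eq_iff)
  then show ?thesis using integral_lborel_translate[of F "(c, c)"] assms unfolding lborel_prod by simp
qed

section \<open>The energy form for Borel functions\<close>

abbreviation incr :: "('a \<Rightarrow> real) \<Rightarrow> 'a \<times> 'a \<Rightarrow> real" where
  "incr u p \<equiv> u (fst p) - u (snd p)"

text \<open>One integral over a product of Borel measures, in place of the iterated integrals over
  \<open>lebesgue\<close> in \<open>energy\<close>: Fubini and the exchange of the two variables
  then apply directly.\<close>

definition bform :: "('a::euclidean_space \<Rightarrow> real) \<Rightarrow> ('a \<Rightarrow> real) \<Rightarrow> real" where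
  "bform u v = 1 / 2 *
    (LINT p|lborel2. incr u p * incr v p * J (fst p - snd p))"

text \<open>No support condition is imposed, so that translates of a solution and their differences
  stay in the class.\<close>

definition fin_energy :: "('a::euclidean_space \<Rightarrow> real) \<Rightarrow> bool" where
  "fin_energy u \<longleftrightarrow> u \<in> borel_measurable borel \<and>
    integrable lborel2 (\<lambda>p. (incr u p)\<^sup>2 * J (fst p - snd p))"

text \<open>Vanishing outside \<open>\<Omega>\<close> is required at every point, not almost
  everywhere, so that later case distinctions on membership in \<open>\<Omega>\<close> are
  pointwise.\<close>

definition test_fun :: "'a::euclidean_space set \<Rightarrow> ('a \<Rightarrow> real) \<Rightarrow> bool" where
  "test_fun \<Omega> \<phi> \<longleftrightarrow> fin_energy \<phi> \<and> integrable lborel (\<lambda>x. (\<phi> x)\<^sup>2) \<and> (\<forall>x. x \<notin> \<Omega> \<longrightarrow> \<phi> x = 0)"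

text \<open>The right-hand side is a given function: once the solution is known to be bounded, the
  nonlinearity is frozen and all regularity estimates concern a linear problem.\<close>

definition wsol :: "'a::euclidean_space set \<Rightarrow> ('a \<Rightarrow> real) \<Rightarrow> ('a \<Rightarrow> real) \<Rightarrow> bool" where
  "wsol \<Omega> f u \<longleftrightarrow> test_fun \<Omega> u \<and> (\<forall>\<phi>. test_fun \<Omega> \<phi> \<longrightarrow> bform u \<phi> = (LINT x|lborel. f x * \<phi> x))"

lemma fin_energy_measurable [measurable_dest]: "fin_energy u \<Longrightarrow> u \<in> borel_measurable borel"
  by (simp add: fin_energy_def)

lemma test_fun_measurable [measurable_dest]: "test_fun \<Omega> u \<Longrightarrow> u \<in> borel_measurable borel"
  by (simp add: test_fun_def fin_energy_def)

lemma abs_mult_le_sum_squares: "\<bar>a * b\<bar> \<le> a\<^sup>2 + b\<^sup>2" for a b :: real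
proof -
  have "2 * (\<bar>a\<bar> * \<bar>b\<bar>) \<le> a\<^sup>2 + b\<^sup>2" using sum_squares_bound[of "\<bar>a\<bar>" "\<bar>b\<bar>"] by simp
  moreover have "0 \<le> \<bar>a\<bar> * \<bar>b\<bar>" by simp
  ultimately show ?thesis unfolding abs_mult by linarith
qed

lemma bform_integrable:
  assumes u: "fin_energy u" and v: "fin_energy v"
  shows "integrable lborel2 (\<lambda>p. incr u p * incr v p * J (fst p - snd p))"
proof (rule Bochner_Integration.integrable_bound)
  show "integrable lborel2 (\<lambda>p. (incr u p)\<^sup>2 * J (fst p - snd p) + (incr v p)\<^sup>2 * J (fst p - snd p))"
    using assms by (auto simp: fin_energy_def)
  have [measurable]: "u \<in> borel_measurable borel" "v \<in> borel_measurable borel" using assms by (auto simp: fin_energy_def)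
  show "(\<lambda>p. incr u p * incr v p * J (fst p - snd p)) \<in> borel_measurable lborel2"
    by measurable
  have "\<bar>a * b * j\<bar> \<le> \<bar>a\<^sup>2 * j + b\<^sup>2 * j\<bar>" if "0 \<le> j" for a b j :: real
  proof -
    have "\<bar>a * b * j\<bar> = \<bar>a * b\<bar> * j" using that by (simp add: abs_mult)
    also have "\<dots> \<le> (a\<^sup>2 + b\<^sup>2) * j" by (rule mult_right_mono[OF abs_mult_le_sum_squares that])
    also have "\<dots> = a\<^sup>2 * j + b\<^sup>2 * j" by (rule distrib_right)
    finally show ?thesis by linarith
  qed
  then show "AE p in lborel2. norm (incr u p * incr v p * J (fst p - snd p))
     \<le> norm ((incr u p)\<^sup>2 * J (fst p - snd p) + (incr v p)\<^sup>2 * J (fst p - snd p))"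
    unfolding real_norm_def by (intro AE_I2) (use J_nonneg in blast)
qed

lemma fin_energy_iff_nn_integral:
  assumes [measurable]: "u \<in> borel_measurable borel"
  shows "fin_energy u \<longleftrightarrow> (\<integral>\<^sup>+x. \<integral>\<^sup>+y. ennreal ((u x - u y)\<^sup>2 * J (x - y)) \<partial>lborel \<partial>lborel) < \<infinity>"
proof -
  have "(\<integral>\<^sup>+x. \<integral>\<^sup>+y. ennreal ((u x - u y)\<^sup>2 * J (x - y)) \<partial>lborel \<partial>lborel)
      = (\<integral>\<^sup>+p. ennreal ((incr u p)\<^sup>2 * J (fst p - snd p)) \<partial>lborel2)"
    by (subst lborel.nn_integral_fst[symmetric]) auto
  then show ?thesis
    by (simp add: fin_energy_def integrable_iff_bounded)
qed

lemma nn_energy_cong: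
  fixes u u' :: "'a::euclidean_space \<Rightarrow> real"
  assumes ae: "AE x in lborel. u x = u' x"
  shows "(\<integral>\<^sup>+x. \<integral>\<^sup>+y. ennreal ((u x - u y)\<^sup>2 * J (x - y)) \<partial>lebesgue \<partial>lebesgue)
    = (\<integral>\<^sup>+x. \<integral>\<^sup>+y. ennreal ((u' x - u' y)\<^sup>2 * J (x - y)) \<partial>lborel \<partial>lborel)"
proof -
  have "(\<integral>\<^sup>+y. ennreal ((u x - u y)\<^sup>2 * J (x - y)) \<partial>lborel) = (\<integral>\<^sup>+y. ennreal ((u' x - u' y)\<^sup>2 * J (x - y)) \<partial>lborel)"
    if "u x = u' x" for x
    using ae that by (intro nn_integral_cong_AE) auto
  then show ?thesis unfolding nn_integral_completion
    using ae by (intro nn_integral_cong_AE) auto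
qed

text \<open>Changing \<open>u\<close> on a null set affects the inner integral only for
  \<open>x\<close> in that set. Finite energy enters through Fubini, since iterated and double
  Bochner integrals are known to agree for integrable functions.\<close>

lemma energy_eq_bform:
  fixes u u' v :: "'a::euclidean_space \<Rightarrow> real"
  assumes u: "u \<in> borel_measurable lebesgue" and ae: "AE x in lborel. u x = u' x"
    and fin: "fin_energy u'" "fin_energy v"
  shows "energy u v = bform u' v"
proof -
  have [measurable]: "u' \<in> borel_measurable borel" "v \<in> borel_measurable borel" using fin by (auto simp: fin_energy_def)
  define G where "G x y = (u' x - u' y) * (v x - v y) * J (x - y)" for x y
  define I where "I x = (LINT y|lborel. G x y)" for x
  have Gm [measurable]: "(\<lambda>p. G (fst p) (snd p)) \<in> borel_measurable (borel \<Otimes>\<^sub>M borel)" unfolding G_def by measurable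
  have Im [measurable]: "I \<in> borel_measurable borel" unfolding I_def by measurable
  have ae': "AE x in lebesgue. u x = u' x" using ae by (rule AE_completion)
  have "(LINT y|lebesgue. (u x - u y) * (v x - v y) * J (x - y)) = I x" if "u x = u' x" for x
  proof -
    have "(LINT y|lebesgue. (u x - u y) * (v x - v y) * J (x - y)) = (LINT y|lebesgue. G x y)"
    proof (rule integral_cong_AE)
      show "(\<lambda>y. (u x - u y) * (v x - v y) * J (x - y)) \<in> borel_measurable lebesgue"
      proof (intro borel_measurable_times borel_measurable_diff borel_measurable_const u)
        show "v \<in> borel_measurable lebesgue" by (intro measurable_completion) measurable
        show "(\<lambda>y. J (x - y)) \<in> borel_measurable lebesgue" by (intro measurable_completion) measurable
      qed
      show "G x \<in> borel_measurable lebesgue" unfolding G_def by (intro measurable_completion) measurable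
      show "AE y in lebesgue. (u x - u y) * (v x - v y) * J (x - y) = G x y"
        using ae' that by (auto simp: G_def)
    qed
    also have "\<dots> = I x" unfolding I_def G_def by (rule integral_completion) measurable
    finally show ?thesis .
  qed
  then have aeI: "AE x in lebesgue. I x = (LINT y|lebesgue. (u x - u y) * (v x - v y) * J (x - y))"
    using ae' by auto
  have Il: "I \<in> borel_measurable lebesgue" by (intro measurable_completion) measurable
  have "(LINT x|lebesgue. LINT y|lebesgue. (u x - u y) * (v x - v y) * J (x - y)) = (LINT x|lebesgue. I x)"
    using aeI by (intro integral_cong_AE borel_measurable_AE[OF Il aeI] Il) auto
  also have "\<dots> = (LINT x|lborel. I x)" by (rule integral_completion) measurable
  also have "\<dots> = (LINT p|lborel2. G (fst p) (snd p))"
    using lborel_pair.integral_fst'[of "\<lambda>p. G (fst p) (snd p)"] bform_integrable[OF fin]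
    by (simp add: I_def G_def)
  finally show ?thesis by (simp add: energy_def bform_def G_def)
qed

lemma set_integral_lebesgue_eq:
  fixes F G :: "'a::euclidean_space \<Rightarrow> real"
  assumes [measurable]: "G \<in> borel_measurable borel" "\<Omega> \<in> sets borel" and F: "F \<in> borel_measurable lebesgue"
    and ae: "AE x in lborel. F x = G x"
  shows "(LINT x:\<Omega>|lebesgue. F x) = (LINT x|lborel. indicator \<Omega> x * G x)"
proof -
  have "(LINT x:\<Omega>|lebesgue. F x) = (LINT x|lebesgue. indicator \<Omega> x * G x)"
    unfolding set_lebesgue_integral_def real_scaleR_def
  proof (intro integral_cong_AE borel_measurable_times F)
    show "indicator \<Omega> \<in> borel_measurable lebesgue" "G \<in> borel_measurable lebesgue"
      by (intro measurable_completion; measurable)+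
    show "AE x in lebesgue. indicator \<Omega> x * F x = indicator \<Omega> x * G x" using AE_completion[OF ae] by auto
  qed (intro measurable_completion, measurable)
  also have "\<dots> = (LINT x|lborel. indicator \<Omega> x * G x)" by (rule integral_completion) measurable
  finally show ?thesis .
qed

lemma H0_ln_representative:
  assumes u: "u \<in> H0_ln \<Omega>" and [measurable]: "\<Omega> \<in> sets borel"
  obtains u' where "test_fun \<Omega> u'" "AE x in lborel. u x = u' x"
proof -
  have um: "u \<in> borel_measurable lebesgue" using u by (auto simp: H0_ln_def H_ln_def)
  obtain w where w [measurable]: "w \<in> borel_measurable lborel" and ae: "AE x in lborel. u x = w x"
    using completion_ex_borel_measurable_real[OF um] by blast
  \<comment> \<open>The indicator turns vanishing almost everywhere outside \<open>\<Omega>\<close>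
    into vanishing everywhere there.\<close>
  define u' where "u' x = indicator \<Omega> x * w x" for x
  have [measurable]: "u' \<in> borel_measurable borel" unfolding u'_def by measurable
  have "AE x in lborel. x \<notin> \<Omega> \<longrightarrow> u x = 0" using u by (simp add: H0_ln_def AE_completion_iff)
  then have ae': "AE x in lborel. u x = u' x" using ae by eventually_elim (auto simp: u'_def indicator_def)
  have "integrable lebesgue (\<lambda>x. (u' x)\<^sup>2)"
  proof (subst integrable_cong_AE)
    show "AE x in lebesgue. (u' x)\<^sup>2 = (u x)\<^sup>2" using AE_completion[OF ae'] by auto
    show "integrable lebesgue (\<lambda>x. (u x)\<^sup>2)" "(\<lambda>x. (u x)\<^sup>2) \<in> borel_measurable lebesgue"
      using u by (auto simp: H0_ln_def H_ln_def)
    show "(\<lambda>x. (u' x)\<^sup>2) \<in> borel_measurable lebesgue" by (intro measurable_completion) measurable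
  qed
  then have "integrable lborel (\<lambda>x. (u' x)\<^sup>2)" by (subst (asm) integrable_completion) auto
  moreover have "fin_energy u'"
    unfolding fin_energy_iff_nn_integral[OF \<open>u' \<in> borel_measurable borel\<close>] nn_energy_cong[OF ae', symmetric]
    using u by (simp add: H0_ln_def H_ln_def)
  ultimately have "test_fun \<Omega> u'" by (auto simp: test_fun_def u'_def)
  then show ?thesis using ae' that by blast
qed

lemma test_fun_imp_H0_ln:
  assumes \<phi>: "test_fun \<Omega> \<phi>"
  shows "\<phi> \<in> H0_ln \<Omega>"
proof -
  have [measurable]: "\<phi> \<in> borel_measurable borel" using \<phi> by (auto simp: test_fun_def fin_energy_def)
  have "integrable lebesgue (\<lambda>x. (\<phi> x)\<^sup>2)" using \<phi> by (subst integrable_completion) (auto simp: test_fun_def)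
  moreover have "(\<integral>\<^sup>+ x. \<integral>\<^sup>+ y. ennreal ((\<phi> x - \<phi> y)\<^sup>2 * J (x - y)) \<partial>lebesgue \<partial>lebesgue) < \<infinity>"
    using \<phi> by (subst nn_energy_cong[of \<phi> \<phi>]) (auto simp: test_fun_def fin_energy_iff_nn_integral)
  moreover have "\<phi> \<in> borel_measurable lebesgue" by (intro measurable_completion) measurable
  ultimately show ?thesis using \<phi> by (auto simp: H0_ln_def H_ln_def test_fun_def)
qed

text \<open>Both forms are compared with \<open>energy\<close>, whose first argument tolerates
  changes on null sets.\<close>

lemma wsol_cong_AE:
  assumes sol: "wsol \<Omega> f u" and [measurable]: "u' \<in> borel_measurable borel"
    and ae: "AE x in lborel. u x = u' x" and z: "\<And>x. x \<notin> \<Omega> \<Longrightarrow> u' x = 0"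
  shows "wsol \<Omega> f u'"
proof -
  have tu: "test_fun \<Omega> u" using sol by (simp add: wsol_def)
  then have [measurable]: "u \<in> borel_measurable borel" and fu: "fin_energy u" by (auto simp: test_fun_def fin_energy_def)
  have "AE x in lborel. u' x = u' x" by simp
  have fu': "fin_energy u'"
    using fu nn_energy_cong[OF ae] nn_energy_cong[of u u] by (simp add: fin_energy_iff_nn_integral)
  have "integrable lborel (\<lambda>x. (u' x)\<^sup>2)"
    using tu ae by (subst integrable_cong_AE[of _ _ "\<lambda>x. (u x)\<^sup>2"]) (auto simp: test_fun_def)
  then have "test_fun \<Omega> u'" using fu' z by (auto simp: test_fun_def)
  moreover have "bform u' \<phi> = bform u \<phi>" if "test_fun \<Omega> \<phi>" for \<phi>
  proof -
    have "fin_energy \<phi>" using that by (simp add: test_fun_def)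
    moreover have "u \<in> borel_measurable lebesgue" by (intro measurable_completion) measurable
    ultimately show ?thesis using energy_eq_bform[of u u' \<phi>] energy_eq_bform[of u u \<phi>] fu fu' ae by simp
  qed
  ultimately show ?thesis using sol by (auto simp: wsol_def)
qed

lemma test_fun_uminus: "test_fun \<Omega> u \<Longrightarrow> test_fun \<Omega> (\<lambda>x. - u x)"
proof -
  have e: "(- a - - b)\<^sup>2 = (a - b)\<^sup>2" for a b :: real by (simp add: power2_eq_square algebra_simps)
  assume "test_fun \<Omega> u"
  then show ?thesis unfolding test_fun_def fin_energy_def e by auto
qed

lemma bform_uminus_left: "bform (\<lambda>x. - u x) v = - bform u v"
proof -
  have "(- u (fst p) - - u (snd p)) * incr v p * J (fst p - snd p)
    = - (incr u p * incr v p * J (fst p - snd p))" for p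
    by (simp add: algebra_simps)
  then show ?thesis unfolding bform_def by (simp only: Bochner_Integration.integral_minus mult_minus_right)
qed

lemma wsol_uminus: "wsol \<Omega> f u \<Longrightarrow> wsol \<Omega> (\<lambda>x. - f x) (\<lambda>x. - u x)"
  by (auto simp: wsol_def test_fun_uminus bform_uminus_left)

text \<open>Splitting the product and swapping the variables in one of the two halves.\<close>

lemma symmetric_kernel_form:
  fixes k :: "'a::euclidean_space \<Rightarrow> real"
  assumes A: "integrable lborel2 (\<lambda>p. \<phi> (fst p) * (incr z p * k (fst p - snd p)))"
    and sym: "\<And>x y. k (x - y) = k (y - x)"
  shows "integrable lborel2 (\<lambda>p. incr z p * incr \<phi> p * k (fst p - snd p))"
    and "1 / 2 * (LINT p|lborel2. incr z p * incr \<phi> p * k (fst p - snd p))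
      = (LINT x|lborel. \<phi> x * (LINT y|lborel. (z x - z y) * k (x - y)))"
    and "integrable lborel (\<lambda>x. \<phi> x * (LINT y|lborel. (z x - z y) * k (x - y)))"
proof -
  define a where "a p = \<phi> (fst p) * (incr z p * k (fst p - snd p))" for p
  have a: "integrable lborel2 a" using A by (simp add: a_def[abs_def])
  have s: "integrable lborel2 (\<lambda>p. a (snd p, fst p))"
    using lborel_pair.integrable_product_swap[OF a] by (simp add: case_prod_unfold)
  have sI: "(LINT p|lborel2. a (snd p, fst p)) = (LINT p|lborel2. a p)"
    using lborel_pair.integral_product_swap[of a] a by (simp add: case_prod_unfold)
  have eq: "incr z p * incr \<phi> p * k (fst p - snd p) = a p + a (snd p, fst p)" for p
    using sym[of "fst p" "snd p"] by (simp add: a_def algebra_simps)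
  show "integrable lborel2 (\<lambda>p. incr z p * incr \<phi> p * k (fst p - snd p))"
    unfolding eq using a s by simp
  have I: "(LINT x|lborel. LINT y|lborel. a (x, y)) = (LINT p|lborel2. a p)"
    by (rule lborel_pair.integral_fst'[OF a])
  show "1 / 2 * (LINT p|lborel2. incr z p * incr \<phi> p * k (fst p - snd p))
      = (LINT x|lborel. \<phi> x * (LINT y|lborel. (z x - z y) * k (x - y)))"
    unfolding eq Bochner_Integration.integral_add[OF a s] sI I[symmetric] by (simp add: a_def)
  show "integrable lborel (\<lambda>x. \<phi> x * (LINT y|lborel. (z x - z y) * k (x - y)))"
    using lborel_pair.integrable_fst'[OF a] by (simp add: a_def)
qed

lemma integrable_pair_bounded_fibres:
  fixes \<phi> :: "'a::euclidean_space \<Rightarrow> real" and g :: "'a \<times> 'a \<Rightarrow> real"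
  assumes \<phi>: "integrable lborel \<phi>" and [measurable]: "g \<in> borel_measurable (borel \<Otimes>\<^sub>M borel)"
    and B: "\<And>x. \<phi> x \<noteq> 0 \<Longrightarrow> (\<integral>\<^sup>+y. ennreal \<bar>g (x, y)\<bar> \<partial>lborel) \<le> ennreal B"
  shows "integrable lborel2 (\<lambda>p. \<phi> (fst p) * g p)"
proof (rule integrableI_bounded)
  have [measurable]: "\<phi> \<in> borel_measurable borel" using \<phi> by auto
  show "(\<lambda>p. \<phi> (fst p) * g p) \<in> borel_measurable lborel2" by measurable
  have "(\<integral>\<^sup>+p. ennreal (norm (\<phi> (fst p) * g p)) \<partial>lborel2)
      = (\<integral>\<^sup>+x. \<integral>\<^sup>+y. ennreal \<bar>\<phi> x\<bar> * ennreal \<bar>g (x, y)\<bar> \<partial>lborel \<partial>lborel)"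
    by (subst lborel.nn_integral_fst[symmetric]) (auto simp: abs_mult ennreal_mult)
  also have "\<dots> = (\<integral>\<^sup>+x. ennreal \<bar>\<phi> x\<bar> * (\<integral>\<^sup>+y. ennreal \<bar>g (x, y)\<bar> \<partial>lborel) \<partial>lborel)"
    by (intro nn_integral_cong nn_integral_cmult) auto
  also have "\<dots> \<le> (\<integral>\<^sup>+x. ennreal \<bar>\<phi> x\<bar> * ennreal B \<partial>lborel)"
  proof (intro nn_integral_mono)
    fix x
    show "ennreal \<bar>\<phi> x\<bar> * (\<integral>\<^sup>+y. ennreal \<bar>g (x, y)\<bar> \<partial>lborel) \<le> ennreal \<bar>\<phi> x\<bar> * ennreal B"
      using B[of x] by (cases "\<phi> x = 0") (auto intro: mult_left_mono)
  qed
  also have "\<dots> = (\<integral>\<^sup>+x. ennreal \<bar>\<phi> x\<bar> \<partial>lborel) * ennreal B" by (intro nn_integral_multc) auto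
  also have "\<dots> < \<infinity>" using \<phi> by (auto simp: integrable_iff_bounded ennreal_mult_less_top)
  finally show "(\<integral>\<^sup>+p. ennreal (norm (\<phi> (fst p) * g p)) \<partial>lborel2) < \<infinity>" .
qed

lemma fin_energy_dominated:
  assumes [measurable]: "\<phi> \<in> borel_measurable borel"
    and g: "integrable lborel2 g"
    and le: "\<And>p. (incr \<phi> p)\<^sup>2 * J (fst p - snd p) \<le> g p"
  shows "fin_energy \<phi>"
  unfolding fin_energy_def
proof (intro conjI assms(1) Bochner_Integration.integrable_bound[OF g])
  show "AE p in lborel2. norm ((incr \<phi> p)\<^sup>2 * J (fst p - snd p)) \<le> norm (g p)"
    using le by (intro AE_I2) (auto intro: order_trans[OF _ abs_ge_self])
qed measurable

lemma bform_translate: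
  assumes "fin_energy u" "fin_energy v"
  shows "bform (\<lambda>x. u (x + h)) (\<lambda>x. v (x + h)) = bform u v"
proof -
  let ?F = "\<lambda>p. incr u p * incr v p * J (fst p - snd p)"
  have "?F \<in> borel_measurable lborel2" using bform_integrable[OF assms] by auto
  from integral_pair_translate[OF this, of h] show ?thesis by (simp add: bform_def)
qed

lemma fin_energy_translate:
  assumes "fin_energy u"
  shows "fin_energy (\<lambda>x. u (x + h))"
proof -
  have [measurable]: "u \<in> borel_measurable borel" using assms by (simp add: fin_energy_def)
  show ?thesis
    using assms integrable_pair_translate[of "\<lambda>p. (incr u p)\<^sup>2 * J (fst p - snd p)" h]
    by (simp add: fin_energy_def)
qed

lemma bform_diff_left:
  assumes "fin_energy u" "fin_energy w" "fin_energy \<phi>"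
  shows "bform (\<lambda>x. w x - u x) \<phi> = bform w \<phi> - bform u \<phi>"
proof -
  have "(w (fst p) - u (fst p) - (w (snd p) - u (snd p))) * incr \<phi> p * J (fst p - snd p)
     = incr w p * incr \<phi> p * J (fst p - snd p)
     - incr u p * incr \<phi> p * J (fst p - snd p)" for p
    by (simp add: algebra_simps)
  then have "bform (\<lambda>x. w x - u x) \<phi> = 1 / 2 *
    ((LINT p|lborel2. incr w p * incr \<phi> p * J (fst p - snd p)) -
     (LINT p|lborel2. incr u p * incr \<phi> p * J (fst p - snd p)))"
    unfolding bform_def
    by (simp only: Bochner_Integration.integral_diff[OF bform_integrable[OF assms(2,3)] bform_integrable[OF assms(1,3)]])
  then show ?thesis unfolding bform_def by (simp only: right_diff_distrib)
qed

text \<open>The weak substitute for evaluating an equation at a maximum point. In the applications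
  \<open>\<phi>\<close> is the positive part of an excess, possibly truncated, and \<open>g\<close>
  is the integrand that remains after testing the equation with it.\<close>

lemma AE_zero_of_nonpos_integral:
  fixes \<phi> g :: "'a::euclidean_space \<Rightarrow> real"
  assumes g: "integrable lborel g" and le: "(LINT x|lborel. g x) \<le> 0"
    and pos: "\<And>x. \<phi> x \<noteq> 0 \<Longrightarrow> g x > 0" and zero: "\<And>x. \<phi> x = 0 \<Longrightarrow> g x = 0"
  shows "AE x in lborel. \<phi> x = 0"
proof -
  have nn: "0 \<le> g x" for x using pos[of x] zero[of x] by (cases "\<phi> x = 0") auto
  have "0 \<le> (LINT x|lborel. g x)" using nn by (intro integral_nonneg_AE) auto
  with le have "(LINT x|lborel. g x) = 0" by linarith
  then have "AE x in lborel. g x = 0" using integral_nonneg_eq_0_iff_AE[OF g] nn by auto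
  then show ?thesis
  proof eventually_elim
    case (elim x)
    then show ?case using pos[of x] by auto
  qed
qed

section \<open>Boundedness of solutions\<close>

lemma bform_nonneg:
  assumes "\<And>x y. 0 \<le> (u x - u y) * (v x - v y)"
  shows "0 \<le> bform u v"
proof -
  have "0 \<le> (LINT p|lborel2. incr u p * incr v p * J (fst p - snd p))"
    by (intro integral_nonneg_AE AE_I2 mult_nonneg_nonneg[OF assms]) simp
  then show ?thesis by (simp add: bform_def)
qed

text \<open>Normal contractions operate on the form: a 1-Lipschitz \<open>p\<close> increases no
  increment, and \<open>p 0 = 0\<close> preserves both the support and, with the Lipschitz bound,
  square integrability.\<close>

lemma test_fun_contraction:
  fixes p :: "real \<Rightarrow> real"
  assumes u: "test_fun \<Omega> u" and [measurable]: "p \<in> borel_measurable borel"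
    and lip: "\<And>s t. \<bar>p s - p t\<bar> \<le> \<bar>s - t\<bar>" and "p 0 = 0"
  shows "test_fun \<Omega> (\<lambda>x. p (u x))"
proof -
  have [measurable]: "u \<in> borel_measurable borel" using u by auto
  have "fin_energy (\<lambda>x. p (u x))"
  proof (rule fin_energy_dominated)
    show "integrable lborel2 (\<lambda>p. (incr u p)\<^sup>2 * J (fst p - snd p))"
      using u by (simp add: test_fun_def fin_energy_def)
    show "(p (u (fst q)) - p (u (snd q)))\<^sup>2 * J (fst q - snd q) \<le> (u (fst q) - u (snd q))\<^sup>2 * J (fst q - snd q)" for q
      using lip by (intro mult_right_mono) (auto simp: abs_le_square_iff[symmetric])
  qed measurable
  moreover have "integrable lborel (\<lambda>x. (p (u x))\<^sup>2)"
  proof (rule Bochner_Integration.integrable_bound)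
    show "integrable lborel (\<lambda>x. (u x)\<^sup>2)" using u by (simp add: test_fun_def)
    show "AE x in lborel. norm ((p (u x))\<^sup>2) \<le> norm ((u x)\<^sup>2)"
      using lip[of _ 0] \<open>p 0 = 0\<close> by (intro AE_I2) (simp add: abs_le_square_iff[symmetric])
  qed measurable
  ultimately show ?thesis using u \<open>p 0 = 0\<close> by (auto simp: test_fun_def)
qed

lemma integrable_of_square:
  fixes \<phi> :: "'a::euclidean_space \<Rightarrow> real"
  assumes sq: "integrable lborel (\<lambda>x. (\<phi> x)\<^sup>2)" and [measurable]: "\<phi> \<in> borel_measurable borel" "\<Omega> \<in> sets borel"
    and "bounded \<Omega>" and z: "\<And>x. x \<notin> \<Omega> \<Longrightarrow> \<phi> x = 0"
  shows "integrable lborel \<phi>"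
proof (rule Bochner_Integration.integrable_bound)
  show "integrable lborel (\<lambda>x. (\<phi> x)\<^sup>2 + indicator \<Omega> x)"
    using sq emeasure_bounded_finite[OF \<open>bounded \<Omega>\<close>] by (intro Bochner_Integration.integrable_add integrable_real_indicator) auto
  have "\<bar>t\<bar> \<le> t\<^sup>2 + 1" for t :: real
    using sum_squares_bound[of "\<bar>t\<bar>" 1] abs_ge_zero[of t] unfolding power2_abs by (simp del: abs_ge_zero)
  then show "AE x in lborel. norm (\<phi> x) \<le> norm ((\<phi> x)\<^sup>2 + indicator \<Omega> x)"
    using z by (intro AE_I2) (force simp: indicator_def)
qed measurable

lemma test_fun_integrable:
  assumes "test_fun \<Omega> \<phi>" "bounded \<Omega>" "open \<Omega>"
  shows "integrable lborel \<phi>"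
  using assms by (intro integrable_of_square[of \<phi> \<Omega>]) (auto simp: test_fun_def fin_energy_def)

lemma integrable_bounded_mult:
  fixes g \<phi> :: "'a \<Rightarrow> real"
  assumes \<phi>: "integrable M \<phi>" and [measurable]: "g \<in> borel_measurable M" and B: "\<And>x. \<bar>g x\<bar> \<le> B"
  shows "integrable M (\<lambda>x. g x * \<phi> x)"
proof (rule Bochner_Integration.integrable_bound)
  show "integrable M (\<lambda>x. B * \<phi> x)" using \<phi> by simp
  show "(\<lambda>x. g x * \<phi> x) \<in> borel_measurable M" using \<phi> by measurable
  show "AE x in M. norm (g x * \<phi> x) \<le> norm (B * \<phi> x)"
  proof (intro AE_I2)
    fix x
    show "norm (g x * \<phi> x) \<le> norm (B * \<phi> x)"
      using mult_right_mono[OF B[of x], of "\<bar>\<phi> x\<bar>"] B[of x] by (simp add: abs_mult)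
  qed
qed

lemma diff_mult_pos_part_diff_nonneg: "0 \<le> (a - b) * (max (a - c) 0 - max (b - c) 0)" for a b c :: real
  by (cases "a \<le> b") (auto intro: mult_nonpos_nonpos)

lemma integrable_mult_of_squares:
  fixes u v :: "'a \<Rightarrow> real"
  assumes "integrable M (\<lambda>x. (u x)\<^sup>2)" "integrable M (\<lambda>x. (v x)\<^sup>2)"
    and [measurable]: "u \<in> borel_measurable M" "v \<in> borel_measurable M"
  shows "integrable M (\<lambda>x. u x * v x)"
proof (rule Bochner_Integration.integrable_bound)
  show "integrable M (\<lambda>x. (u x)\<^sup>2 + (v x)\<^sup>2)" using assms by auto
  show "AE x in M. norm (u x * v x) \<le> norm ((u x)\<^sup>2 + (v x)\<^sup>2)"
    by (intro AE_I2) (auto intro: order_trans[OF abs_mult_le_sum_squares])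
qed measurable

lemma abs_mult_ln_le: "\<bar>t * ln \<bar>t\<bar>\<bar> \<le> 1 + t\<^sup>2" for t :: real
proof (cases "t = 0")
  case False
  define s where "s = \<bar>t\<bar>"
  have s: "s > 0" using False by (simp add: s_def)
  have "s * \<bar>ln s\<bar> \<le> 1 + s\<^sup>2"
  proof (cases "s \<le> 1")
    case True
    have "ln (1 / s) \<le> 1 / s - 1" using s by (intro ln_le_minus_one) auto
    then have "\<bar>ln s\<bar> \<le> 1 / s - 1" using True s by (simp add: ln_div)
    then have "s * \<bar>ln s\<bar> \<le> s * (1 / s - 1)" using s by (intro mult_left_mono) auto
    also have "\<dots> \<le> 1" using s by (simp add: field_simps)
    finally show ?thesis by (simp add: add_increasing2)
  next
    case False
    have "\<bar>ln s\<bar> \<le> s" using False ln_le_minus_one[of s] by simp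
    then have "s * \<bar>ln s\<bar> \<le> s * s" using s by (intro mult_left_mono) auto
    then show ?thesis by (simp add: power2_eq_square)
  qed
  then show ?thesis by (simp add: s_def abs_mult)
qed simp

text \<open>The test function is truncated at \<open>1\<close> because \<open>u\<^sup>2 ln \<bar>u\<bar>\<close> is not known to be integrable
  at this stage.\<close>

lemma solution_le_exp:
  fixes u :: "'a::euclidean_space \<Rightarrow> real"
  assumes u: "test_fun \<Omega> u" and "k < 0"
    and W: "\<And>\<phi>. test_fun \<Omega> \<phi> \<Longrightarrow> integrable lborel (\<lambda>x. u x * ln \<bar>u x\<bar> * \<phi> x) \<Longrightarrow>
      bform u \<phi> = (LINT x|lborel. (lam * u x + k * u x * ln \<bar>u x\<bar>) * \<phi> x)"
  shows "AE x in lborel. u x \<le> exp (- lam / k)"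
proof -
  have [measurable]: "u \<in> borel_measurable borel" using u by auto
  define M where "M = exp (- lam / k)"
  have M: "M > 0" "ln M = - lam / k" by (simp_all add: M_def)
  define p where "p t = min (max (t - M) 0) 1" for t
  define \<phi> where "\<phi> x = p (u x)" for x
  have [measurable]: "p \<in> borel_measurable borel" unfolding p_def by measurable
  then have [measurable]: "\<phi> \<in> borel_measurable borel" unfolding \<phi>_def by measurable
  have p0: "p 0 = 0" using M(1) by (simp add: p_def)
  have plip: "\<bar>p s - p t\<bar> \<le> \<bar>s - t\<bar>" for s t unfolding p_def min_def max_def by (simp split: if_split)
  have \<phi>: "test_fun \<Omega> \<phi>" unfolding \<phi>_def
    by (rule test_fun_contraction[OF u _ plip p0]) measurable
  have u2: "integrable lborel (\<lambda>x. (u x)\<^sup>2)" and \<phi>2: "integrable lborel (\<lambda>x. (\<phi> x)\<^sup>2)" using u \<phi> by (auto simp: test_fun_def)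
  have i1: "integrable lborel (\<lambda>x. u x * ln \<bar>u x\<bar> * \<phi> x)"
  proof (rule Bochner_Integration.integrable_bound)
    \<comment> \<open>For \<open>t > M\<close>, \<open>ln (t / M) \<le> t / M - 1\<close> gives
      \<open>\<bar>ln t\<bar> \<le> t / M + \<bar>ln M\<bar>\<close>, and
      \<open>t / M \<ge> 1\<close> absorbs the constant. Elsewhere \<open>\<phi>\<close> is
      zero.\<close>
    show "integrable lborel (\<lambda>x. ((1 + \<bar>ln M\<bar>) / M) * (u x)\<^sup>2)" using u2 by simp
    show "AE x in lborel. norm (u x * ln \<bar>u x\<bar> * \<phi> x) \<le> norm (((1 + \<bar>ln M\<bar>) / M) * (u x)\<^sup>2)"
    proof (intro AE_I2)
      fix x
      show "norm (u x * ln \<bar>u x\<bar> * \<phi> x) \<le> norm (((1 + \<bar>ln M\<bar>) / M) * (u x)\<^sup>2)"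
      proof (cases "u x > M")
        case True
        define t where "t = u x"
        have t: "t > M" "t > 0" using True M by (auto simp: t_def)
        have "ln (t / M) \<le> t / M - 1" using t M(1) by (intro ln_le_minus_one) simp
        moreover have "ln (t / M) = ln t - ln M" using t M(1) by (simp add: ln_div)
        moreover have "ln M < ln t" using t M(1) by (subst ln_less_cancel_iff) auto
        ultimately have "\<bar>ln t\<bar> \<le> t / M + \<bar>ln M\<bar>" by linarith
        also have "\<dots> \<le> t / M + \<bar>ln M\<bar> * (t / M)"
        proof -
          have "1 \<le> t / M" using t M by simp
          from mult_left_mono[OF this, of "\<bar>ln M\<bar>"] show ?thesis by simp
        qed
        also have "\<dots> = (1 + \<bar>ln M\<bar>) / M * t" by (simp add: add_divide_distrib distrib_right)
        finally have "\<bar>ln t\<bar> \<le> (1 + \<bar>ln M\<bar>) / M * t" .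
        then have "t * \<bar>ln t\<bar> \<le> (1 + \<bar>ln M\<bar>) / M * t\<^sup>2"
        proof -
          assume le: "\<bar>ln t\<bar> \<le> (1 + \<bar>ln M\<bar>) / M * t"
          have "t * \<bar>ln t\<bar> \<le> t * ((1 + \<bar>ln M\<bar>) / M * t)" using t by (intro mult_left_mono le) auto
          also have "\<dots> = (1 + \<bar>ln M\<bar>) / M * t\<^sup>2" by (simp only: power2_eq_square mult_ac)
          finally show ?thesis .
        qed
        moreover have "\<bar>\<phi> x\<bar> \<le> 1" by (simp add: \<phi>_def p_def)
        ultimately have "(t * \<bar>ln t\<bar>) * \<bar>\<phi> x\<bar> \<le> ((1 + \<bar>ln M\<bar>) / M * t\<^sup>2) * 1"
          by (rule mult_mono) (use t M(1) in auto)
        moreover have "norm (((1 + \<bar>ln M\<bar>) / M) * (u x)\<^sup>2) = (1 + \<bar>ln M\<bar>) / M * t\<^sup>2"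
          using M(1) unfolding t_def real_norm_def by (intro abs_of_nonneg) auto
        moreover have "norm (u x * ln \<bar>u x\<bar> * \<phi> x) = (t * \<bar>ln t\<bar>) * \<bar>\<phi> x\<bar>"
          using t by (simp add: t_def abs_mult)
        ultimately show ?thesis by simp
      next
        case False
        then have "\<phi> x = 0" by (simp add: \<phi>_def p_def)
        then show ?thesis by simp
      qed
    qed
  qed measurable
  have i2: "integrable lborel (\<lambda>x. u x * \<phi> x)"
    using u2 \<phi>2 by (intro integrable_mult_of_squares) auto
  have eq: "- ((lam * u x + k * u x * ln \<bar>u x\<bar>) * \<phi> x) = - (lam * (u x * \<phi> x)) - k * (u x * ln \<bar>u x\<bar> * \<phi> x)" for x
    by (simp add: algebra_simps)
  have "0 \<le> bform u \<phi>"
  proof (rule bform_nonneg)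
    show "0 \<le> (u x - u y) * (\<phi> x - \<phi> y)" for x y
    proof (cases "u x \<le> u y")
      case True
      then have "\<phi> x \<le> \<phi> y" by (auto simp: \<phi>_def p_def)
      then show ?thesis using True by (intro mult_nonpos_nonpos) auto
    next
      case False
      then have "\<phi> x \<ge> \<phi> y" by (auto simp: \<phi>_def p_def)
      then show ?thesis using False by (intro mult_nonneg_nonneg) auto
    qed
  qed
  then have le: "(LINT x|lborel. - ((lam * u x + k * u x * ln \<bar>u x\<bar>) * \<phi> x)) \<le> 0"
    using W[OF \<phi> i1] by simp
  have pos: "- ((lam * u x + k * u x * ln \<bar>u x\<bar>) * \<phi> x) > 0" if "\<phi> x \<noteq> 0" for x
  proof -
    have t: "u x > M" "\<phi> x > 0" using that by (auto simp: \<phi>_def p_def split: if_splits)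
    then have "ln M < ln (u x)" using M(1) by (subst ln_less_cancel_iff) auto
    then have "- lam > k * ln (u x)" using \<open>k < 0\<close> unfolding M(2) by (simp only: neg_divide_less_eq mult.commute)
    then have "u x * (lam + k * ln (u x)) < 0" using t M(1) by (intro mult_pos_neg) auto
    then have "(u x * (lam + k * ln (u x))) * \<phi> x < 0" by (rule mult_neg_pos[OF _ t(2)])
    then show ?thesis using t M(1) by (simp add: algebra_simps)
  qed
  have "AE x in lborel. \<phi> x = 0"
  proof (rule AE_zero_of_nonpos_integral[OF _ le pos])
    show "integrable lborel (\<lambda>x. - ((lam * u x + k * u x * ln \<bar>u x\<bar>) * \<phi> x))" unfolding eq using i1 i2 by auto
  qed auto
  then show ?thesis by eventually_elim (auto simp: \<phi>_def p_def M_def split: if_splits)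
qed

text \<open>The identity \<open>W\<close> carries an integrability hypothesis, because the two
  integrals of the weak formulation are merged into one. It is first used with the truncated test
  functions of \<open>solution_le_exp\<close>, for \<open>w\<close> and for \<open>- w\<close>. The
  resulting bound makes \<open>w * ln \<bar>w\<bar>\<close> bounded almost everywhere, and test
  functions on a bounded domain are integrable, so the hypothesis then holds for every test
  function.\<close>

lemma weak_solution_imp_wsol:
  fixes u :: "'a::euclidean_space \<Rightarrow> real"
  assumes sol: "weak_solution \<Omega> k lam u" and "k < 0" and \<Omega>: "bounded \<Omega>" "open \<Omega>"
  defines "M \<equiv> exp (- lam / k)"
  obtains v where "AE x in lborel. u x = v x" "wsol \<Omega> (\<lambda>x. lam * v x + k * v x * ln \<bar>v x\<bar>) v" "\<And>x. \<bar>v x\<bar> \<le> M"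
proof -
  have [measurable]: "\<Omega> \<in> sets borel" using \<Omega> by auto
  have uH: "u \<in> H0_ln \<Omega>" using sol by (simp add: weak_solution_def)
  then have ul: "u \<in> borel_measurable lebesgue" by (auto simp: H0_ln_def H_ln_def)
  obtain w where w: "test_fun \<Omega> w" and ae: "AE x in lborel. u x = w x"
    using H0_ln_representative[OF uH] by auto
  have [measurable]: "w \<in> borel_measurable borel" using w by auto
  have W: "bform w \<phi> = (LINT x|lborel. (lam * w x + k * w x * ln \<bar>w x\<bar>) * \<phi> x)"
    if \<phi>: "test_fun \<Omega> \<phi>" and i: "integrable lborel (\<lambda>x. w x * ln \<bar>w x\<bar> * \<phi> x)" for \<phi>
  proof -
    have [measurable]: "\<phi> \<in> borel_measurable borel" using \<phi> by auto
    then have pl: "\<phi> \<in> borel_measurable lebesgue" by (intro measurable_completion) simp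
    have i2: "integrable lborel (\<lambda>x. w x * \<phi> x)"
      using w \<phi> by (intro integrable_mult_of_squares) (auto simp: test_fun_def)
    have z: "\<phi> x = 0" if "x \<notin> \<Omega>" for x using \<phi> that by (auto simp: test_fun_def)
    have "bform w \<phi> = energy u \<phi>" using energy_eq_bform[OF ul ae] w \<phi> by (auto simp: test_fun_def)
    also have "\<dots> = lam * (LINT x:\<Omega>|lebesgue. u x * \<phi> x) + k * (LINT x:\<Omega>|lebesgue. \<phi> x * u x * ln \<bar>u x\<bar>)"
      using sol test_fun_imp_H0_ln[OF \<phi>] by (simp add: weak_solution_def)
    also have "(LINT x:\<Omega>|lebesgue. u x * \<phi> x) = (LINT x|lborel. indicator \<Omega> x * (w x * \<phi> x))"
      by (rule set_integral_lebesgue_eq) (use ae ul pl in \<open>auto intro!: borel_measurable_times\<close>)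
    also have "\<dots> = (LINT x|lborel. w x * \<phi> x)"
      by (intro Bochner_Integration.integral_cong refl) (use z in \<open>auto simp: indicator_def\<close>)
    also have "(LINT x:\<Omega>|lebesgue. \<phi> x * u x * ln \<bar>u x\<bar>) = (LINT x|lborel. indicator \<Omega> x * (\<phi> x * w x * ln \<bar>w x\<bar>))"
      by (rule set_integral_lebesgue_eq) (use ae ul pl in \<open>auto intro!: borel_measurable_times borel_measurable_ln borel_measurable_abs\<close>)
    also have "\<dots> = (LINT x|lborel. w x * ln \<bar>w x\<bar> * \<phi> x)"
      by (intro Bochner_Integration.integral_cong refl) (use z in \<open>auto simp: indicator_def\<close>)
    also have "lam * (LINT x|lborel. w x * \<phi> x) + k * (LINT x|lborel. w x * ln \<bar>w x\<bar> * \<phi> x)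
        = (LINT x|lborel. lam * (w x * \<phi> x) + k * (w x * ln \<bar>w x\<bar> * \<phi> x))"
      using i i2 by simp
    also have "\<dots> = (LINT x|lborel. (lam * w x + k * w x * ln \<bar>w x\<bar>) * \<phi> x)"
      by (intro Bochner_Integration.integral_cong refl) (simp add: algebra_simps)
    finally show ?thesis .
  qed
  have "AE x in lborel. w x \<le> M" unfolding M_def by (rule solution_le_exp[OF w \<open>k < 0\<close> W])
  moreover have "AE x in lborel. - w x \<le> M" unfolding M_def
  proof (rule solution_le_exp[OF test_fun_uminus[OF w] \<open>k < 0\<close>])
    fix \<phi> assume \<phi>: "test_fun \<Omega> \<phi>" and i: "integrable lborel (\<lambda>x. - w x * ln \<bar>- w x\<bar> * \<phi> x)"
    have "integrable lborel (\<lambda>x. w x * ln \<bar>w x\<bar> * \<phi> x)"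
      using integrable_minus[OF i] by simp
    from W[OF \<phi> this] show "bform (\<lambda>x. - w x) \<phi> = (LINT x|lborel. (lam * - w x + k * - w x * ln \<bar>- w x\<bar>) * \<phi> x)"
      unfolding bform_uminus_left by (simp add: Bochner_Integration.integral_minus[symmetric] del: Bochner_Integration.integral_minus)
        (intro Bochner_Integration.integral_cong refl, simp add: algebra_simps)
  qed
  ultimately have aeM: "AE x in lborel. \<bar>w x\<bar> \<le> M" by eventually_elim auto
  \<comment> \<open>Resetting the function to \<open>0\<close> on the null set where the bound fails
    makes the bound hold everywhere without enlarging the support.\<close>
  define v where "v x = (if \<bar>w x\<bar> \<le> M then w x else 0)" for x
  have [measurable]: "v \<in> borel_measurable borel" unfolding v_def by measurable
  have aev: "AE x in lborel. w x = v x" using aeM by eventually_elim (auto simp: v_def)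
  have vM: "\<bar>v x\<bar> \<le> M" for x by (auto simp: v_def M_def)
  have "wsol \<Omega> (\<lambda>x. lam * w x + k * w x * ln \<bar>w x\<bar>) w"
    unfolding wsol_def
  proof (intro conjI allI impI w W)
    fix \<phi> assume \<phi>: "test_fun \<Omega> \<phi>"
    have [measurable]: "\<phi> \<in> borel_measurable borel" using \<phi> by auto
    show "integrable lborel (\<lambda>x. w x * ln \<bar>w x\<bar> * \<phi> x)"
    proof (rule Bochner_Integration.integrable_bound)
      show "integrable lborel (\<lambda>x. (1 + M\<^sup>2) * \<phi> x)" using test_fun_integrable[OF \<phi> \<Omega>] by simp
      show "AE x in lborel. norm (w x * ln \<bar>w x\<bar> * \<phi> x) \<le> norm ((1 + M\<^sup>2) * \<phi> x)"
        using aeM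
      proof eventually_elim
        case (elim x)
        have "\<bar>w x * ln \<bar>w x\<bar>\<bar> \<le> 1 + M\<^sup>2"
          using abs_mult_ln_le[of "w x"] power_mono[OF elim, of 2] by simp
        then have "\<bar>w x * ln \<bar>w x\<bar>\<bar> * \<bar>\<phi> x\<bar> \<le> (1 + M\<^sup>2) * \<bar>\<phi> x\<bar>" by (rule mult_right_mono) simp
        then show ?case by (simp add: abs_mult)
      qed
    qed measurable
  qed
  then have "wsol \<Omega> (\<lambda>x. lam * w x + k * w x * ln \<bar>w x\<bar>) v"
    by (rule wsol_cong_AE) (use aev w in \<open>auto simp: v_def test_fun_def\<close>)
  moreover have "(LINT x|lborel. (lam * w x + k * w x * ln \<bar>w x\<bar>) * \<phi> x) = (LINT x|lborel. (lam * v x + k * v x * ln \<bar>v x\<bar>) * \<phi> x)"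
    if "test_fun \<Omega> \<phi>" for \<phi>
  proof -
    have [measurable]: "\<phi> \<in> borel_measurable borel" using that by auto
    show ?thesis using aev by (intro integral_cong_AE) (auto, measurable)
  qed
  ultimately have "wsol \<Omega> (\<lambda>x. lam * v x + k * v x * ln \<bar>v x\<bar>) v" by (auto simp: wsol_def)
  moreover have "AE x in lborel. u x = v x" using ae aev by eventually_elim auto
  ultimately show ?thesis using that vM by blast
qed

text \<open>The logarithmic integrals of \<open>energy u u\<close> and of the functional cancel.
  This is safe even without integrability of \<open>u\<^sup>2 * ln \<bar>u\<bar>\<close>, since
  scalar factors leave a real Bochner integral unconditionally.\<close>

lemma J_ln_weak_solution:
  assumes "weak_solution \<Omega> k lam u"
  shows "J_ln \<Omega> k lam u = k / 4 * (LINT x:\<Omega>|lebesgue. (u x)\<^sup>2)"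
proof -
  have "energy u u = lam * (LINT x:\<Omega>|lebesgue. u x * u x) + k * (LINT x:\<Omega>|lebesgue. u x * u x * ln \<bar>u x\<bar>)"
    using assms by (simp add: weak_solution_def)
  moreover have "(LINT x:\<Omega>|lebesgue. (u x)\<^sup>2 * ln ((u x)\<^sup>2)) = 2 * (LINT x:\<Omega>|lebesgue. u x * u x * ln \<bar>u x\<bar>)"
  proof -
    have "(u x)\<^sup>2 * ln ((u x)\<^sup>2) = 2 * (u x * u x * ln \<bar>u x\<bar>)" for x
      using ln_realpow[of "\<bar>u x\<bar>" 2] by (cases "u x = 0") (auto simp: power2_eq_square)
    then show ?thesis by simp
  qed
  ultimately show ?thesis by (simp add: J_ln_def power2_eq_square algebra_simps)
qed

section \<open>Decay at the boundary\<close>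

text \<open>Test with the positive part \<open>\<phi>\<close> of \<open>u - K * \<psi>\<close>. For
  a pair with one point \<open>y\<close> in \<open>B\<close>, the vanishing of \<open>u\<close> at
  \<open>y\<close> gives a surplus \<open>K * \<psi> y * \<phi> x\<close> in the product of
  increments; weighting it with the integrable \<open>j\<close> keeps the total finite. Hypothesis
  \<open>super\<close> says that this gain, together with the operator applied to the barrier, beats
  the right-hand side wherever \<open>u\<close> exceeds the barrier.\<close>

lemma comparison_principle:
  fixes u f \<psi> j :: "'a::euclidean_space \<Rightarrow> real"
  assumes sol: "wsol \<Omega> f u" and \<Omega>: "bounded \<Omega>" "open \<Omega>"
    and fm [measurable]: "f \<in> borel_measurable borel" and F: "\<And>x. \<bar>f x\<bar> \<le> F"
    and \<psi>m [measurable]: "\<psi> \<in> borel_measurable borel" and \<psi>: "\<And>x. 0 \<le> \<psi> x" "\<And>x. \<psi> x \<le> 1"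
    and \<psi>J: "\<And>x. (\<integral>\<^sup>+y. ennreal (\<bar>\<psi> x - \<psi> y\<bar> * J (x - y)) \<partial>lborel) \<le> ennreal D"
    and K: "0 \<le> K" and Bm [measurable]: "B \<in> sets borel" and B: "B \<inter> \<Omega> = {}"
    and j: "integrable lborel j" "\<And>x. 0 \<le> j x" "\<And>x. x \<noteq> 0 \<Longrightarrow> j x \<le> J x"
    and super: "\<And>x. x \<in> \<Omega> \<Longrightarrow> K * \<psi> x < u x \<Longrightarrow>
      F < K * ((LINT y|lborel. indicator B y * \<psi> y * j (x - y)) + (LINT y|lborel. (\<psi> x - \<psi> y) * J (x - y)))"
  shows "AE x in lborel. u x \<le> K * \<psi> x"
proof -
  have [measurable]: "\<Omega> \<in> sets borel" "j \<in> borel_measurable borel" using \<Omega> j by auto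
  have tu: "test_fun \<Omega> u" using sol by (simp add: wsol_def)
  then have um [measurable]: "u \<in> borel_measurable borel" by auto
  have fu: "fin_energy u" using tu by (simp add: test_fun_def)
  have u0: "u x = 0" if "x \<notin> \<Omega>" for x using tu that by (simp add: test_fun_def)
  define z where "z x = u x - K * \<psi> x" for x
  define \<phi> where "\<phi> x = max (z x) 0" for x
  have [measurable]: "z \<in> borel_measurable borel" "\<phi> \<in> borel_measurable borel" unfolding \<phi>_def z_def by measurable
  have K\<psi>: "0 \<le> K * \<psi> x" for x using K \<psi>(1) by simp
  have \<phi>0: "\<phi> x = 0" if "x \<notin> \<Omega>" for x using u0[OF that] K\<psi>[of x] by (simp add: \<phi>_def z_def)
  have \<phi>nn: "0 \<le> \<phi> x" for x by (simp add: \<phi>_def)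
  have \<phi>u: "\<bar>\<phi> x\<bar> \<le> \<bar>u x\<bar>" for x using K\<psi>[of x] unfolding \<phi>_def z_def by linarith
  let ?d = "\<lambda>p. \<bar>\<psi> (fst p) - \<psi> (snd p)\<bar> * J (fst p - snd p)"
  have iI: "integrable lborel (indicator \<Omega> :: 'a \<Rightarrow> real)"
    using emeasure_bounded_finite[OF \<Omega>(1)] by (intro integrable_real_indicator) auto
  have d1: "integrable lborel2 (\<lambda>p. indicator \<Omega> (fst p) * ?d p)"
    by (rule integrable_pair_bounded_fibres[OF iI, where B=D]) (use \<psi>J in \<open>simp_all add: abs_mult\<close>)
  have d2: "integrable lborel2 (\<lambda>p. indicator \<Omega> (snd p) * ?d p)"
    using lborel_pair.integrable_product_swap[OF d1]
    by (simp add: case_prod_unfold abs_minus_commute J_minus_commute)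
  have fin: "fin_energy \<phi>"
  proof (rule fin_energy_dominated)
    show "integrable lborel2 (\<lambda>p. 2 * ((incr u p)\<^sup>2 * J (fst p - snd p))
        + 2 * K\<^sup>2 * (indicator \<Omega> (fst p) * ?d p + indicator \<Omega> (snd p) * ?d p))"
      using fu d1 d2 by (auto simp: fin_energy_def)
    fix p :: "'a \<times> 'a"
    define x y where "x = fst p" and "y = snd p"
    \<comment> \<open>Pairs with both points outside \<open>\<Omega>\<close> contribute nothing. On
      the others the squared increment of \<open>\<psi>\<close> is at most its absolute value,
      because \<open>\<psi>\<close> takes values between \<open>0\<close> and \<open>1\<close>, and
      the latter is controlled by \<open>\<psi>J\<close>.\<close>
    have "(\<phi> x - \<phi> y)\<^sup>2 \<le> 2 * (u x - u y)\<^sup>2 + 2 * K\<^sup>2 * (indicator \<Omega> x + indicator \<Omega> y) * \<bar>\<psi> x - \<psi> y\<bar>"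
    proof (cases "x \<in> \<Omega> \<or> y \<in> \<Omega>")
      case False
      then show ?thesis using \<phi>0 by simp
    next
      case True
      then have i1: "1 \<le> indicator \<Omega> x + (indicator \<Omega> y :: real)" by (auto simp: indicator_def)
      have "\<bar>\<phi> x - \<phi> y\<bar> \<le> \<bar>z x - z y\<bar>" unfolding \<phi>_def by linarith
      then have "(\<phi> x - \<phi> y)\<^sup>2 \<le> (z x - z y)\<^sup>2" by (simp add: abs_le_square_iff)
      also have "\<dots> = ((u x - u y) - K * (\<psi> x - \<psi> y))\<^sup>2" by (simp add: z_def algebra_simps)
      also have "\<dots> \<le> 2 * (u x - u y)\<^sup>2 + 2 * (K * (\<psi> x - \<psi> y))\<^sup>2"
      proof -
        have "(a - b)\<^sup>2 \<le> 2 * a\<^sup>2 + 2 * b\<^sup>2" for a b :: real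
          using zero_le_power2[of "a + b"] by (simp add: power2_eq_square algebra_simps)
        then show ?thesis .
      qed
      also have "(K * (\<psi> x - \<psi> y))\<^sup>2 = K\<^sup>2 * (\<bar>\<psi> x - \<psi> y\<bar> * \<bar>\<psi> x - \<psi> y\<bar>)" by (simp add: power_mult_distrib power2_eq_square)
      also have "\<bar>\<psi> x - \<psi> y\<bar> * \<bar>\<psi> x - \<psi> y\<bar> \<le> (indicator \<Omega> x + indicator \<Omega> y) * \<bar>\<psi> x - \<psi> y\<bar>"
      proof (intro mult_right_mono)
        show "\<bar>\<psi> x - \<psi> y\<bar> \<le> indicator \<Omega> x + indicator \<Omega> y"
          using i1 \<psi>[of x] \<psi>[of y] by linarith
      qed simp
      finally have "(\<phi> x - \<phi> y)\<^sup>2 \<le> 2 * (u x - u y)\<^sup>2 + 2 * (K\<^sup>2 * ((indicator \<Omega> x + indicator \<Omega> y) * \<bar>\<psi> x - \<psi> y\<bar>))"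
        by (simp add: mult_left_mono)
      then show ?thesis by (simp only: mult.assoc)
    qed
    then have "(\<phi> x - \<phi> y)\<^sup>2 * J (x - y) \<le> (2 * (u x - u y)\<^sup>2 + 2 * K\<^sup>2 * (indicator \<Omega> x + indicator \<Omega> y) * \<bar>\<psi> x - \<psi> y\<bar>) * J (x - y)"
      by (rule mult_right_mono) simp
    then show "(incr \<phi> p)\<^sup>2 * J (fst p - snd p) \<le> 2 * ((incr u p)\<^sup>2 * J (fst p - snd p))
        + 2 * K\<^sup>2 * (indicator \<Omega> (fst p) * ?d p + indicator \<Omega> (snd p) * ?d p)"
      unfolding x_def y_def by (simp only: algebra_simps)
  qed measurable
  have i\<phi>2: "integrable lborel (\<lambda>x. (\<phi> x)\<^sup>2)"
  proof (rule Bochner_Integration.integrable_bound)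
    show "integrable lborel (\<lambda>x. (u x)\<^sup>2)" using tu by (simp add: test_fun_def)
    show "AE x in lborel. norm ((\<phi> x)\<^sup>2) \<le> norm ((u x)\<^sup>2)"
      using \<phi>u by (intro AE_I2) (simp add: abs_le_square_iff)
  qed measurable
  have t\<phi>: "test_fun \<Omega> \<phi>" using fin i\<phi>2 \<phi>0 by (simp add: test_fun_def)
  have i\<phi>: "integrable lborel \<phi>" by (rule test_fun_integrable[OF t\<phi> \<Omega>])
  have A: "integrable lborel2 (\<lambda>p. \<phi> (fst p) * (incr \<psi> p * J (fst p - snd p)))"
    by (rule integrable_pair_bounded_fibres[OF i\<phi>, where B=D]) (use \<psi>J in \<open>simp_all add: abs_mult\<close>)
  \<comment> \<open>The gain occurs once for each order of the pair; the factor \<open>1 / 2\<close>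
    in \<open>bform\<close> restores a single copy.\<close>
  define b where "b p = \<phi> (fst p) * (indicator B (snd p) * \<psi> (snd p) * j (fst p - snd p))" for p
  have ib: "integrable lborel2 b"
    unfolding b_def
  proof (rule integrable_pair_bounded_fibres[OF i\<phi>, where B="LINT y|lborel. j y"])
    fix x
    have "(\<integral>\<^sup>+y. ennreal \<bar>indicator B (snd (x, y)) * \<psi> (snd (x, y)) * j (fst (x, y) - snd (x, y))\<bar> \<partial>lborel)
        \<le> (\<integral>\<^sup>+y. ennreal (j (x - y)) \<partial>lborel)"
    proof (intro nn_integral_mono ennreal_leI)
      fix y
      have "\<bar>indicator B y * \<psi> y\<bar> * j (x - y) \<le> 1 * j (x - y)"
        using \<psi>[of y] j(2) by (intro mult_right_mono) (auto simp: indicator_def)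
      then show "\<bar>indicator B (snd (x, y)) * \<psi> (snd (x, y)) * j (fst (x, y) - snd (x, y))\<bar> \<le> j (x - y)"
        using j(2) by (simp add: abs_mult)
    qed
    also have "\<dots> = (\<integral>\<^sup>+y. ennreal (j y) \<partial>lborel)" by (rule nn_integral_lborel_reflect) measurable
    also have "\<dots> = ennreal (LINT y|lborel. j y)" using j by (intro nn_integral_eq_integral) auto
    finally show "(\<integral>\<^sup>+y. ennreal \<bar>indicator B (snd (x, y)) * \<psi> (snd (x, y)) * j (fst (x, y) - snd (x, y))\<bar> \<partial>lborel) \<le> ennreal (LINT y|lborel. j y)" .
  qed measurable
  have ib': "integrable lborel2 (\<lambda>p. b (snd p, fst p))"
    using lborel_pair.integrable_product_swap[OF ib] by (simp add: case_prod_unfold)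
  have b_swap: "(LINT p|lborel2. b (snd p, fst p)) = (LINT p|lborel2. b p)"
    using lborel_pair.integral_product_swap[of b] ib by (simp add: case_prod_unfold)
  define gain where "gain x = (LINT y|lborel. indicator B y * \<psi> y * j (x - y))" for x
  define L where "L x = (LINT y|lborel. (\<psi> x - \<psi> y) * J (x - y))" for x
  have bxy: "b (x, y) = \<phi> x * (indicator B y * \<psi> y * j (x - y))" for x y by (simp add: b_def)
  have Ib: "(LINT p|lborel2. b p) = (LINT x|lborel. \<phi> x * gain x)"
    using lborel_pair.integral_fst'[OF ib] by (simp add: bxy gain_def)
  have ig: "integrable lborel (\<lambda>x. \<phi> x * gain x)"
    using lborel_pair.integrable_fst'[OF ib] by (simp add: bxy gain_def)
  note S = symmetric_kernel_form[OF A J_minus_commute, folded L_def]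
  have pw: "K * (incr \<psi> p * incr \<phi> p * J (fst p - snd p)) + K * (b p + b (snd p, fst p))
      \<le> incr u p * incr \<phi> p * J (fst p - snd p)" for p
  proof -
    define x y where "x = fst p" and "y = snd p"
    have mono: "0 \<le> (z x - z y) * (\<phi> x - \<phi> y)"
      using diff_mult_pos_part_diff_nonneg[of "z x" "z y" 0] by (simp add: \<phi>_def)
    \<comment> \<open>Here the product of increments equals
      \<open>z x * \<phi> x + K * \<psi> y * \<phi> x\<close>, and the first term is
      nonnegative.\<close>
    have one: "K * (\<phi> x * (\<psi> y * j (x - y))) \<le> (z x - z y) * (\<phi> x - \<phi> y) * J (x - y)"
      if "x \<noteq> y" "y \<in> B" for x y
    proof -
      have "y \<notin> \<Omega>" using that B by auto
      then have y: "\<phi> y = 0" "z y = - (K * \<psi> y)" using \<phi>0 u0 by (auto simp: z_def)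
      have "0 \<le> z x * \<phi> x" by (simp add: \<phi>_def max_def)
      then have "K * \<psi> y * \<phi> x \<le> (z x - z y) * (\<phi> x - \<phi> y)" unfolding y by (simp add: algebra_simps)
      then have "K * \<psi> y * \<phi> x * j (x - y) \<le> (z x - z y) * (\<phi> x - \<phi> y) * J (x - y)"
        by (rule mult_mono) (use j that K \<psi> \<phi>nn in \<open>auto intro!: order_trans[OF _ \<open>K * \<psi> y * \<phi> x \<le> (z x - z y) * (\<phi> x - \<phi> y)\<close>]\<close>)
      then show ?thesis by (simp add: mult_ac)
    qed
    have "K * (b (x, y) + b (y, x)) \<le> (z x - z y) * (\<phi> x - \<phi> y) * J (x - y)"
    proof (cases "x \<in> B")
      case x: True
      then have fx: "\<phi> x = 0" using B \<phi>0 by auto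
      show ?thesis
      proof (cases "y \<in> B")
        case True
        then have "\<phi> y = 0" using B \<phi>0 by auto
        then show ?thesis using fx by (simp add: b_def)
      next
        case False
        then have "x \<noteq> y" using x by auto
        from one[OF this[symmetric] x] have "K * (\<phi> y * (\<psi> x * j (y - x))) \<le> (z x - z y) * (\<phi> x - \<phi> y) * J (x - y)"
          by (simp add: J_minus_commute[of y x] algebra_simps)
        then show ?thesis using x False by (simp add: b_def)
      qed
    next
      case x: False
      show ?thesis
      proof (cases "y \<in> B")
        case True
        then have "x \<noteq> y" using x by auto
        from one[OF this True] show ?thesis using x True by (simp add: b_def)
      next
        case False
        then show ?thesis using x mono by (simp add: b_def)
      qed
    qed
    then show ?thesis unfolding x_def y_def by (simp add: z_def algebra_simps)
  qed
  have "K * (LINT x|lborel. \<phi> x * L x) + K * (LINT x|lborel. \<phi> x * gain x) \<le> bform u \<phi>"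
  proof -
    let ?P = "\<lambda>p. incr \<psi> p * incr \<phi> p * J (fst p - snd p)"
    have "(LINT p|lborel2. K * ?P p + K * (b p + b (snd p, fst p)))
      \<le> (LINT p|lborel2. incr u p * incr \<phi> p * J (fst p - snd p))"
      using S(1) ib ib' by (intro integral_mono bform_integrable fu fin pw) auto
    moreover have "(LINT p|lborel2. K * ?P p + K * (b p + b (snd p, fst p)))
       = K * (LINT p|lborel2. ?P p) + K * (2 * (LINT x|lborel. \<phi> x * gain x))"
      using S(1) ib ib' b_swap Ib by simp
    moreover have "(LINT p|lborel2. ?P p) = 2 * (LINT x|lborel. \<phi> x * L x)"
      using S(2) unfolding L_def by simp
    ultimately show ?thesis unfolding bform_def by (simp add: algebra_simps)
  qed
  moreover have "bform u \<phi> = (LINT x|lborel. f x * \<phi> x)" using sol t\<phi> by (simp add: wsol_def)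
  moreover have if\<phi>: "integrable lborel (\<lambda>x. f x * \<phi> x)"
    by (rule integrable_bounded_mult[OF i\<phi> _ F]) measurable
  have iL: "integrable lborel (\<lambda>x. \<phi> x * L x)" using S(3) by (simp add: L_def)
  define g where "g x = \<phi> x * (K * (gain x + L x) - f x)" for x
  have g_eq: "g x = K * (\<phi> x * L x) + K * (\<phi> x * gain x) - f x * \<phi> x" for x by (simp add: g_def algebra_simps)
  have ig': "integrable lborel g" unfolding g_eq[abs_def] using iL ig if\<phi> by auto
  have "(LINT x|lborel. g x) = K * (LINT x|lborel. \<phi> x * L x) + K * (LINT x|lborel. \<phi> x * gain x) - (LINT x|lborel. f x * \<phi> x)"
    unfolding g_eq using iL ig if\<phi> by simp
  ultimately have gle: "(LINT x|lborel. g x) \<le> 0" by linarith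
  have pos: "g x > 0" if "\<phi> x \<noteq> 0" for x
  proof -
    have "x \<in> \<Omega>" using that \<phi>0 by blast
    moreover have "K * \<psi> x < u x" and \<phi>p: "\<phi> x > 0" using that by (auto simp: \<phi>_def z_def max_def split: if_splits)
    ultimately have "F < K * (gain x + L x)" using super unfolding gain_def L_def by blast
    then have "0 < K * (gain x + L x) - f x" using F[of x] by linarith
    then show ?thesis unfolding g_def using \<phi>p by (rule mult_pos_pos[rotated])
  qed
  have "AE x in lborel. \<phi> x = 0"
    by (rule AE_zero_of_nonpos_integral[OF ig' gle pos]) (simp_all add: g_def)
  then show ?thesis
  proof eventually_elim
    case (elim x)
    then have "z x \<le> 0" unfolding \<phi>_def by linarith
    then show ?case by (simp add: z_def)
  qed
qed

section \<open>The logarithmic modulus behind the barriers\<close>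

definition gmod :: "real \<Rightarrow> real \<Rightarrow> real" where
  "gmod \<beta> s = (1 - log 2 (min s 1)) powr (- \<beta>)"

lemma borel_measurable_gmod [measurable]: "gmod \<beta> \<in> borel_measurable borel"
  unfolding gmod_def[abs_def] log_def by measurable

lemma gmod_base_ge_1: "0 < s \<Longrightarrow> 1 \<le> 1 - log 2 (min s 1)"
  by (simp add: min_def)

lemma gmod_pos: "0 < s \<Longrightarrow> 0 < gmod \<beta> s"
proof -
  assume "0 < s"
  then have "0 < 1 - log 2 (min s 1)" using gmod_base_ge_1[of s] by linarith
  then show ?thesis unfolding gmod_def by (subst powr_gt_zero) linarith
qed

lemma gmod_le_1: "0 < s \<Longrightarrow> 0 \<le> \<beta> \<Longrightarrow> gmod \<beta> s \<le> 1"
  using gmod_base_ge_1[of s] powr_mono2'[of "- \<beta>" 1 "1 - log 2 (min s 1)"] by (simp add: gmod_def)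

lemma gmod_mono:
  assumes "0 < s" "s \<le> t" "0 \<le> \<beta>"
  shows "gmod \<beta> s \<le> gmod \<beta> t"
proof -
  have "log 2 (min s 1) \<le> log 2 (min t 1)" using assms by (simp add: log_le_cancel_iff)
  moreover have "1 \<le> 1 - log 2 (min t 1)" using assms by (intro gmod_base_ge_1) auto
  ultimately show ?thesis unfolding gmod_def using assms(3) by (intro powr_mono2') auto
qed

text \<open>At dyadic radii the logarithm is an integer, which turns estimates over shells into sums
  of powers of natural numbers.\<close>

lemma gmod_dyadic: "gmod \<beta> (1 / 2 ^ i) = real (Suc i) powr (- \<beta>)"
proof -
  have "min (1 / 2 ^ i) 1 = (1 / 2 ^ i :: real)" by (simp add: min_def)
  moreover have "log 2 (1 / 2 ^ i) = - real i" by (simp add: log_divide)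
  ultimately show ?thesis by (simp add: gmod_def add.commute)
qed

text \<open>Factor out \<open>x powr (- \<beta>) \<le> 1\<close>; then
  \<open>exp s \<ge> 1 + s\<close> bounds the difference by \<open>\<beta> * ln (y / x)\<close>, and
  \<open>ln (y / x) \<le> y / x - 1 \<le> y - x\<close>.\<close>

lemma powr_minus_diff_le:
  fixes x y \<beta> :: real
  assumes "1 \<le> x" "x \<le> y" "0 \<le> \<beta>" "\<beta> \<le> 1"
  shows "x powr (- \<beta>) - y powr (- \<beta>) \<le> y - x"
proof -
  have x1: "x powr (- \<beta>) \<le> 1" using assms powr_mono2'[of "- \<beta>" 1 x] by simp
  have ln: "ln (y / x) \<le> y - x"
  proof -
    have "ln (y / x) \<le> y / x - 1" using assms by (intro ln_le_minus_one) auto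
    also have "\<dots> = (y - x) / x" using assms by (simp add: field_simps)
    also have "\<dots> \<le> y - x" using assms by (simp add: divide_le_eq mult_le_cancel_left1)
    finally show ?thesis .
  qed
  have lnn: "0 \<le> ln (y / x)" using assms by simp
  have "y powr (- \<beta>) = x powr (- \<beta>) * (y / x) powr (- \<beta>)"
    using assms by (simp add: powr_mult[symmetric])
  moreover have "1 - \<beta> * ln (y / x) \<le> (y / x) powr (- \<beta>)"
    using assms exp_ge_add_one_self[of "- \<beta> * ln (y / x)"] by (simp add: powr_def)
  then have "x powr (- \<beta>) * (1 - \<beta> * ln (y / x)) \<le> x powr (- \<beta>) * (y / x) powr (- \<beta>)" by (rule mult_left_mono) simp
  ultimately have "x powr (- \<beta>) * (1 - \<beta> * ln (y / x)) \<le> y powr (- \<beta>)" by simp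
  then have "x powr (- \<beta>) - y powr (- \<beta>) \<le> x powr (- \<beta>) * (\<beta> * ln (y / x))" by (simp add: algebra_simps)
  also have "\<dots> \<le> 1 * (1 * ln (y / x))" using assms x1 lnn by (intro mult_mono) auto
  finally show ?thesis using ln by simp
qed

lemma gmod_diff_le:
  assumes "0 < s" "s \<le> t" "0 \<le> \<beta>" "\<beta> \<le> 1"
  shows "gmod \<beta> t - gmod \<beta> s \<le> 2 * (t - s) / s"
proof -
  let ?s = "min s 1" and ?t = "min t 1"
  have pos: "0 < ?s" "?s \<le> ?t" using assms by (auto simp: min_def)
  have l2: "2/3 \<le> ln (2::real)" by (rule ln2_ge_two_thirds)
  have "gmod \<beta> t - gmod \<beta> s \<le> (1 - log 2 ?s) - (1 - log 2 ?t)"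
    unfolding gmod_def
    using assms pos gmod_base_ge_1[of t] log_le_cancel_iff[of 2 ?s ?t] by (intro powr_minus_diff_le) auto
  also have "\<dots> = ln (?t / ?s) / ln 2"
  proof -
    have "ln (?t / ?s) = ln ?t - ln ?s" using pos by (intro ln_divide_pos) linarith+
    then show ?thesis by (simp add: log_def diff_divide_distrib)
  qed
  also have "\<dots> \<le> (?t / ?s - 1) / ln 2" using pos l2 by (intro divide_right_mono ln_le_minus_one) auto
  also have "\<dots> \<le> ((t - s) / s) / ln 2"
  proof (intro divide_right_mono)
    show "?t / ?s - 1 \<le> (t - s) / s"
    proof (cases "s \<le> 1")
      case True
      then have "?s = s" by simp
      then show ?thesis using assms by (simp add: diff_divide_distrib divide_right_mono)
    next
      case False then show ?thesis using assms by simp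
    qed
  qed (use l2 in auto)
  also have "\<dots> \<le> ((t - s) / s) / (1/2)" using assms l2 by (intro divide_left_mono) auto
  finally show ?thesis by (simp add: mult.commute right_diff_distrib left_diff_distrib)
qed

text \<open>Comparison with the integral of the power, carried out by induction: the increment is
  Young's inequality for \<open>n powr (1 - \<beta>) * (n + 1) powr \<beta>\<close>.\<close>

lemma sum_powr_minus_le:
  assumes "0 < \<beta>" "\<beta> < 1"
  shows "(\<Sum>i=1..n. real i powr (- \<beta>)) \<le> real n powr (1 - \<beta>) / (1 - \<beta>)"
proof (induction n)
  case 0 show ?case by simp
next
  case (Suc n)
  have "(1 - \<beta>) * real (Suc n) powr (- \<beta>) \<le> real (Suc n) powr (1 - \<beta>) - real n powr (1 - \<beta>)"
  proof (cases "n = 0")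
    case True then show ?thesis using assms by simp
  next
    case False
    have "real n powr (1 - \<beta>) * real (Suc n) powr \<beta> \<le> (1 - \<beta>) * real n + \<beta> * real (Suc n)"
      using False assms by (intro Youngs_inequality_0) auto
    also have "\<dots> = real (Suc n) - (1 - \<beta>)" by (simp add: algebra_simps)
    finally have "(real n powr (1 - \<beta>) * real (Suc n) powr \<beta>) * real (Suc n) powr (- \<beta>) \<le> (real (Suc n) - (1 - \<beta>)) * real (Suc n) powr (- \<beta>)"
      by (intro mult_right_mono) auto
    moreover have "real (Suc n) powr \<beta> * real (Suc n) powr (- \<beta>) = 1" by (simp add: powr_add[symmetric])
    then have "(real n powr (1 - \<beta>) * real (Suc n) powr \<beta>) * real (Suc n) powr (- \<beta>) = real n powr (1 - \<beta>)"
      by (simp only: mult.assoc mult_1_right)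
    ultimately have "real n powr (1 - \<beta>) \<le> (real (Suc n) - (1 - \<beta>)) * real (Suc n) powr (- \<beta>)" by (simp only:)
    moreover have "real (Suc n) * real (Suc n) powr (- \<beta>) = real (Suc n) powr (1 - \<beta>)"
      using powr_add[of "real (Suc n)" 1 "- \<beta>"] by simp
    ultimately show ?thesis by (simp only: left_diff_distrib)
  qed
  then have "real (Suc n) powr (- \<beta>) \<le> (real (Suc n) powr (1 - \<beta>) - real n powr (1 - \<beta>)) / (1 - \<beta>)"
    using assms by (simp add: pos_le_divide_eq mult.commute)
  then show ?case using Suc by (simp add: diff_divide_distrib)
qed

text \<open>Here the loss acquires its factor \<beta>. For \<open>0 < i < n\<close> the increment is
  at most \<open>i powr (- \<beta>) - m powr (- \<beta>)\<close> with \<open>m = n + 2\<close>.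
  Summed, the first part is at most \<open>m powr (1 - \<beta>) / (1 - \<beta>)\<close> and the
  second is about \<open>m powr (1 - \<beta>)\<close>; the difference keeps only the fraction
  \<open>\<beta> / (1 - \<beta>) \<le> 2 * \<beta>\<close>.\<close>

lemma gmod_increment_sum:
  assumes \<beta>: "0 < \<beta>" "\<beta> \<le> 1/2" and \<rho>: "1 / 2 ^ Suc n < \<rho>" "\<rho> \<le> 1 / 2 ^ n"
  shows "(\<Sum>i. ennreal (gmod \<beta> (\<rho> + 1 / 2 ^ i) - gmod \<beta> \<rho>)) \<le> ennreal (12 + 2 * \<beta> * real (n + 2) powr (1 - \<beta>))"
proof -
  have \<rho>0: "0 < \<rho>" using \<rho>(1) by (rule order.strict_trans[rotated]) simp
  define m where "m = real (n + 2)"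
  have m: "m \<ge> 2" by (simp add: m_def)
  \<comment> \<open>Index \<open>0\<close> is separate because \<open>0 powr (- \<beta>)\<close> is
    \<open>0\<close> and bounds nothing; that increment is at most \<open>1\<close>.\<close>
  define c where "c i = (if i = 0 then 1 else if i < n then real i powr (- \<beta>) - m powr (- \<beta>) else 0)" for i :: nat
  \<comment> \<open>For \<open>i \<ge> n\<close> the Lipschitz bound \<open>gmod_diff_le\<close>
    together with \<open>1 / \<rho> < 2 ^ Suc n\<close> leaves a geometric tail of sum
    \<open>8\<close>.\<close>
  define e where "e i = (if i < n then 0 else 4 * 2 ^ n * (1 / 2 :: real) ^ i)" for i :: nat
  define b where "b i = c i + e i" for i
  have g\<rho>: "m powr (- \<beta>) \<le> gmod \<beta> \<rho>"
    using gmod_mono[of "1 / 2 ^ Suc n" \<rho> \<beta>] \<rho> \<beta> gmod_dyadic[of \<beta> "Suc n"] by (simp add: m_def add.commute)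
  have nn: "0 \<le> real i powr (- \<beta>) - m powr (- \<beta>)" if "0 < i" "i \<le> n" for i
    using that \<beta> powr_mono2'[of "- \<beta>" "real i" m] by (simp add: m_def)
  have le: "gmod \<beta> (\<rho> + 1 / 2 ^ i) - gmod \<beta> \<rho> \<le> b i" for i
  proof (cases "i < n")
    case False
    have "gmod \<beta> (\<rho> + 1 / 2 ^ i) - gmod \<beta> \<rho> \<le> 2 * (\<rho> + 1 / 2 ^ i - \<rho>) / \<rho>"
      using \<rho>0 \<beta> by (intro gmod_diff_le) auto
    also have "\<dots> = 2 / 2 ^ i * (1 / \<rho>)" by simp
    also have "\<dots> \<le> 2 / 2 ^ i * 2 ^ Suc n" using \<rho> \<rho>0 by (intro mult_left_mono) (auto simp: field_simps)
    also have "\<dots> = e i" using False by (simp add: e_def power_divide)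
    also have "\<dots> \<le> b i" using False by (auto simp: b_def c_def)
    finally show ?thesis .
  next
    case True
    show ?thesis
    proof (cases "i = 0")
      case True
      have "gmod \<beta> (\<rho> + 1 / 2 ^ i) \<le> 1" using \<rho>0 \<beta> by (intro gmod_le_1) (auto intro: add_pos_pos)
      then have "gmod \<beta> (\<rho> + 1 / 2 ^ i) - gmod \<beta> \<rho> \<le> 1" using gmod_pos[OF \<rho>0, of \<beta>] by linarith
      also have "1 \<le> b i" using True by (simp add: b_def c_def e_def)
      finally show ?thesis .
    next
      case False
      then obtain l where l: "i = Suc l" using not0_implies_Suc by blast
      have "(1::real) / 2 ^ n \<le> 1 / 2 ^ i" using True by (simp add: frac_le power_increasing)
      then have "\<rho> + 1 / 2 ^ i \<le> 2 * (1 / 2 ^ i)" using \<rho>(2) by linarith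
      also have "2 * (1 / 2 ^ i) = 1 / (2::real) ^ l" using l by simp
      finally have "\<rho> + 1 / 2 ^ i \<le> 1 / 2 ^ l" .
      then have "gmod \<beta> (\<rho> + 1 / 2 ^ i) \<le> gmod \<beta> (1 / 2 ^ l)" using \<rho>0 \<beta> by (intro gmod_mono) (auto intro: add_pos_pos)
      also have "\<dots> = real i powr (- \<beta>)" by (simp only: gmod_dyadic l)
      finally have "gmod \<beta> (\<rho> + 1 / 2 ^ i) - gmod \<beta> \<rho> \<le> real i powr (- \<beta>) - m powr (- \<beta>)" using g\<rho> by linarith
      also have "\<dots> \<le> b i" using True False by (simp add: b_def c_def e_def)
      finally show ?thesis .
    qed
  qed
  have bnn: "0 \<le> b i" for i using nn[of i] by (auto simp: b_def c_def e_def intro!: add_nonneg_nonneg)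
  have "(\<lambda>i. 4 * (1 / 2 :: real) ^ i) sums (4 * 2)"
    using geometric_sums[of "1/2::real"] by (intro sums_mult) simp
  also have "(\<lambda>i. 4 * (1 / 2 :: real) ^ i) = (\<lambda>i. e (i + n))"
    by (auto simp: e_def power_add power_divide)
  finally have "e sums (4 * 2 + (\<Sum>i<n. e i))" by (simp add: sums_iff_shift)
  then have es: "e sums 8" by (simp add: e_def)
  have "c sums (\<Sum>i\<in>{..n}. c i)" by (rule sums_finite) (auto simp: c_def)
  from sums_add[OF this es] have bs: "b sums ((\<Sum>i\<in>{..n}. c i) + 8)" by (simp add: b_def[abs_def])
  have "{..n} = insert 0 {1..n}" by auto
  then have "(\<Sum>i\<in>{..n}. c i) = c 0 + (\<Sum>i=1..n. c i)" by simp
  also have "\<dots> \<le> 1 + (\<Sum>i=1..n. real i powr (- \<beta>) - m powr (- \<beta>))"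
    using nn by (intro add_mono sum_mono) (auto simp: c_def)
  also have "\<dots> = 1 + (\<Sum>i=1..n. real i powr (- \<beta>)) - (m - 2) * m powr (- \<beta>)" by (simp add: sum_subtractf m_def)
  also have "\<dots> \<le> 1 + m powr (1 - \<beta>) / (1 - \<beta>) - (m powr (1 - \<beta>) - 2)"
  proof -
    have "(\<Sum>i=1..n. real i powr (- \<beta>)) \<le> real n powr (1 - \<beta>) / (1 - \<beta>)" using \<beta> by (intro sum_powr_minus_le) auto
    also have "\<dots> \<le> m powr (1 - \<beta>) / (1 - \<beta>)" using \<beta> by (intro divide_right_mono powr_mono2) (auto simp: m_def)
    finally have "(\<Sum>i=1..n. real i powr (- \<beta>)) \<le> m powr (1 - \<beta>) / (1 - \<beta>)" .
    moreover have "m * m powr (- \<beta>) = m powr (1 - \<beta>)" using m powr_add[of m 1 "- \<beta>"] by simp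
    moreover have "m powr (- \<beta>) \<le> 1" using m \<beta> powr_mono2'[of "- \<beta>" 1 m] by simp
    ultimately show ?thesis by (simp only: left_diff_distrib)
  qed
  also have "\<dots> = 3 + \<beta> / (1 - \<beta>) * m powr (1 - \<beta>)" using \<beta> by (simp add: field_simps)
  also have "\<dots> \<le> 3 + (2 * \<beta>) * m powr (1 - \<beta>)"
    using \<beta> by (intro add_left_mono mult_right_mono) (auto simp: field_simps)
  \<comment> \<open>The constants are \<open>8\<close> from the tail, \<open>1\<close> from index
    \<open>0\<close> and \<open>2\<close> from \<open>n = m - 2\<close>, \<open>11\<close> in
    all.\<close>
  finally have tot: "(\<Sum>i\<in>{..n}. c i) + 8 \<le> 12 + 2 * \<beta> * m powr (1 - \<beta>)" by simp
  have "(\<Sum>i. ennreal (gmod \<beta> (\<rho> + 1 / 2 ^ i) - gmod \<beta> \<rho>)) \<le> (\<Sum>i. ennreal (b i))"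
    by (intro suminf_le ennreal_leI le) auto
  also have "\<dots> = ennreal ((\<Sum>i\<in>{..n}. c i) + 8)" using bs bnn by (intro suminf_ennreal_eq) auto
  also have "\<dots> \<le> ennreal (12 + 2 * \<beta> * m powr (1 - \<beta>))" by (intro ennreal_leI tot)
  finally show ?thesis by (simp add: m_def)
qed

text \<open>Used qualitatively: for fixed \<eta> the barrier is Lipschitz with constant
  \<open>2 / \<eta>\<close>, so its integrals against \<open>J\<close> converge. The bound
  degenerates as \<eta> tends to \<open>0\<close> and does not reach the final constants.\<close>

lemma nn_integral_J_lipschitz:
  "\<exists>C. \<forall>\<Lambda>\<ge>0. \<forall>\<psi> :: 'a::euclidean_space \<Rightarrow> real. \<psi> \<in> borel_measurable borel \<longrightarrow>
     (\<forall>x y. \<bar>\<psi> x - \<psi> y\<bar> \<le> min 1 (\<Lambda> * norm (x - y))) \<longrightarrow>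
     (\<forall>x. (\<integral>\<^sup>+y. ennreal (\<bar>\<psi> x - \<psi> y\<bar> * J (x - y)) \<partial>lborel) \<le> ennreal (C * (2 * \<Lambda> + 1)))"
proof -
  obtain C where "C > 0" and C: "\<forall>H \<Lambda>. \<forall>h :: 'a \<Rightarrow> real. dyadic_J_bound C H \<Lambda> h"
    using nn_integral_J_le[where 'a='a] by (elim exE conjE)
  have "(\<integral>\<^sup>+y. ennreal (\<bar>\<psi> x - \<psi> y\<bar> * J (x - y)) \<partial>lborel) \<le> ennreal (C * (2 * \<Lambda> + 1))"
    if \<Lambda>: "0 \<le> \<Lambda>" and [measurable]: "\<psi> \<in> borel_measurable borel" and lip: "\<And>x y. \<bar>\<psi> x - \<psi> y\<bar> \<le> min 1 (\<Lambda> * norm (x - y))"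
    for \<Lambda> and \<psi> :: "'a \<Rightarrow> real" and x
  proof -
    define h where "h y = \<bar>\<psi> x - \<psi> (x - y)\<bar>" for y
    define H where "H r = min 1 (\<Lambda> * r)" for r
    have [measurable]: "h \<in> borel_measurable borel" unfolding h_def by measurable
    have gs: "(\<lambda>i. \<Lambda> * (1/2) ^ i) sums (\<Lambda> * 2)"
      using geometric_sums[of "1/2::real"] by (intro sums_mult) simp
    have "(\<integral>\<^sup>+y. ennreal (\<bar>\<psi> x - \<psi> y\<bar> * J (x - y)) \<partial>lborel) = (\<integral>\<^sup>+y. ennreal (h y * J y) \<partial>lborel)"
      using nn_integral_lborel_reflect[of "\<lambda>y. ennreal (h y * J y)" x] by (simp add: h_def)
    also have "\<dots> \<le> ennreal C * ((\<Sum>i. ennreal (H (1 / 2 ^ i))) + ennreal 1)"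
    proof (rule C[unfolded dyadic_J_bound_def, THEN spec, THEN spec, THEN spec, THEN mp, THEN mp, THEN mp, THEN mp, THEN mp])
      show "\<forall>y. h y \<le> H (norm y)"
      proof
        fix y
        show "h y \<le> H (norm y)" using lip[of x "x - y"] by (simp add: h_def H_def)
      qed
      show "mono H" using \<Lambda> unfolding H_def by (intro monoI min.mono mult_left_mono) auto
    qed (use \<Lambda> in \<open>auto simp: H_def\<close>)
    also have "(\<Sum>i. ennreal (H (1 / 2 ^ i))) \<le> (\<Sum>i. ennreal (\<Lambda> * (1/2) ^ i))"
      by (intro suminf_le ennreal_leI) (auto simp: H_def power_divide)
    also have "\<dots> = ennreal (\<Lambda> * 2)" using gs \<Lambda> by (intro suminf_ennreal_eq) auto
    finally have "(\<integral>\<^sup>+y. ennreal (\<bar>\<psi> x - \<psi> y\<bar> * J (x - y)) \<partial>lborel) \<le> ennreal C * (ennreal (\<Lambda> * 2) + ennreal 1)"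
      by (simp add: add_right_mono mult_left_mono)
    also have "ennreal (\<Lambda> * 2) + ennreal 1 = ennreal (\<Lambda> * 2 + 1)"
      using \<Lambda> by (intro ennreal_plus[symmetric]) auto
    also have "ennreal C * \<dots> = ennreal (C * (\<Lambda> * 2 + 1))"
      using \<Lambda> \<open>C > 0\<close> by (intro ennreal_mult[symmetric]) auto
    also have "C * (\<Lambda> * 2 + 1) = C * (2 * \<Lambda> + 1)" by (simp only: mult.commute)
    finally show ?thesis .
  qed
  then show ?thesis by blast
qed

section \<open>Barriers at a boundary point with an exterior ball\<close>

lemma gmod_radial_lipschitz:
  fixes x0 :: "'a::euclidean_space"
  assumes \<beta>: "0 \<le> \<beta>" "\<beta> \<le> 1" and "0 < \<eta>"
  shows "\<bar>gmod \<beta> (norm (x - x0) + \<eta>) - gmod \<beta> (norm (y - x0) + \<eta>)\<bar> \<le> min 1 (2 / \<eta> * norm (x - y))"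
proof -
  have *: "\<bar>gmod \<beta> (norm (x - x0) + \<eta>) - gmod \<beta> (norm (y - x0) + \<eta>)\<bar> \<le> 2 / \<eta> * norm (x - y)"
    if le: "norm (y - x0) \<le> norm (x - x0)" for x y
  proof -
    let ?s = "norm (y - x0) + \<eta>" and ?t = "norm (x - x0) + \<eta>"
    have s: "0 < ?s" "\<eta> \<le> ?s" using \<open>0 < \<eta>\<close> by (auto simp: add_nonneg_pos)
    have "\<bar>gmod \<beta> ?t - gmod \<beta> ?s\<bar> = gmod \<beta> ?t - gmod \<beta> ?s" using gmod_mono[of ?s ?t \<beta>] s le \<beta> by simp
    also have "\<dots> \<le> 2 * (?t - ?s) / ?s" using s le \<beta> by (intro gmod_diff_le) auto
    also have "\<dots> \<le> 2 * (?t - ?s) / \<eta>" using s le \<open>0 < \<eta>\<close> by (intro divide_left_mono mult_pos_pos add_nonneg_pos) auto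
    also have "\<dots> \<le> 2 * norm (x - y) / \<eta>"
    proof -
      have "norm (x - x0) - norm (y - x0) \<le> norm (x - y)" using norm_triangle_ineq2[of "x - x0" "y - x0"] by simp
      then show ?thesis using \<open>0 < \<eta>\<close> by (intro divide_right_mono) auto
    qed
    finally show ?thesis by simp
  qed
  have a: "0 < norm (x - x0) + \<eta>" "0 < norm (y - x0) + \<eta>" using \<open>0 < \<eta>\<close> by (auto simp: add_nonneg_pos)
  have "\<bar>gmod \<beta> (norm (x - x0) + \<eta>) - gmod \<beta> (norm (y - x0) + \<eta>)\<bar> \<le> 1"
    using gmod_pos[OF a(1), of \<beta>] gmod_pos[OF a(2), of \<beta>] gmod_le_1[OF a(1) \<beta>(1)] gmod_le_1[OF a(2) \<beta>(1)] by linarith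
  moreover have "\<bar>gmod \<beta> (norm (x - x0) + \<eta>) - gmod \<beta> (norm (y - x0) + \<eta>)\<bar> \<le> 2 / \<eta> * norm (x - y)"
    using *[of y x] *[of x y] by (cases "norm (y - x0) \<le> norm (x - x0)") (auto simp: norm_minus_commute abs_minus_commute)
  ultimately show ?thesis by simp
qed

text \<open>For each scale \<open>i\<close>, place a ball of radius \<open>1 / (8 * 2 ^ i)\<close>
  at distance \<open>1 / (4 * 2 ^ i)\<close> from \<open>x0\<close> in the direction of
  \<open>y0\<close>. It lies in the exterior ball; its points are at distance at least
  \<open>\<rho>\<close> from \<open>x0\<close>, so \<open>\<psi> \<ge> g\<close> on it; and they are
  within \<open>1 / 2 ^ i\<close> of \<open>x\<close>, so the \<open>i\<close>-th summand of the
  dyadic kernel is active. All scales contribute equally. The balls may overlap, as the comparison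
  is made summand by summand.\<close>

lemma dyadic_kernel_gain:
  fixes x0 y0 x :: "'a::euclidean_space"
  assumes R: "norm (y0 - x0) = R" "0 < R" and i0: "1 / 2 ^ i0 \<le> 4 * R" and nm: "n \<le> m"
    and \<rho>: "norm (x - x0) \<le> \<rho>" "\<rho> \<le> 1 / 2 ^ n"
    and [measurable]: "\<psi> \<in> borel_measurable borel" and \<psi>: "\<And>y. 0 \<le> \<psi> y" "\<And>y. \<psi> y \<le> 1"
    and g: "0 \<le> g" "\<And>y. \<rho> \<le> norm (y - x0) \<Longrightarrow> g \<le> \<psi> y"
  shows "unit_ball_vol DIM('a) * (1/8) ^ DIM('a) * g * (real n - 2 - real i0)
    \<le> (LINT y|lborel. indicator (cball y0 R) y * \<psi> y * dyadic_kernel m (x - y))"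
proof -
  let ?V = "unit_ball_vol DIM('a)" and ?N = "DIM('a)"
  have [measurable]: "cball y0 R \<in> sets borel" by (intro borel_closed closed_cball)
  define e where "e = (y0 - x0) /\<^sub>R R"
  have e: "norm e = 1" "y0 = x0 + R *\<^sub>R e" using R by (auto simp: e_def)
  define c where "c i = x0 + (1 / (4 * 2 ^ i)) *\<^sub>R e" for i :: nat
  define b where "b i = ball (c i) (1 / (8 * 2 ^ i))" for i :: nat
  \<comment> \<open>The upper end, \<open>i + 3 \<le> n\<close>, gives
    \<open>1 / (8 * 2 ^ i) \<ge> 1 / 2 ^ n \<ge> \<rho>\<close>; the lower end keeps the centres
    within distance \<open>R\<close> of \<open>x0\<close>.\<close>
  define I where "I = {i0..<n - 2}"
  have ball_facts: "y \<in> cball y0 R" "\<rho> \<le> norm (y - x0)" "norm (x - y) < 1 / 2 ^ i"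
    if i: "i \<in> I" and y: "y \<in> b i" for i y
  proof -
    define r where "r = 1 / (4 * 2 ^ i :: real)"
    have r: "0 < r" "1 / 2 ^ i = 4 * r" "1 / (8 * 2 ^ i) = r / 2" "c i = x0 + r *\<^sub>R e" by (auto simp: r_def c_def)
    have yc: "norm (y - c i) < r / 2" using y by (simp add: b_def r(3) dist_norm norm_minus_commute)
    have "1 / 2 ^ i \<le> (1::real) / 2 ^ i0" using i by (simp add: I_def frac_le power_increasing)
    then have rR: "r \<le> R" using i0 r(2) by linarith
    have "norm (c i - y0) = norm ((r - R) *\<^sub>R e)" unfolding r(4) e(2) by (simp add: algebra_simps)
    then have "norm (c i - y0) = R - r" using rR e(1) by simp
    moreover have "norm (y - y0) \<le> norm (y - c i) + norm (c i - y0)" using norm_triangle_ineq[of "y - c i" "c i - y0"] by simp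
    ultimately have "norm (y - y0) \<le> R" using yc r(1) by linarith
    then show "y \<in> cball y0 R" by (simp add: dist_norm norm_minus_commute)
    have cx: "norm (c i - x0) = r" using r e(1) by simp
    have "norm (c i - x0) \<le> norm (c i - y) + norm (y - x0)" using norm_triangle_ineq[of "c i - y" "y - x0"] by simp
    then have lo: "r / 2 \<le> norm (y - x0)" using yc cx by (simp add: norm_minus_commute)
    have "i + 3 \<le> n" using i by (auto simp: I_def)
    then have "(1::real) / 2 ^ n \<le> 1 / 2 ^ (i + 3)" by (intro frac_le power_increasing) auto
    also have "\<dots> = r / 2" by (simp add: r_def power_add)
    finally have \<rho>r: "\<rho> \<le> r / 2" using \<rho>(2) by linarith
    then show "\<rho> \<le> norm (y - x0)" using lo by linarith
    have "norm (x - y) \<le> norm (x - x0) + norm (y - x0)" using norm_triangle_ineq4[of "x - x0" "y - x0"] by simp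
    moreover have "norm (y - x0) \<le> norm (y - c i) + norm (c i - x0)" using norm_triangle_ineq[of "y - c i" "c i - x0"] by simp
    ultimately have "norm (x - y) < 4 * r" using yc cx \<rho>r \<rho>(1) r(1) by linarith
    then show "norm (x - y) < 1 / 2 ^ i" using r(2) by simp
  qed
  have I: "has_bochner_integral lborel (\<lambda>y. \<Sum>i\<in>I. 2 ^ (i * ?N) * g * indicator (b i) y) (\<Sum>i\<in>I. 2 ^ (i * ?N) * g * (?V * (1 / (8 * 2 ^ i)) ^ ?N))"
    unfolding b_def
    by (intro has_bochner_integral_sum has_bochner_integral_mult_right has_bochner_integral_indicator_ball) auto
  have "?V * (1/8) ^ ?N * g * (real n - 2 - real i0) \<le> ?V * (1/8) ^ ?N * g * real (card I)"
    using g by (intro mult_left_mono) (auto simp: I_def)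
  also have "\<dots> = (\<Sum>i\<in>I. 2 ^ (i * ?N) * g * (?V * (1 / (8 * 2 ^ i)) ^ ?N))"
    by (simp add: power_mult power_divide power_mult_distrib)
  also have "\<dots> = (LINT y|lborel. (\<Sum>i\<in>I. 2 ^ (i * ?N) * g * indicator (b i) y))"
    using I by (simp add: has_bochner_integral_iff)
  also have "\<dots> \<le> (LINT y|lborel. indicator (cball y0 R) y * \<psi> y * dyadic_kernel m (x - y))"
  proof (rule integral_mono)
    show "integrable lborel (\<lambda>y. \<Sum>i\<in>I. 2 ^ (i * ?N) * g * indicator (b i) y)" using I by (simp add: has_bochner_integral_iff)
    show "integrable lborel (\<lambda>y. indicator (cball y0 R) y * \<psi> y * dyadic_kernel m (x - y))"
    proof (rule Bochner_Integration.integrable_bound)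
      show "integrable lborel (\<lambda>y. dyadic_kernel m (x - y))" by (intro integrable_lborel_reflect integrable_dyadic_kernel)
      show "AE y in lborel. norm (indicator (cball y0 R) y * \<psi> y * dyadic_kernel m (x - y)) \<le> norm (dyadic_kernel m (x - y))"
      proof (intro AE_I2)
        fix y
        have "\<bar>indicator (cball y0 R) y * \<psi> y\<bar> * dyadic_kernel m (x - y) \<le> 1 * dyadic_kernel m (x - y)"
          using \<psi>[of y] by (intro mult_right_mono) (auto simp: indicator_def)
        then show "norm (indicator (cball y0 R) y * \<psi> y * dyadic_kernel m (x - y)) \<le> norm (dyadic_kernel m (x - y))"
          by (simp add: abs_mult)
      qed
    qed measurable
    fix y
    show "(\<Sum>i\<in>I. 2 ^ (i * ?N) * g * indicator (b i) y) \<le> indicator (cball y0 R) y * \<psi> y * dyadic_kernel m (x - y)"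
    proof (cases "\<exists>i\<in>I. y \<in> b i")
      case False
      then have "(\<Sum>i\<in>I. 2 ^ (i * ?N) * g * indicator (b i) y) = 0" by (intro sum.neutral) auto
      then show ?thesis using \<psi>(1)[of y] by simp
    next
      case True
      then have yB: "y \<in> cball y0 R" and gy: "g \<le> \<psi> y" using ball_facts g(2) by blast+
      have "(\<Sum>i\<in>I. 2 ^ (i * ?N) * g * indicator (b i) y) \<le> (\<Sum>i\<in>I. \<psi> y * (2 ^ (i * ?N) * indicator (ball 0 (1 / 2 ^ i)) (x - y)))"
      proof (intro sum_mono)
        fix i assume i: "i \<in> I"
        show "2 ^ (i * ?N) * g * indicator (b i) y \<le> \<psi> y * (2 ^ (i * ?N) * indicator (ball 0 (1 / 2 ^ i)) (x - y))"
          using ball_facts(3)[OF i, of y] gy \<psi>(1)[of y] by (cases "y \<in> b i") (auto simp: indicator_def)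
      qed
      also have "\<dots> = \<psi> y * (\<Sum>i\<in>I. 2 ^ (i * ?N) * indicator (ball 0 (1 / 2 ^ i)) (x - y))" by (simp add: sum_distrib_left)
      also have "\<dots> \<le> \<psi> y * dyadic_kernel m (x - y)"
        unfolding dyadic_kernel_def using \<psi>(1) nm by (intro mult_left_mono sum_mono2) (auto simp: I_def)
      finally show ?thesis using yB by simp
    qed
  qed
  finally show ?thesis .
qed

text \<open>The quantity multiplied by \<open>K\<close> in hypothesis \<open>super\<close> of
  \<open>comparison_principle\<close>: the gain from the exterior ball plus the operator applied to
  the barrier.\<close>

definition barrier_gap :: "real \<Rightarrow> real \<Rightarrow> real \<Rightarrow> 'a::euclidean_space \<Rightarrow> 'a \<Rightarrow> real \<Rightarrow> nat \<Rightarrow> 'a \<Rightarrow> real" where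
  "barrier_gap \<beta> c R y0 x0 \<eta> m x =
    (LINT y|lborel. indicator (cball y0 R) y * gmod \<beta> (norm (y - x0) + \<eta>) * (c * dyadic_kernel m (x - y))) +
    (LINT y|lborel. (gmod \<beta> (norm (x - x0) + \<eta>) - gmod \<beta> (norm (y - x0) + \<eta>)) * J (x - y))"

text \<open>With \<open>\<rho>\<close> of order \<open>1 / 2 ^ n\<close> and
  \<open>q = (n + 2) powr (1 - \<beta>)\<close>, the gain is at least \<open>a / 2 * q\<close> and
  the loss at most \<open>C * (13 + 2 * \<beta> * q)\<close>. The choice of \<open>\<beta>\<close>
  leaves a surplus \<open>a / 4 * q\<close>, which is unbounded as \<open>\<rho>\<close> shrinks.
  Only \<open>\<delta>\<close> has to depend on \<open>R\<close>.\<close>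

lemma barrier_supersolution:
  "\<exists>\<beta> c. 0 < \<beta> \<and> \<beta> \<le> 1/2 \<and> 0 < c \<and> (\<forall>n. \<forall>y::'a::euclidean_space. y \<noteq> 0 \<longrightarrow> c * dyadic_kernel n y \<le> J y) \<and>
    (\<forall>R>0. \<exists>\<delta>>0. \<forall>x0 y0 x :: 'a. \<forall>\<eta> m. norm (y0 - x0) = R \<longrightarrow> 0 < \<eta> \<longrightarrow> 1 / 2 ^ m \<le> \<eta> \<longrightarrow> norm (x - x0) + \<eta> \<le> \<delta> \<longrightarrow>
      1 \<le> barrier_gap \<beta> c R y0 x0 \<eta> m x)"
proof -
  let ?V = "unit_ball_vol DIM('a)" and ?N = "DIM('a)"
  obtain c where "c > 0" and cJ: "\<And>n. \<And>y::'a. y \<noteq> 0 \<Longrightarrow> c * dyadic_kernel n y \<le> J y"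
    using dyadic_kernel_le_J by blast
  obtain C where "C > 0" and C: "\<forall>H \<Lambda>. \<forall>h :: 'a \<Rightarrow> real. dyadic_J_bound C H \<Lambda> h"
    using nn_integral_J_le[where 'a='a] by (elim exE conjE)
  obtain C' where C': "\<forall>\<Lambda>\<ge>0. \<forall>\<psi> :: 'a \<Rightarrow> real. \<psi> \<in> borel_measurable borel \<longrightarrow>
     (\<forall>x y. \<bar>\<psi> x - \<psi> y\<bar> \<le> min 1 (\<Lambda> * norm (x - y))) \<longrightarrow>
     (\<forall>x. (\<integral>\<^sup>+y. ennreal (\<bar>\<psi> x - \<psi> y\<bar> * J (x - y)) \<partial>lborel) \<le> ennreal (C' * (2 * \<Lambda> + 1)))"
    using nn_integral_J_lipschitz[where 'a='a] by (elim exE)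
  define a where "a = c * (?V * (1/8) ^ ?N)"
  have a: "a > 0" using \<open>c > 0\<close> by (simp add: a_def)
  define \<beta> where "\<beta> = min (1/2) (a / (8 * C))"
  have \<beta>: "0 < \<beta>" "\<beta> \<le> 1/2" "2 * \<beta> * C \<le> a / 4"
  proof -
    have "\<beta> \<le> a / (8 * C)" unfolding \<beta>_def by (rule min.cobounded2)
    then show "2 * \<beta> * C \<le> a / 4" using \<open>C > 0\<close> by (simp add: field_simps)
  qed (use a \<open>C > 0\<close> in \<open>auto simp: \<beta>_def\<close>)
  have "\<exists>\<delta>>0. \<forall>x0 y0 x :: 'a. \<forall>\<eta> m. norm (y0 - x0) = R \<longrightarrow> 0 < \<eta> \<longrightarrow> 1 / 2 ^ m \<le> \<eta> \<longrightarrow> norm (x - x0) + \<eta> \<le> \<delta> \<longrightarrow>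
      1 \<le> barrier_gap \<beta> c R y0 x0 \<eta> m x"
    if R: "R > 0" for R
  proof -
    obtain i0 :: nat where "1 / (4 * R) < 2 ^ i0" using real_arch_pow[of 2 "1 / (4 * R)"] by auto
    then have i0: "1 / 2 ^ i0 \<le> 4 * R" using R by (simp add: field_simps)
    \<comment> \<open>The square is tied to \<open>\<beta> \<le> 1/2\<close>: then
      \<open>q \<ge> sqrt (n + 2)\<close>, so \<open>q\<close> passes the threshold
      \<open>(13 * C + 1) * 4 / a\<close>.\<close>
    obtain n0 :: nat where n0: "((13 * C + 1) * 4 / a)\<^sup>2 \<le> real n0" using real_arch_simple by blast
    \<comment> \<open>\<open>n \<ge> 2 * i0 + 6\<close> makes the number of usable scales,
      \<open>n - 2 - i0\<close>, at least \<open>(n + 2) / 2\<close>.\<close>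
    define n1 where "n1 = max n0 (2 * i0 + 6)"
    define \<delta> where "\<delta> = (1::real) / 2 ^ n1"
    have "\<delta> > 0" by (simp add: \<delta>_def)
    moreover have "1 \<le> barrier_gap \<beta> c R y0 x0 \<eta> m x"
      if y0: "norm (y0 - x0) = R" and \<eta>: "0 < \<eta>" and m: "1 / 2 ^ m \<le> \<eta>" and \<delta>: "norm (x - x0) + \<eta> \<le> \<delta>" for x0 y0 x :: 'a and \<eta> m
    proof -
      define \<psi> where "\<psi> y = gmod \<beta> (norm (y - x0) + \<eta>)" for y
      have [measurable]: "\<psi> \<in> borel_measurable borel" unfolding \<psi>_def by measurable
      have pos: "0 < norm (y - x0) + \<eta>" for y using \<eta> by (simp add: add_nonneg_pos)
      have \<psi>: "0 \<le> \<psi> y" "\<psi> y \<le> 1" for y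
        using gmod_pos[OF pos, of \<beta> y] gmod_le_1[OF pos, of \<beta> y] \<beta> by (auto simp: \<psi>_def)
      have lip: "\<bar>\<psi> x - \<psi> y\<bar> \<le> min 1 (2 / \<eta> * norm (x - y))" for x y
        unfolding \<psi>_def using \<beta> \<eta> by (intro gmod_radial_lipschitz) auto
      define \<rho> where "\<rho> = norm (x - x0) + \<eta>"
      have \<rho>: "0 < \<rho>" "\<eta> \<le> \<rho>" using \<eta> by (auto simp: \<rho>_def add_nonneg_pos)
      have d1: "\<delta> \<le> 1" by (simp add: \<delta>_def)
      have "1 \<le> 1 / \<rho>" using \<delta> d1 \<rho> by (simp add: \<rho>_def)
      then obtain n where n: "2 ^ n \<le> 1 / \<rho>" "1 / \<rho> < 2 ^ Suc n" using power_of_two_bracket by metis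
      have \<rho>n: "1 / 2 ^ Suc n < \<rho>" "\<rho> \<le> 1 / 2 ^ n" using n \<rho> by (auto simp: field_simps)
      have "\<rho> \<le> 1 / 2 ^ n1" using \<delta> by (simp add: \<rho>_def \<delta>_def)
      then have "(2::real) ^ n1 \<le> 1 / \<rho>" using \<rho>(1) by (simp add: field_simps)
      then have "(2::real) ^ n1 < 2 ^ Suc n" using n by linarith
      then have nn1: "n1 \<le> n" by (simp add: power_less_imp_less_exp less_Suc_eq_le del: power_Suc)
      have "(1::real) / 2 ^ m \<le> 1 / 2 ^ n" using m \<rho>(2) \<rho>n(2) by linarith
      then have nm: "n \<le> m" by (simp add: frac_le field_simps)
      define q where "q = real (n + 2) powr (1 - \<beta>)"
      have g\<rho>: "real (n + 2) powr (- \<beta>) \<le> gmod \<beta> \<rho>"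
        using gmod_mono[of "1 / 2 ^ Suc n" \<rho> \<beta>] \<rho>n \<beta> gmod_dyadic[of \<beta> "Suc n"] by (simp add: add.commute)
      have "a * (gmod \<beta> \<rho> * (real n - 2 - real i0))
         = c * (?V * (1/8) ^ ?N * gmod \<beta> \<rho> * (real n - 2 - real i0))"
        by (simp add: a_def)
      also have "\<dots> \<le> c * (LINT y|lborel. indicator (cball y0 R) y * \<psi> y * dyadic_kernel m (x - y))"
      proof (intro mult_left_mono dyadic_kernel_gain[OF y0 R i0 nm _ \<rho>n(2)] \<psi>)
        show "norm (x - x0) \<le> \<rho>" using \<eta> by (simp add: \<rho>_def)
        show "0 \<le> gmod \<beta> \<rho>" using gmod_pos[OF \<rho>(1), of \<beta>] by simp
        show "gmod \<beta> \<rho> \<le> \<psi> y" if "\<rho> \<le> norm (y - x0)" for y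
          unfolding \<psi>_def using that \<rho> \<beta> \<eta> by (intro gmod_mono) auto
      qed (use \<open>c > 0\<close> in auto)
      also have "\<dots> = (LINT y|lborel. indicator (cball y0 R) y * \<psi> y * (c * dyadic_kernel m (x - y)))"
        by (subst Bochner_Integration.integral_mult_right_zero[symmetric]) (intro Bochner_Integration.integral_cong refl, simp add: mult_ac)
      finally have gain: "a * (gmod \<beta> \<rho> * (real n - 2 - real i0)) \<le> (LINT y|lborel. indicator (cball y0 R) y * \<psi> y * (c * dyadic_kernel m (x - y)))" .
      have "q / 2 = real (n + 2) powr (- \<beta>) * (real (n + 2) / 2)"
        using powr_add[of "real (n + 2)" 1 "- \<beta>"] by (simp add: q_def)
      also have "\<dots> \<le> gmod \<beta> \<rho> * (real n - 2 - real i0)"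
        using g\<rho> nn1 gmod_pos[OF \<rho>(1), of \<beta>] by (intro mult_mono) (auto simp: n1_def)
      finally have "a * (q / 2) \<le> a * (gmod \<beta> \<rho> * (real n - 2 - real i0))" using a by (intro mult_left_mono) auto
      with gain have gain': "a / 2 * q \<le> (LINT y|lborel. indicator (cball y0 R) y * \<psi> y * (c * dyadic_kernel m (x - y)))" by simp
      \<comment> \<open>Only the positive part of \<open>h\<close> is a loss. By the triangle
        inequality the barrier rises within distance \<open>norm y\<close> of \<open>x\<close> at
        most to its value at radius \<open>\<rho> + norm y\<close>.\<close>
      define h where "h y = \<psi> (x - y) - \<psi> x" for y
      define H where "H r = gmod \<beta> (\<rho> + max r 0) - gmod \<beta> \<rho>" for r
      have [measurable]: "h \<in> borel_measurable borel" unfolding h_def by measurable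
      have "(\<integral>\<^sup>+y. ennreal (h y * J y) \<partial>lborel) \<le> ennreal C * ((\<Sum>i. ennreal (H (1 / 2 ^ i))) + ennreal 1)"
      proof (rule C[unfolded dyadic_J_bound_def, THEN spec, THEN spec, THEN spec, THEN mp, THEN mp, THEN mp, THEN mp, THEN mp])
        show "\<forall>y. h y \<le> H (norm y)"
        proof
          fix y
          have "norm (x - y - x0) \<le> norm (x - x0) + norm y" using norm_triangle_ineq4[of "x - x0" y] by (simp add: algebra_simps)
          then have "\<psi> (x - y) \<le> gmod \<beta> (\<rho> + norm y)" unfolding \<psi>_def \<rho>_def using pos \<beta> by (intro gmod_mono) auto
          then show "h y \<le> H (norm y)" by (simp add: h_def H_def \<psi>_def \<rho>_def)
        qed
        show "mono H" unfolding H_def using \<rho> \<beta> by (intro monoI diff_right_mono gmod_mono) (auto simp: add_pos_nonneg)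
        show "\<forall>r. H r \<le> 1"
        proof
          fix r
          have "gmod \<beta> (\<rho> + max r 0) \<le> 1" using \<rho> \<beta> by (intro gmod_le_1) (auto simp: add_pos_nonneg)
          then show "H r \<le> 1" using gmod_pos[OF \<rho>(1), of \<beta>] by (simp add: H_def)
        qed
        show "\<forall>r\<ge>0. 0 \<le> H r" using \<rho> \<beta> by (auto simp: H_def intro!: gmod_mono)
      qed simp
      also have "(\<Sum>i. ennreal (H (1 / 2 ^ i))) \<le> ennreal (12 + 2 * \<beta> * q)"
        using gmod_increment_sum[OF \<beta>(1,2) \<rho>n] by (simp add: H_def q_def)
      finally have "(\<integral>\<^sup>+y. ennreal (h y * J y) \<partial>lborel) \<le> ennreal C * (ennreal (12 + 2 * \<beta> * q) + ennreal 1)"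
        by (simp add: add_right_mono mult_left_mono)
      also have "ennreal (12 + 2 * \<beta> * q) + ennreal 1 = ennreal (12 + 2 * \<beta> * q + 1)"
        using \<beta> by (intro ennreal_plus[symmetric]) (auto simp: q_def)
      also have "12 + 2 * \<beta> * q + 1 = 13 + 2 * \<beta> * q" by simp
      also have "ennreal C * ennreal (13 + 2 * \<beta> * q) = ennreal (C * (13 + 2 * \<beta> * q))"
        using \<beta> \<open>C > 0\<close> by (intro ennreal_mult[symmetric]) (auto simp: q_def)
      finally have nn: "(\<integral>\<^sup>+y. ennreal (h y * J y) \<partial>lborel) \<le> ennreal (C * (13 + 2 * \<beta> * q))" .
      have ihJ: "integrable lborel (\<lambda>y. h y * J y)"
      proof (rule integrableI_bounded)
        have "(\<integral>\<^sup>+y. ennreal (norm (h y * J y)) \<partial>lborel) = (\<integral>\<^sup>+y. ennreal (\<bar>\<psi> x - \<psi> y\<bar> * J (x - y)) \<partial>lborel)"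
          using nn_integral_lborel_reflect[of "\<lambda>y. ennreal (norm (h y * J y))" x] by (simp add: h_def abs_mult abs_minus_commute)
        also have "\<dots> \<le> ennreal (C' * (2 * (2 / \<eta>) + 1))" using \<eta> lip by (intro C'[rule_format]) auto
        finally show "(\<integral>\<^sup>+y. ennreal (norm (h y * J y)) \<partial>lborel) < \<infinity>" by (rule le_less_trans) simp
      qed measurable
      have "(LINT y|lborel. h y * J y) \<le> C * (13 + 2 * \<beta> * q)"
        using nn \<beta> \<open>C > 0\<close> by (intro integral_real_bounded) (auto simp: q_def)
      moreover have "(LINT y|lborel. (\<psi> x - \<psi> y) * J (x - y)) = (LINT y|lborel. - (h y * J y))"
        using integral_lborel_reflect[of "\<lambda>y. - (h y * J y)" x] by (simp add: h_def algebra_simps)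
      ultimately have bad: "- (C * (13 + 2 * \<beta> * q)) \<le> (LINT y|lborel. (\<psi> x - \<psi> y) * J (x - y))" by simp
      have qnn: "0 \<le> q" by (simp add: q_def)
      have "2 * \<beta> * C * q \<le> a / 4 * q" using \<beta>(3) qnn by (rule mult_right_mono)
      then have "C * (13 + 2 * \<beta> * q) \<le> 13 * C + a / 4 * q" by (simp add: algebra_simps)
      moreover have "1 \<le> a / 4 * q - 13 * C"
      proof -
        have "(13 * C + 1) * 4 / a = sqrt (((13 * C + 1) * 4 / a)\<^sup>2)" using a \<open>C > 0\<close> by simp
        also have "\<dots> \<le> sqrt (real (n + 2))" using n0 nn1 by (intro real_sqrt_le_mono) (auto simp: n1_def)
        also have "\<dots> = real (n + 2) powr (1/2)" by (simp add: powr_half_sqrt)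
        also have "\<dots> \<le> q" unfolding q_def using \<beta> by (intro powr_mono) auto
        finally show ?thesis using a by (simp add: field_simps)
      qed
      ultimately have "1 \<le> (LINT y|lborel. indicator (cball y0 R) y * \<psi> y * (c * dyadic_kernel m (x - y))) + (LINT y|lborel. (\<psi> x - \<psi> y) * J (x - y))"
        using gain' bad by linarith
      then show ?thesis by (simp only: barrier_gap_def \<psi>_def)
    qed
    ultimately show ?thesis by blast
  qed
  then show ?thesis using \<beta>(1,2) \<open>c > 0\<close> cJ by blast
qed

text \<open>\<open>K\<close> is fixed before the boundary point and \<eta>; this uniformity allows
  the later passage to all boundary points and to vanishing \<eta>.\<close>

definition decay_bound :: "real \<Rightarrow> real \<Rightarrow> real \<Rightarrow> real \<Rightarrow> real \<Rightarrow> 'a::euclidean_space set \<Rightarrow> bool" where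
  "decay_bound \<beta> R M F K \<Omega> \<longleftrightarrow> (\<forall>f u x0 y0 \<eta>. bounded \<Omega> \<longrightarrow> open \<Omega> \<longrightarrow> wsol \<Omega> f u \<longrightarrow>
     f \<in> borel_measurable borel \<longrightarrow> (\<forall>x. \<bar>f x\<bar> \<le> F) \<longrightarrow> (\<forall>x. \<bar>u x\<bar> \<le> M) \<longrightarrow>
     norm (y0 - x0) = R \<longrightarrow> cball y0 R \<inter> \<Omega> = {} \<longrightarrow> 0 < \<eta> \<longrightarrow>
     (AE x in lborel. \<bar>u x\<bar> \<le> K * gmod \<beta> (norm (x - x0) + \<eta>)))"

lemma boundary_decay:
  "\<exists>\<beta>. 0 < \<beta> \<and> \<beta> \<le> 1/2 \<and> (\<forall>R>0. \<forall>M F. \<exists>K\<ge>0. \<forall>\<Omega> :: 'a::euclidean_space set. decay_bound \<beta> R M F K \<Omega>)"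
proof -
  obtain \<beta> c where \<beta>: "0 < \<beta>" "\<beta> \<le> 1/2" and c: "0 < c" and cJ: "\<forall>n. \<forall>y::'a. y \<noteq> 0 \<longrightarrow> c * dyadic_kernel n y \<le> J y"
    and sup: "\<forall>R>0. \<exists>\<delta>>0. \<forall>x0 y0 x :: 'a. \<forall>\<eta> m. norm (y0 - x0) = R \<longrightarrow> 0 < \<eta> \<longrightarrow> 1 / 2 ^ m \<le> \<eta> \<longrightarrow> norm (x - x0) + \<eta> \<le> \<delta> \<longrightarrow>
      1 \<le> barrier_gap \<beta> c R y0 x0 \<eta> m x"
    using barrier_supersolution[where 'a='a] by (elim exE conjE)
  obtain C where C: "\<forall>\<Lambda>\<ge>0. \<forall>\<psi> :: 'a \<Rightarrow> real. \<psi> \<in> borel_measurable borel \<longrightarrow>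
     (\<forall>x y. \<bar>\<psi> x - \<psi> y\<bar> \<le> min 1 (\<Lambda> * norm (x - y))) \<longrightarrow>
     (\<forall>x. (\<integral>\<^sup>+y. ennreal (\<bar>\<psi> x - \<psi> y\<bar> * J (x - y)) \<partial>lborel) \<le> ennreal (C * (2 * \<Lambda> + 1)))"
    using nn_integral_J_lipschitz[where 'a='a] by (elim exE)
  have "\<exists>K\<ge>0. \<forall>\<Omega> :: 'a set. decay_bound \<beta> R M F K \<Omega>" if R: "R > 0" for R M F
  proof -
    obtain \<delta> where \<delta>: "\<delta> > 0" and D: "\<forall>x0 y0 x :: 'a. \<forall>\<eta> m. norm (y0 - x0) = R \<longrightarrow> 0 < \<eta> \<longrightarrow> 1 / 2 ^ m \<le> \<eta> \<longrightarrow> norm (x - x0) + \<eta> \<le> \<delta> \<longrightarrow>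
      1 \<le> barrier_gap \<beta> c R y0 x0 \<eta> m x"
      using sup[rule_format, OF R] by (elim exE conjE)
    \<comment> \<open>The first summand makes \<open>K\<close> times a gap of at least
      \<open>1\<close> exceed \<open>F\<close>. The second gives
      \<open>K * gmod \<beta> \<delta> \<ge> M\<close>, so that \<open>u\<close> can exceed the
      barrier only within \<open>\<delta>\<close> of \<open>x0\<close>, where the supersolution
      estimate is available.\<close>
    define K where "K = (\<bar>F\<bar> + 1) + \<bar>M\<bar> / gmod \<beta> \<delta>"
    have g\<delta>: "gmod \<beta> \<delta> > 0" by (rule gmod_pos[OF \<delta>])
    have K: "0 \<le> K" "F < K * 1" "M \<le> K * gmod \<beta> \<delta>"
    proof -
      have "0 \<le> \<bar>M\<bar> / gmod \<beta> \<delta>" using g\<delta> by simp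
      then show "0 \<le> K" "F < K * 1" unfolding K_def mult_1_right by linarith+
      have "K * gmod \<beta> \<delta> = (\<bar>F\<bar> + 1) * gmod \<beta> \<delta> + \<bar>M\<bar>" unfolding K_def using g\<delta> by (simp add: distrib_right)
      moreover have "0 \<le> (\<bar>F\<bar> + 1) * gmod \<beta> \<delta>" using g\<delta> by simp
      ultimately show "M \<le> K * gmod \<beta> \<delta>" by linarith
    qed
    have one: "AE x in lborel. u x \<le> K * gmod \<beta> (norm (x - x0) + \<eta>)"
      if \<Omega>: "bounded \<Omega>" "open \<Omega>" and sol: "wsol \<Omega> f u" and f: "f \<in> borel_measurable borel" "\<And>x. \<bar>f x\<bar> \<le> F"
        and u: "\<And>x. \<bar>u x\<bar> \<le> M" and y0: "norm (y0 - x0) = R" and B: "cball y0 R \<inter> \<Omega> = {}" and \<eta>: "0 < \<eta>"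
      for \<Omega> f and u :: "'a \<Rightarrow> real" and x0 y0 \<eta>
    proof -
      have pos: "0 < norm (y - x0) + \<eta>" for y using \<eta> by (simp add: add_nonneg_pos)
      \<comment> \<open>The dyadic kernel has to resolve the scale \<eta>, the smallest value of the
        shifted radius.\<close>
      obtain m :: nat where "1 / \<eta> < 2 ^ m" using real_arch_pow[of 2 "1 / \<eta>"] by auto
      then have m: "1 / 2 ^ m \<le> \<eta>" using \<eta> by (simp add: field_simps)
      have lip: "\<bar>gmod \<beta> (norm (x - x0) + \<eta>) - gmod \<beta> (norm (y - x0) + \<eta>)\<bar> \<le> min 1 (2 / \<eta> * norm (x - y))" for x y :: 'a
        using \<beta> \<eta> by (intro gmod_radial_lipschitz) auto
      show ?thesis
      proof (rule comparison_principle[where \<psi>="\<lambda>x. gmod \<beta> (norm (x - x0) + \<eta>)" and j="\<lambda>y. c * dyadic_kernel m y"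
            and D="C * (2 * (2 / \<eta>) + 1)", OF sol \<Omega> f])
        show "(\<lambda>x. gmod \<beta> (norm (x - x0) + \<eta>)) \<in> borel_measurable borel" by measurable
        show "0 \<le> gmod \<beta> (norm (x - x0) + \<eta>)" for x using gmod_pos[OF pos, of \<beta> x] by simp
        show "gmod \<beta> (norm (x - x0) + \<eta>) \<le> 1" for x using gmod_le_1[OF pos, of \<beta> x] \<beta> by simp
        show "(\<integral>\<^sup>+y. ennreal (\<bar>gmod \<beta> (norm (x - x0) + \<eta>) - gmod \<beta> (norm (y - x0) + \<eta>)\<bar> * J (x - y)) \<partial>lborel) \<le> ennreal (C * (2 * (2 / \<eta>) + 1))" for x
          using C[THEN spec, of "2 / \<eta>", THEN mp, THEN spec, of "\<lambda>x. gmod \<beta> (norm (x - x0) + \<eta>)", THEN mp, THEN mp, THEN spec, of x] lip \<eta> by simp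
        show "0 \<le> K" by fact
        show "cball y0 R \<in> sets borel" by (intro borel_closed closed_cball)
        show "cball y0 R \<inter> \<Omega> = {}" by fact
        show "integrable lborel (\<lambda>y::'a. c * dyadic_kernel m y)" by (intro integrable_mult_right integrable_dyadic_kernel)
        show "0 \<le> c * dyadic_kernel m y" for y :: 'a using c by simp
        show "c * dyadic_kernel m y \<le> J y" if "y \<noteq> 0" for y :: 'a using cJ that by blast
        fix x assume x: "x \<in> \<Omega>" "K * gmod \<beta> (norm (x - x0) + \<eta>) < u x"
        have "norm (x - x0) + \<eta> \<le> \<delta>"
        proof (rule ccontr)
          assume "\<not> norm (x - x0) + \<eta> \<le> \<delta>"
          then have "gmod \<beta> \<delta> \<le> gmod \<beta> (norm (x - x0) + \<eta>)" using \<delta> \<beta> by (intro gmod_mono) auto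
          then have "K * gmod \<beta> \<delta> \<le> K * gmod \<beta> (norm (x - x0) + \<eta>)" using K(1) by (rule mult_left_mono)
          then show False using x(2) K(3) u[of x] by linarith
        qed
        then have "1 \<le> barrier_gap \<beta> c R y0 x0 \<eta> m x"
          using D y0 \<eta> m by blast
        from mult_left_mono[OF this K(1)]
        show "F < K * ((LINT y|lborel. indicator (cball y0 R) y * gmod \<beta> (norm (y - x0) + \<eta>) * (c * dyadic_kernel m (x - y)))
         + (LINT y|lborel. (gmod \<beta> (norm (x - x0) + \<eta>) - gmod \<beta> (norm (y - x0) + \<eta>)) * J (x - y)))"
          using K(2) unfolding barrier_gap_def by linarith
      qed
    qed
    have "AE x in lborel. \<bar>u x\<bar> \<le> K * gmod \<beta> (norm (x - x0) + \<eta>)"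
      if a: "bounded \<Omega>" "open \<Omega>" "wsol \<Omega> f u" "f \<in> borel_measurable borel" "\<forall>x. \<bar>f x\<bar> \<le> F"
        "\<forall>x. \<bar>u x\<bar> \<le> M" "norm (y0 - x0) = R" "cball y0 R \<inter> \<Omega> = {}" "0 < \<eta>"
      for \<Omega> f and u :: "'a \<Rightarrow> real" and x0 y0 \<eta>
    proof -
      have "AE x in lborel. u x \<le> K * gmod \<beta> (norm (x - x0) + \<eta>)" using a by (intro one) auto
      moreover have "AE x in lborel. - u x \<le> K * gmod \<beta> (norm (x - x0) + \<eta>)"
        using wsol_uminus[OF a(3)] a by (intro one[where f="\<lambda>x. - f x"]) auto
      ultimately show ?thesis by eventually_elim auto
    qed
    then show ?thesis using K(1) unfolding decay_bound_def by blast
  qed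
  then show ?thesis using \<beta> by blast
qed

text \<open>The exceptional set in \<open>dec\<close> depends on \<open>x0\<close> and
  \<open>\<eta>\<close>. Restricting to a countable dense set of boundary points and to
  \<open>\<eta> = 1 / (n + 1)\<close> leaves a single null set, on which the function is reset to
  \<open>0\<close>. An arbitrary \<open>x0\<close> is then approximated within half of
  \<open>norm (x - x0)\<close>, with \<open>\<eta>\<close> below the other half; this is the origin
  of the factor \<open>2\<close>.\<close>

lemma boundary_decay_representative:
  fixes u :: "'a::euclidean_space \<Rightarrow> real"
  assumes sol: "wsol \<Omega> f u" and \<Omega>: "open \<Omega>" and uM: "\<And>x. \<bar>u x\<bar> \<le> M" and "0 \<le> K" "0 \<le> \<beta>"
    and dec: "\<And>x0 \<eta>. x0 \<in> frontier \<Omega> \<Longrightarrow> 0 < \<eta> \<Longrightarrow> AE x in lborel. \<bar>u x\<bar> \<le> K * gmod \<beta> (norm (x - x0) + \<eta>)"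
  obtains v where "AE x in lborel. u x = v x" "wsol \<Omega> f v" "\<And>x. \<bar>v x\<bar> \<le> M"
    "\<And>x0 x. x0 \<in> frontier \<Omega> \<Longrightarrow> \<bar>v x\<bar> \<le> K * gmod \<beta> (2 * norm (x - x0))"
proof -
  have [measurable]: "u \<in> borel_measurable borel" using sol by (auto simp: wsol_def)
  have u0: "u x = 0" if "x \<notin> \<Omega>" for x using sol that by (auto simp: wsol_def test_fun_def)
  obtain D where D: "countable D" "D \<subseteq> frontier \<Omega>" "frontier \<Omega> \<subseteq> closure D" using separable by blast
  have "AE x in lborel. \<forall>x0\<in>D. \<forall>n::nat. \<bar>u x\<bar> \<le> K * gmod \<beta> (norm (x - x0) + inverse (real (Suc n)))"
    using D dec by (subst AE_ball_countable) (auto simp: AE_all_countable)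
  then obtain N where N: "N \<in> null_sets lborel"
    and good: "\<And>x x0 n. x \<notin> N \<Longrightarrow> x0 \<in> D \<Longrightarrow> \<bar>u x\<bar> \<le> K * gmod \<beta> (norm (x - x0) + inverse (real (Suc n)))"
    by (force elim!: AE_E3)
  have [measurable]: "N \<in> sets borel" using N by auto
  define v where "v x = (if x \<in> N then 0 else u x)" for x
  have [measurable]: "v \<in> borel_measurable borel" unfolding v_def by measurable
  have ae: "AE x in lborel. u x = v x" using AE_not_in[OF N] by eventually_elim (simp add: v_def)
  have "wsol \<Omega> f v" by (rule wsol_cong_AE[OF sol _ ae]) (auto simp: v_def u0)
  moreover have "\<bar>v x\<bar> \<le> M" for x using uM[of x] by (auto simp: v_def)
  moreover have "\<bar>v x\<bar> \<le> K * gmod \<beta> (2 * norm (x - x0))" if x0: "x0 \<in> frontier \<Omega>" for x x0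
  \<comment> \<open>At \<open>x = x0\<close> the value of \<open>gmod\<close> at \<open>0\<close> is
    meaningless as a modulus; there \<open>v\<close> vanishes and nonnegativity of the right-hand
    side is enough.\<close>
  proof (cases "x \<in> N \<or> x = x0")
    case True
    have "x0 \<notin> \<Omega>" using x0 \<Omega> by (simp add: frontier_def interior_open)
    then have "v x = 0" using True u0 by (auto simp: v_def)
    then show ?thesis using \<open>0 \<le> K\<close> by (simp add: gmod_def)
  next
    case False
    define d where "d = norm (x - x0)"
    have d: "d > 0" using False by (simp add: d_def)
    obtain x1 where x1: "x1 \<in> D" "dist x1 x0 < d / 2"
      using D(3) x0 d closure_approachable[of x0 D] by (meson half_gt_zero subsetD)
    obtain n :: nat where n: "inverse (real (Suc n)) < d / 2" using reals_Archimedean[of "d / 2"] d by auto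
    have "norm (x - x1) \<le> norm (x - x0) + norm (x0 - x1)" using norm_triangle_ineq[of "x - x0" "x0 - x1"] by simp
    then have le: "norm (x - x1) + inverse (real (Suc n)) \<le> 2 * d"
      using x1(2) n by (simp add: d_def dist_norm norm_minus_commute)
    have "\<bar>v x\<bar> \<le> K * gmod \<beta> (norm (x - x1) + inverse (real (Suc n)))" using good[OF _ x1(1)] False by (simp add: v_def)
    also have "\<dots> \<le> K * gmod \<beta> (2 * d)"
      using le \<open>0 \<le> K\<close> \<open>0 \<le> \<beta>\<close> by (intro mult_left_mono gmod_mono) (auto simp: add_nonneg_pos)
    finally show ?thesis by (simp add: d_def)
  qed
  ultimately show ?thesis using that ae by blast
qed

text \<open>The segment from an inner to an outer point meets the frontier at a point no farther
  from the inner one than the outer one is. Monotonicity of \<open>gmod\<close> converts decay at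
  that point into a bound by the length of the segment.\<close>

lemma abs_translate_diff_le_boundary:
  fixes v :: "'a::euclidean_space \<Rightarrow> real"
  assumes \<Omega>: "open \<Omega>" and v0: "\<And>x. x \<notin> \<Omega> \<Longrightarrow> v x = 0" and "0 \<le> K" "0 \<le> \<beta>"
    and dec: "\<And>x0 x. x0 \<in> frontier \<Omega> \<Longrightarrow> \<bar>v x\<bar> \<le> K * gmod \<beta> (2 * norm (x - x0))"
    and x: "x \<notin> \<Omega> \<or> x + h \<notin> \<Omega>"
  shows "\<bar>v (x + h) - v x\<bar> \<le> K * gmod \<beta> (2 * norm h)"
proof -
  have *: "\<bar>v p\<bar> \<le> K * gmod \<beta> (2 * norm (p - q))" if q: "q \<notin> \<Omega>" for p q
  proof (cases "p \<in> \<Omega>")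
    case False
    then show ?thesis using v0 \<open>0 \<le> K\<close> by (simp add: gmod_def)
  next
    case True
    have "closed_segment p q \<inter> frontier \<Omega> \<noteq> {}"
      by (rule connected_Int_frontier) (use True q in auto)
    then obtain x0 where x0: "x0 \<in> closed_segment p q" "x0 \<in> frontier \<Omega>" by blast
    have "x0 \<notin> \<Omega>" using x0(2) \<Omega> by (simp add: frontier_def interior_open)
    then have "p \<noteq> x0" using True by auto
    have "norm (p - x0) \<le> norm (p - q)" using segment_bound1[OF x0(1)] by (simp add: norm_minus_commute)
    have "\<bar>v p\<bar> \<le> K * gmod \<beta> (2 * norm (p - x0))" by (rule dec[OF x0(2)])
    also have "\<dots> \<le> K * gmod \<beta> (2 * norm (p - q))"
      using \<open>norm (p - x0) \<le> norm (p - q)\<close> \<open>p \<noteq> x0\<close> assms by (intro mult_left_mono gmod_mono) auto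
    finally show ?thesis .
  qed
  show ?thesis
  proof (cases "x \<in> \<Omega>")
    case False
    then show ?thesis using *[of x "x + h"] v0[of x] by simp
  next
    case True
    then have "x + h \<notin> \<Omega>" using x by blast
    then show ?thesis using *[of "x + h" x] v0[of "x + h"] by simp
  qed
qed

lemma fin_energy_diff:
  assumes "fin_energy u" "fin_energy w"
  shows "fin_energy (\<lambda>x. w x - u x)"
proof -
  have [measurable]: "u \<in> borel_measurable borel" "w \<in> borel_measurable borel" using assms by auto
  show ?thesis
  proof (rule fin_energy_dominated)
    show "integrable lborel2 (\<lambda>p. 2 * ((incr w p)\<^sup>2 * J (fst p - snd p)) + 2 * ((incr u p)\<^sup>2 * J (fst p - snd p)))"
      using assms by (auto simp: fin_energy_def)
    fix p :: "'a \<times> 'a"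
    have "(a - b - (c - d))\<^sup>2 \<le> 2 * (a - c)\<^sup>2 + 2 * (b - d)\<^sup>2" for a b c d :: real
      using zero_le_power2[of "(a - c) + (b - d)"] by (simp add: power2_eq_square algebra_simps)
    then have "(w (fst p) - u (fst p) - (w (snd p) - u (snd p)))\<^sup>2 * J (fst p - snd p)
        \<le> (2 * (incr w p)\<^sup>2 + 2 * (incr u p)\<^sup>2) * J (fst p - snd p)"
      by (rule mult_right_mono) simp
    then show "(w (fst p) - u (fst p) - (w (snd p) - u (snd p)))\<^sup>2 * J (fst p - snd p)
        \<le> 2 * ((incr w p)\<^sup>2 * J (fst p - snd p)) + 2 * ((incr u p)\<^sup>2 * J (fst p - snd p))"
      by (simp add: distrib_right mult.assoc)
  qed measurable
qed

section \<open>Modulus of continuity\<close>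

text \<open>Test the difference of the equations for \<open>v (x + h)\<close> and \<open>v x\<close>
  with the positive part of \<open>w - m\<close>. After \<open>J\<close> is lowered to
  \<open>k\<close>, the operator at a point with \<open>w x > m\<close> is at least
  \<open>\<kappa> * m\<close> minus the cost of translating \<open>k\<close>, while the right-hand
  sides differ by at most \<open>2 * F\<close>. Hypothesis \<open>m\<close> states that the former
  prevails.\<close>

lemma translate_diff_le:
  fixes v f :: "'a::euclidean_space \<Rightarrow> real"
  assumes sol: "wsol \<Omega> f v" and \<Omega>: "bounded \<Omega>" "open \<Omega>"
    and fm [measurable]: "f \<in> borel_measurable borel" and F: "\<And>x. \<bar>f x\<bar> \<le> F" and M: "\<And>x. \<bar>v x\<bar> \<le> M"
    and bd: "\<And>x. x \<notin> \<Omega> \<or> x + h \<notin> \<Omega> \<Longrightarrow> v (x + h) - v x \<le> m"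
    and c: "0 < c" and cJ: "\<And>y::'a. y \<noteq> 0 \<Longrightarrow> c * dyadic_kernel n y \<le> J y"
    and h: "norm h * 2 ^ n \<le> 1"
    and m: "2 * F + M * (c * (2 * unit_ball_vol DIM('a) * DIM('a))) < c * (real n * unit_ball_vol DIM('a)) * m"
  shows "AE x in lborel. v (x + h) - v x \<le> m"
proof -
  have tv: "test_fun \<Omega> v" using sol by (simp add: wsol_def)
  then have vm [measurable]: "v \<in> borel_measurable borel" by auto
  have fv: "fin_energy v" using tv by (simp add: test_fun_def)
  have F0: "0 \<le> F" and M0: "0 \<le> M" using F[of 0] M[of 0] by linarith+
  define k where "k y = c * dyadic_kernel n y" for y :: 'a
  define \<kappa> where "\<kappa> = c * (real n * unit_ball_vol DIM('a))"
  have \<kappa>: "0 \<le> \<kappa>" using c by (simp add: \<kappa>_def)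
  have [measurable]: "k \<in> borel_measurable borel" unfolding k_def by measurable
  have k: "0 \<le> k y" "k (x - y) = k (y - x)" for x y using c dyadic_kernel_minus_commute[of n x y] by (auto simp: k_def)
  have ik: "integrable lborel k" unfolding k_def by (intro integrable_mult_right integrable_dyadic_kernel)
  have Ik: "(LINT y|lborel. k y) = \<kappa>" unfolding k_def \<kappa>_def by (simp add: integral_dyadic_kernel)
  define w where "w x = v (x + h) - v x" for x
  define \<phi> where "\<phi> x = max (w x - m) 0" for x
  have [measurable]: "w \<in> borel_measurable borel" "\<phi> \<in> borel_measurable borel" unfolding \<phi>_def w_def by measurable
  have w2M: "\<bar>w x\<bar> \<le> 2 * M" for x using M[of x] M[of "x + h"] unfolding w_def by linarith
  have m0: "0 \<le> m"
  proof (rule ccontr)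
    assume "\<not> 0 \<le> m"
    then have "\<kappa> * m \<le> 0" using \<kappa> by (intro mult_nonneg_nonpos) auto
    moreover have "0 \<le> M * (c * (2 * unit_ball_vol DIM('a) * DIM('a)))" using M0 c by simp
    ultimately show False using m F0 unfolding \<kappa>_def by linarith
  qed
  have \<phi>0: "\<phi> x = 0" if "x \<notin> \<Omega> \<or> x + h \<notin> \<Omega>" for x using bd[OF that] by (simp add: \<phi>_def w_def)
  have \<phi>nn: "0 \<le> \<phi> x" for x by (simp add: \<phi>_def)
  have fvh: "fin_energy (\<lambda>x. v (x + h))" by (rule fin_energy_translate[OF fv])
  have fw: "fin_energy w" unfolding w_def by (rule fin_energy_diff[OF fv fvh])
  have f\<phi>: "fin_energy \<phi>"
  proof (rule fin_energy_dominated)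
    show "integrable lborel2 (\<lambda>p. (incr w p)\<^sup>2 * J (fst p - snd p))"
      using fw by (simp add: fin_energy_def)
    have "\<bar>\<phi> x - \<phi> y\<bar> \<le> \<bar>w x - w y\<bar>" for x y unfolding \<phi>_def by linarith
    then show "(incr \<phi> p)\<^sup>2 * J (fst p - snd p) \<le> (incr w p)\<^sup>2 * J (fst p - snd p)" for p
      by (intro mult_right_mono) (auto simp: abs_le_square_iff[symmetric])
  qed measurable
  have iv2: "integrable lborel (\<lambda>x. (v x)\<^sup>2)" using tv by (simp add: test_fun_def)
  have i\<phi>2: "integrable lborel (\<lambda>x. (\<phi> x)\<^sup>2)"
  proof (rule Bochner_Integration.integrable_bound)
    show "integrable lborel (\<lambda>x. 2 * (v (x + h))\<^sup>2 + 2 * (v x)\<^sup>2)"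
      using iv2 integrable_lborel_translate[OF iv2, of h] by simp
    have "(\<phi> x)\<^sup>2 \<le> 2 * (v (x + h))\<^sup>2 + 2 * (v x)\<^sup>2" for x
    proof -
      have "\<bar>\<phi> x\<bar> \<le> \<bar>w x\<bar>" using m0 unfolding \<phi>_def by linarith
      then have "(\<phi> x)\<^sup>2 \<le> (w x)\<^sup>2" by (simp add: abs_le_square_iff)
      also have "\<dots> \<le> 2 * (v (x + h))\<^sup>2 + 2 * (v x)\<^sup>2"
        using zero_le_power2[of "v (x + h) + v x"] by (simp add: w_def power2_eq_square algebra_simps)
      finally show ?thesis .
    qed
    then show "AE x in lborel. norm ((\<phi> x)\<^sup>2) \<le> norm (2 * (v (x + h))\<^sup>2 + 2 * (v x)\<^sup>2)"
      by (intro AE_I2) simp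
  qed measurable
  have t\<phi>: "test_fun \<Omega> \<phi>" using f\<phi> i\<phi>2 \<phi>0 by (auto simp: test_fun_def)
  have i\<phi>: "integrable lborel \<phi>" by (rule test_fun_integrable[OF t\<phi> \<Omega>])
  \<comment> \<open>\<open>\<phi> x \<noteq> 0\<close> forces both \<open>x\<close> and
    \<open>x + h\<close> into \<open>\<Omega>\<close>, so \<open>\<phi>\<close> and its
    back-translate are both admissible. Translation invariance of the form makes testing
    \<open>v\<close> with the latter the same as testing \<open>v (x + h)\<close> with
    \<open>\<phi>\<close>.\<close>
  define \<phi>' where "\<phi>' x = \<phi> (x - h)" for x
  have t\<phi>': "test_fun \<Omega> \<phi>'"
    unfolding test_fun_def
  proof (intro conjI allI impI)
    show "fin_energy \<phi>'" using fin_energy_translate[OF f\<phi>, of "- h"] by (simp add: \<phi>'_def[abs_def])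
    show "integrable lborel (\<lambda>x. (\<phi>' x)\<^sup>2)" using integrable_lborel_translate[OF i\<phi>2, of "- h"] by (simp add: \<phi>'_def)
    show "\<phi>' x = 0" if "x \<notin> \<Omega>" for x using \<phi>0[of "x - h"] that by (simp add: \<phi>'_def)
  qed
  have [measurable]: "\<phi>' \<in> borel_measurable borel" unfolding \<phi>'_def by measurable
  have "bform (\<lambda>x. v (x + h)) \<phi> = bform v \<phi>'"
    using bform_translate[of v \<phi>' h] fv t\<phi>' by (simp add: \<phi>'_def test_fun_def)
  also have "\<dots> = (LINT x|lborel. f x * \<phi>' x)" using sol t\<phi>' by (simp add: wsol_def)
  also have "\<dots> = (LINT x|lborel. f (x + h) * \<phi> x)"
    using integral_lborel_translate[of "\<lambda>x. f x * \<phi>' x" h] by (simp add: \<phi>'_def)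
  finally have B1: "bform (\<lambda>x. v (x + h)) \<phi> = (LINT x|lborel. f (x + h) * \<phi> x)" .
  have B2: "bform v \<phi> = (LINT x|lborel. f x * \<phi> x)" using sol t\<phi> by (simp add: wsol_def)
  have i1: "integrable lborel (\<lambda>x. f (x + h) * \<phi> x)" and i2: "integrable lborel (\<lambda>x. f x * \<phi> x)"
    by (rule integrable_bounded_mult[OF i\<phi> _ F]; measurable)+
  have A: "integrable lborel2 (\<lambda>p. \<phi> (fst p) * (incr w p * k (fst p - snd p)))"
  proof (rule integrable_pair_bounded_fibres[OF i\<phi>, where B="4 * M * \<kappa>"])
    fix x
    have "(\<integral>\<^sup>+y. ennreal \<bar>(w (fst (x, y)) - w (snd (x, y))) * k (fst (x, y) - snd (x, y))\<bar> \<partial>lborel)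
       \<le> (\<integral>\<^sup>+y. ennreal (4 * M * k (x - y)) \<partial>lborel)"
    proof (intro nn_integral_mono ennreal_leI)
      fix y
      have "\<bar>w x - w y\<bar> \<le> 4 * M" using w2M[of x] w2M[of y] by linarith
      then have "\<bar>w x - w y\<bar> * k (x - y) \<le> 4 * M * k (x - y)" by (rule mult_right_mono) (rule k)
      then show "\<bar>(w (fst (x, y)) - w (snd (x, y))) * k (fst (x, y) - snd (x, y))\<bar> \<le> 4 * M * k (x - y)"
        using k(1) by (simp add: abs_mult)
    qed
    also have "\<dots> = (\<integral>\<^sup>+y. ennreal (4 * M * k y) \<partial>lborel)"
      by (rule nn_integral_lborel_reflect[of "\<lambda>y. ennreal (4 * M * k y)"]) measurable
    also have "\<dots> = ennreal (LINT y|lborel. 4 * M * k y)" using ik k M0 by (intro nn_integral_eq_integral) auto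
    also have "(LINT y|lborel. 4 * M * k y) = 4 * M * \<kappa>" by (simp add: Ik)
    finally show "(\<integral>\<^sup>+y. ennreal \<bar>(w (fst (x, y)) - w (snd (x, y))) * k (fst (x, y) - snd (x, y))\<bar> \<partial>lborel) \<le> ennreal (4 * M * \<kappa>)" .
  qed measurable
  define L where "L x = (LINT y|lborel. (w x - w y) * k (x - y))" for x
  note S = symmetric_kernel_form[OF A k(2), folded L_def]
  have iL: "integrable lborel (\<lambda>x. \<phi> x * L x)" using S(3) by (simp add: L_def)
  \<comment> \<open>Lowering the kernel is allowed because \<open>\<phi>\<close> is a nondecreasing
    function of \<open>w\<close>: the product of increments is nonnegative, and it vanishes on the
    diagonal.\<close>
  have "(LINT x|lborel. \<phi> x * L x) \<le> bform w \<phi>"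
  proof -
    have "(LINT p|lborel2. incr w p * incr \<phi> p * k (fst p - snd p))
      \<le> (LINT p|lborel2. incr w p * incr \<phi> p * J (fst p - snd p))"
    proof (intro integral_mono S(1) bform_integrable fw f\<phi>)
      fix p :: "'a \<times> 'a"
      show "incr w p * incr \<phi> p * k (fst p - snd p) \<le> incr w p * incr \<phi> p * J (fst p - snd p)"
      proof (cases "fst p = snd p")
        case False
        have "0 \<le> incr w p * incr \<phi> p"
          unfolding \<phi>_def by (rule diff_mult_pos_part_diff_nonneg)
        moreover have "k (fst p - snd p) \<le> J (fst p - snd p)" unfolding k_def using False by (intro cJ) simp
        ultimately show ?thesis by (rule mult_left_mono[rotated])
      qed simp
    qed
    then show ?thesis using S(2) unfolding bform_def L_def by linarith
  qed
  also have "bform w \<phi> = (LINT x|lborel. f (x + h) * \<phi> x) - (LINT x|lborel. f x * \<phi> x)"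
    unfolding w_def using bform_diff_left[OF fv fvh f\<phi>] B1 B2 by simp
  finally have le: "(LINT x|lborel. \<phi> x * L x) \<le> (LINT x|lborel. f (x + h) * \<phi> x) - (LINT x|lborel. f x * \<phi> x)" .
  have L: "2 * F < L x" if x: "\<phi> x \<noteq> 0" for x
  proof -
    have wx: "m < w x" using x by (simp add: \<phi>_def max_def split: if_splits)
    have ikx: "integrable lborel (\<lambda>y. k (z - y))" for z by (rule integrable_lborel_reflect[OF ik])
    have vh: "integrable lborel (\<lambda>y. v (y + h) * k (x - y))" and vx: "integrable lborel (\<lambda>y. v y * k (x - y))"
      and vxh: "integrable lborel (\<lambda>y. v y * k (x + h - y))"
      by (rule integrable_bounded_mult[OF ikx _ M]; measurable)+
    have "L x = (LINT y|lborel. w x * k (x - y) - (v (y + h) * k (x - y) - v y * k (x - y)))"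
      unfolding L_def by (intro Bochner_Integration.integral_cong refl) (simp add: w_def algebra_simps)
    also have "\<dots> = w x * (LINT y|lborel. k (x - y)) - ((LINT y|lborel. v (y + h) * k (x - y)) - (LINT y|lborel. v y * k (x - y)))"
      using vh vx ikx[of x] by simp
    also have "(LINT y|lborel. k (x - y)) = \<kappa>" using integral_lborel_reflect[of k x] Ik by simp
    \<comment> \<open>The translation moves from \<open>v\<close>, about whose continuity nothing is
      known, to the kernel. The cost is \<open>M\<close> times an integral bounded independently of
      \<open>n\<close>, while \<open>w x\<close> keeps the factor \<open>\<kappa>\<close>,
      proportional to \<open>n\<close>.\<close>
    also have "(LINT y|lborel. v (y + h) * k (x - y)) = (LINT y|lborel. v y * k (x + h - y))"
      using integral_lborel_translate[of "\<lambda>y. v y * k (x + h - y)" h] by simp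
    finally have Lx: "L x = w x * \<kappa> - ((LINT y|lborel. v y * k (x + h - y)) - (LINT y|lborel. v y * k (x - y)))" .
    have kd: "integrable lborel (\<lambda>y. \<bar>k (y + h) - k y\<bar>)"
      "(LINT y|lborel. \<bar>k (y + h) - k y\<bar>) \<le> c * (2 * unit_ball_vol DIM('a) * DIM('a))"
    proof -
      have e: "\<bar>k (y + h) - k y\<bar> = c * \<bar>dyadic_kernel n (y + h) - dyadic_kernel n y\<bar>" for y
        unfolding k_def right_diff_distrib[symmetric] using c by (simp add: abs_mult)
      show "integrable lborel (\<lambda>y. \<bar>k (y + h) - k y\<bar>)" unfolding e
        by (intro integrable_mult_right integral_dyadic_kernel_translate_diff h)
      show "(LINT y|lborel. \<bar>k (y + h) - k y\<bar>) \<le> c * (2 * unit_ball_vol DIM('a) * DIM('a))" unfolding e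
        using integral_dyadic_kernel_translate_diff(2)[OF h] c by (simp add: mult_left_mono)
    qed
    have "(LINT y|lborel. v y * k (x + h - y)) - (LINT y|lborel. v y * k (x - y)) = (LINT y|lborel. v y * k (x + h - y) - v y * k (x - y))"
      using vx vxh by simp
    also have "\<dots> \<le> (LINT y|lborel. M * \<bar>k ((x - y) + h) - k (x - y)\<bar>)"
    proof (rule integral_mono)
      show "integrable lborel (\<lambda>y. v y * k (x + h - y) - v y * k (x - y))" using vx vxh by simp
      show "integrable lborel (\<lambda>y. M * \<bar>k ((x - y) + h) - k (x - y)\<bar>)"
        using integrable_lborel_reflect[OF kd(1), of x] by simp
      fix y
      have "v y * k (x + h - y) - v y * k (x - y) = v y * (k ((x - y) + h) - k (x - y))"
        by (simp add: right_diff_distrib algebra_simps)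
      also have "\<dots> \<le> \<bar>v y\<bar> * \<bar>k ((x - y) + h) - k (x - y)\<bar>" unfolding abs_mult[symmetric] by (rule abs_ge_self)
      also have "\<dots> \<le> M * \<bar>k ((x - y) + h) - k (x - y)\<bar>" by (intro mult_right_mono M) simp
      finally show "v y * k (x + h - y) - v y * k (x - y) \<le> M * \<bar>k ((x - y) + h) - k (x - y)\<bar>" .
    qed
    also have "\<dots> = M * (LINT y|lborel. \<bar>k (y + h) - k y\<bar>)"
      using integral_lborel_reflect[of "\<lambda>y. \<bar>k (y + h) - k y\<bar>" x] by simp
    also have "\<dots> \<le> M * (c * (2 * unit_ball_vol DIM('a) * DIM('a)))" using kd(2) M0 by (rule mult_left_mono)
    finally have "w x * \<kappa> - M * (c * (2 * unit_ball_vol DIM('a) * DIM('a))) \<le> L x" using Lx by linarith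
    moreover have "\<kappa> * m \<le> w x * \<kappa>" using mult_left_mono[of m "w x" \<kappa>] wx \<kappa> by (simp add: mult.commute)
    ultimately show ?thesis using m unfolding \<kappa>_def by linarith
  qed
  define g where "g x = \<phi> x * (L x - (f (x + h) - f x))" for x
  have g_eq: "g x = \<phi> x * L x - (f (x + h) * \<phi> x - f x * \<phi> x)" for x by (simp add: g_def algebra_simps)
  have ig: "integrable lborel g" unfolding g_eq[abs_def] using iL i1 i2 by auto
  have gle: "(LINT x|lborel. g x) \<le> 0" unfolding g_eq using iL i1 i2 le by simp
  have pos: "g x > 0" if x: "\<phi> x \<noteq> 0" for x
  proof -
    have "0 < \<phi> x" using x \<phi>nn[of x] by linarith
    moreover have "0 < L x - (f (x + h) - f x)" using L[OF x] F[of x] F[of "x + h"] by linarith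
    ultimately show ?thesis unfolding g_def by (rule mult_pos_pos)
  qed
  have "AE x in lborel. \<phi> x = 0"
    by (rule AE_zero_of_nonpos_integral[OF ig gle pos]) (simp_all add: g_def)
  then show ?thesis
  proof eventually_elim
    case (elim x)
    then have "w x - m \<le> 0" unfolding \<phi>_def by linarith
    then show ?case by (simp add: w_def)
  qed
qed

section \<open>The modulus \<open>ell\<close> and the estimate for translates\<close>

lemma ell_eq: "0 < t \<Longrightarrow> t \<le> 1/10 \<Longrightarrow> ell t = 1 / (- ln t)"
  by (simp add: ell_def)

lemma ell_powr:
  assumes "0 < t" "t \<le> 1/10"
  shows "ell t powr \<beta> = (- ln t) powr (- \<beta>)"
proof -
  define L where "L = - ln t"
  have "ln t < 0" using assms by simp
  then have "0 < L" by (simp add: L_def)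
  then have "(1 / L) powr \<beta> = L powr (- \<beta>)" by (simp add: powr_divide powr_minus_divide)
  then show ?thesis using assms by (simp only: ell_eq L_def)
qed

lemma ln_10_ge_1: "1 \<le> ln (10::real)"
proof -
  have "exp 1 \<le> (10::real)" using e_less_272 by linarith
  then show ?thesis by (subst ln_ge_iff) auto
qed

text \<open>The cut-off at \<open>1/10\<close> keeps the absolute value of the logarithm above
  \<open>ln 10 \<ge> 1\<close>. That \<open>ell\<close> is at most \<open>1\<close> lets it be
  bounded by its power with exponent \<beta>.\<close>

lemma ell_pos_le_1:
  assumes "0 < t"
  shows "0 < ell t" "ell t \<le> 1"
proof -
  have "ln (min t (1/10)) \<le> ln (1/10)" using assms by (intro ln_mono) auto
  also have "\<dots> = - ln 10" by (simp add: ln_div)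
  finally have "1 \<le> \<bar>ln (min t (1/10))\<bar>" using ln_10_ge_1 by linarith
  then show "0 < ell t" "ell t \<le> 1" by (auto simp: ell_def divide_le_eq)
qed

lemma ell_le_ell_powr:
  assumes "0 < t" "0 \<le> \<beta>" "\<beta> \<le> 1"
  shows "ell t \<le> ell t powr \<beta>"
  using powr_mono'[of \<beta> 1 "ell t"] ell_pos_le_1[OF assms(1)] assms by simp

lemma ell_ge: "1/10 \<le> t \<Longrightarrow> 1/10 \<le> ell t"
proof -
  assume "1/10 \<le> t"
  then have "min t (1/10) = 1/10" by simp
  then have "ell t = 1 / ln 10" using ln_10_ge_1 by (simp add: ell_def ln_div)
  moreover have "ln (10::real) \<le> 10" using ln_le_minus_one[of "10::real"] by simp
  ultimately show ?thesis using ln_10_ge_1 by (simp add: frac_le)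
qed

text \<open>\<open>1 - log 2 (2 * t) = - ln t / ln 2\<close>: the factor \<open>2\<close> acquired
  in the choice of a representative cancels the summand \<open>1\<close> of \<open>gmod\<close>, and
  \<open>ln 2 \<le> 1\<close> gives the right direction.\<close>

lemma gmod_le_ell_powr:
  assumes "0 < t" "t \<le> 1/10" "0 \<le> \<beta>"
  shows "gmod \<beta> (2 * t) \<le> ell t powr \<beta>"
proof -
  have ln: "1 \<le> - ln t"
  proof -
    have "ln t \<le> ln (1/10)" using assms by (intro ln_mono) auto
    also have "\<dots> = - ln 10" by (simp add: ln_div)
    finally show ?thesis using ln_10_ge_1 by linarith
  qed
  have l2: "0 < ln (2::real)" "ln (2::real) \<le> 1" using ln_le_minus_one[of "2::real"] by auto
  have "1 - log 2 (min (2 * t) 1) = - ln t / ln 2"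
    using assms by (simp add: min_def log_def ln_mult add_divide_distrib)
  then have g: "gmod \<beta> (2 * t) = (- ln t / ln 2) powr (- \<beta>)" by (simp add: gmod_def)
  have "- ln t * ln 2 \<le> - ln t * 1" using ln l2 by (intro mult_left_mono) auto
  then have "- ln t \<le> - ln t / ln 2" using l2 by (subst pos_le_divide_eq) auto
  then have "gmod \<beta> (2 * t) \<le> (- ln t) powr (- \<beta>)" unfolding g using ln assms by (intro powr_mono2') auto
  also have "\<dots> = ell t powr \<beta>" using assms by (simp add: ell_powr)
  finally show ?thesis .
qed

definition translate_bound :: "real \<Rightarrow> real \<Rightarrow> real \<Rightarrow> real \<Rightarrow> real \<Rightarrow> 'a::euclidean_space set \<Rightarrow> bool" where
  "translate_bound \<beta> F M K C \<Omega> \<longleftrightarrow> (\<forall>f v. bounded \<Omega> \<longrightarrow> open \<Omega> \<longrightarrow> wsol \<Omega> f v \<longrightarrow> f \<in> borel_measurable borel \<longrightarrow>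
    (\<forall>x. \<bar>f x\<bar> \<le> F) \<longrightarrow> (\<forall>x. \<bar>v x\<bar> \<le> M) \<longrightarrow>
    (\<forall>x0 x. x0 \<in> frontier \<Omega> \<longrightarrow> \<bar>v x\<bar> \<le> K * gmod \<beta> (2 * norm (x - x0))) \<longrightarrow>
    (\<forall>h. h \<noteq> 0 \<longrightarrow> (AE x in lborel. \<bar>v (x + h) - v x\<bar> \<le> C * ell (norm h) powr \<beta>)))"

text \<open>At scale \<open>norm h\<close> the truncated kernel has mass of order
  \<open>1 / ell (norm h)\<close>, so the interior part of \<open>m\<close> is a multiple of
  \<open>ell (norm h)\<close>. The boundary part has the weaker order
  \<open>ell (norm h) powr \<beta>\<close> and decides the result.\<close>

lemma translate_modulus:
  assumes \<beta>: "0 < \<beta>" "\<beta> \<le> 1" and K: "0 \<le> K" and M0: "0 \<le> M" and F0: "0 \<le> F"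
  shows "\<exists>C\<ge>0. \<forall>\<Omega> :: 'a::euclidean_space set. translate_bound \<beta> F M K C \<Omega>"
proof -
  let ?V = "unit_ball_vol DIM('a)" and ?N = "real DIM('a)"
  obtain c where c: "0 < c" and cJ: "\<And>n. \<And>y::'a. y \<noteq> 0 \<Longrightarrow> c * dyadic_kernel n y \<le> J y"
    using dyadic_kernel_le_J by blast
  have V: "?V > 0" by simp
  define S where "S = 2 * F + M * (c * (2 * ?V * ?N))"
  have S: "0 \<le> S" using F0 M0 c by (simp add: S_def)
  \<comment> \<open>Chosen so that, with \<open>n \<ge> 1 / (2 * ell t)\<close>, the summand
    \<open>A * ell t\<close> of \<open>m\<close> alone gives
    \<open>c * (n * V) * m \<ge> S + 1 > S\<close>, with \<open>V\<close> the volume of the unit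
    ball.\<close>
  define A where "A = 2 * (S + 1) / (c * ?V)"
  have A: "0 \<le> A" "c * ?V * A = 2 * (S + 1)" using S c V unfolding A_def by (auto simp del: unit_ball_vol_pos)
  \<comment> \<open>\<open>20 * M\<close> is for \<open>norm h > 1/10\<close>, where the increment
    is at most \<open>2 * M\<close> and \<open>ell (norm h) powr \<beta>\<close> is at least
    \<open>1/10\<close>.\<close>
  define C where "C = K + A + 20 * M"
  have C: "0 \<le> C" using K A M0 by (simp add: C_def)
  have main: "AE x in lborel. \<bar>v (x + h) - v x\<bar> \<le> C * ell (norm h) powr \<beta>"
    if \<Omega>: "bounded \<Omega>" "open \<Omega>" and sol: "wsol \<Omega> f v" and fm: "f \<in> borel_measurable borel"
      and F: "\<forall>x. \<bar>f x\<bar> \<le> F" and M: "\<forall>x. \<bar>v x\<bar> \<le> M"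
      and dec: "\<forall>x0 x. x0 \<in> frontier \<Omega> \<longrightarrow> \<bar>v x\<bar> \<le> K * gmod \<beta> (2 * norm (x - x0))" and h: "h \<noteq> 0"
    for \<Omega> f and v :: "'a \<Rightarrow> real" and h
  proof (cases "norm h \<le> 1/10")
    case False
    have h1: "0 < norm h" using h by simp
    have "1/10 \<le> ell (norm h) powr \<beta>" using ell_ge[of "norm h"] ell_le_ell_powr[OF h1, of \<beta>] False \<beta> by linarith
    then have "(20 * M) * (1/10) \<le> C * ell (norm h) powr \<beta>" using M0 K A C by (intro mult_mono) (auto simp: C_def)
    then have "\<bar>v (x + h) - v x\<bar> \<le> C * ell (norm h) powr \<beta>" for x
      using M[rule_format, of x] M[rule_format, of "x + h"] by linarith
    then show ?thesis by simp
  next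
    case True
    define t where "t = norm h"
    have t: "0 < t" "t \<le> 1/10" using h True by (auto simp: t_def)
    have "1 \<le> 1 / t" using t by (simp add: field_simps)
    then obtain n where n: "2 ^ n \<le> 1 / t" "1 / t < 2 ^ Suc n" using power_of_two_bracket by metis
    \<comment> \<open>The logarithmic estimate only gives \<open>- ln t \<le> n + 1\<close>; with
      \<open>n \<ge> 1\<close> the right-hand side is at most \<open>2 * n\<close>.\<close>
    have n1: "1 \<le> n"
    proof (rule ccontr)
      assume "\<not> 1 \<le> n"
      then have "n = 0" by simp
      then have "1 / t < 2" using n(2) by simp
      moreover have "10 \<le> 1 / t" using t by (simp add: field_simps)
      ultimately show False by linarith
    qed
    have nl: "1 / (2 * ell t) \<le> real n"
    proof -
      have "ln (1 / t) \<le> ln (2 ^ Suc n)" using n(2) t by (intro ln_mono) auto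
      also have "\<dots> = real (Suc n) * ln 2" by (rule ln_realpow)
      also have "\<dots> \<le> real (Suc n) * 1" using ln_le_minus_one[of "2::real"] by (intro mult_left_mono) auto
      finally have "- ln t \<le> real (Suc n)" using t by (simp add: ln_div)
      then have "- ln t / 2 \<le> real n" using n1 by simp
      then show ?thesis using t by (simp add: ell_eq)
    qed
    define m where "m = K * gmod \<beta> (2 * t) + A * ell t"
    have ell: "0 < ell t" using ell_pos_le_1[OF t(1)] by simp
    have Am: "A * ell t \<le> m" using K by (simp add: m_def gmod_def)
    have "2 * F + M * (c * (2 * ?V * ?N)) < S + 1" by (simp add: S_def)
    also have "\<dots> = c * ?V * A * ell t * (1 / (2 * ell t))" using A(2) ell by simp
    also have "\<dots> \<le> c * ?V * A * ell t * real n" using nl c V A ell by (intro mult_left_mono mult_nonneg_nonneg) auto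
    also have "\<dots> = c * (real n * ?V) * (A * ell t)" by (simp only: mult_ac)
    also have "\<dots> \<le> c * (real n * ?V) * m" using Am c V by (intro mult_left_mono mult_nonneg_nonneg) auto
    finally have mm: "2 * F + M * (c * (2 * ?V * ?N)) < c * (real n * ?V) * m" .
    have hn: "norm h * 2 ^ n \<le> 1" using n(1) t by (simp add: t_def[symmetric] field_simps)
    have v0: "v x = 0" if "x \<notin> \<Omega>" for x using sol that by (auto simp: wsol_def test_fun_def)
    have bd: "\<bar>v (x + h) - v x\<bar> \<le> m" if "x \<notin> \<Omega> \<or> x + h \<notin> \<Omega>" for x
    proof -
      have "\<bar>v (x + h) - v x\<bar> \<le> K * gmod \<beta> (2 * norm h)"
        using \<Omega>(2) v0 K \<beta> dec that by (intro abs_translate_diff_le_boundary[of \<Omega>]) auto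
      also have "\<dots> \<le> m" using A ell by (simp add: m_def t_def)
      finally show ?thesis .
    qed
    have a1: "AE x in lborel. v (x + h) - v x \<le> m"
    proof (rule translate_diff_le[OF sol \<Omega> fm _ _ _ c cJ hn mm])
      show "v (x + h) - v x \<le> m" if "x \<notin> \<Omega> \<or> x + h \<notin> \<Omega>" for x using bd[OF that] by linarith
    qed (use F M in auto)
    have a2: "AE x in lborel. - v (x + h) - - v x \<le> m"
    proof (rule translate_diff_le[OF wsol_uminus[OF sol] \<Omega> _ _ _ _ c cJ hn mm])
      show "- v (x + h) - - v x \<le> m" if "x \<notin> \<Omega> \<or> x + h \<notin> \<Omega>" for x using bd[OF that] by linarith
    qed (use F M fm in auto)
    have e1: "ell t \<le> ell t powr \<beta>" using t \<beta> by (intro ell_le_ell_powr) auto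
    have "m \<le> K * ell t powr \<beta> + A * ell t powr \<beta>"
      unfolding m_def using t \<beta> K A e1 by (intro add_mono mult_left_mono gmod_le_ell_powr) auto
    also have "\<dots> \<le> C * ell t powr \<beta>" using M0 by (simp add: C_def distrib_right)
    finally have mC: "m \<le> C * ell (norm h) powr \<beta>" by (simp add: t_def)
    show ?thesis using a1 a2 by eventually_elim (use mC in linarith)
  qed
  show ?thesis using C main unfolding translate_bound_def by blast
qed

section \<open>From translates to a continuous representative\<close>

lemma AE_lborel_open:
  fixes U :: "'a::euclidean_space set"
  assumes ae: "AE x in lborel. P x" and U: "open U" "U \<noteq> {}"
  obtains x where "x \<in> U" "P x"
proof (rule ccontr)
  assume "\<not> thesis"
  then have "\<not> P x" if "x \<in> U" for x using that by (metis \<open>\<And>x. x \<in> U \<Longrightarrow> P x \<Longrightarrow> thesis\<close>)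
  with ae have "AE x in lborel. x \<notin> U" by (auto elim!: eventually_mono)
  then have "U \<in> null_sets lborel" using U(1) by (subst AE_iff_null_sets) auto
  then have "negligible U" using negligible_iff_null_sets null_sets_completionI by blast
  then show False using U open_not_negligible by blast
qed

text \<open>The exceptional set in \<open>tr\<close> depends on \<open>h\<close>. Fubini exchanges
  the roles: for almost every \<open>x\<close> the estimate holds for almost every \<open>h\<close>,
  hence for almost every \<open>y = x + h\<close>.\<close>

lemma ae_modulus_of_translations:
  fixes v :: "'a::euclidean_space \<Rightarrow> real"
  assumes [measurable]: "v \<in> borel_measurable borel" "\<omega> \<in> borel_measurable borel"
    and tr: "\<And>h. h \<noteq> 0 \<Longrightarrow> AE x in lborel. \<bar>v (x + h) - v x\<bar> \<le> \<omega> (norm h)"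
  shows "AE x in lborel. AE y in lborel. \<bar>v y - v x\<bar> \<le> \<omega> (norm (y - x))"
proof -
  have "AE h in lborel. h \<noteq> (0::'a)" using AE_lborel_singleton by blast
  then have "AE h in lborel. AE x in lborel. \<bar>v (x + h) - v x\<bar> \<le> \<omega> (norm h)"
    by eventually_elim (rule tr)
  moreover have "{p \<in> space lborel2. \<bar>v (snd p + fst p) - v (snd p)\<bar> \<le> \<omega> (norm (fst p))} \<in> sets lborel2"
    by measurable
  ultimately have "AE x in lborel. AE h in lborel. \<bar>v (x + h) - v x\<bar> \<le> \<omega> (norm h)"
    by (subst (asm) lborel_pair.AE_commute) auto
  then show ?thesis
  proof eventually_elim
    case (elim x)
    from AE_lborel_translate[OF this, of "- x"] show ?case by simp
  qed
qed

text \<open>Call \<open>x\<close> good if the estimate holds against almost every \<open>y\<close>.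
  Two good points are compared through a third one close to the first and admissible for both: the
  short step costs little because \<open>\<omega>\<close> tends to \<open>0\<close>, and the long
  one is handled by continuity of \<open>\<omega>\<close>. Good points are dense, so
  \<open>v\<close> restricted to them extends uniformly continuously with the same modulus.\<close>

lemma continuous_representative:
  fixes v :: "'a::euclidean_space \<Rightarrow> real"
  assumes ae: "AE x in lborel. AE y in lborel. \<bar>v y - v x\<bar> \<le> \<omega> (norm (y - x))"
    and cont: "\<And>t. 0 < t \<Longrightarrow> isCont \<omega> t" and lim: "(\<omega> \<longlongrightarrow> 0) (at_right 0)"
  obtains g where "AE x in lborel. v x = g x" "continuous_on UNIV g"
    "\<And>x y. x \<noteq> y \<Longrightarrow> \<bar>g x - g y\<bar> \<le> \<omega> (norm (x - y))"
proof -
  define E where "E = {x. AE y in lborel. \<bar>v y - v x\<bar> \<le> \<omega> (norm (y - x))}"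
  have aeE: "AE x in lborel. x \<in> E" using ae by (simp add: E_def)
  have dense: "closure E = UNIV"
  proof -
    have "\<exists>y\<in>E. dist y x < e" if e: "e > 0" for x e
    proof -
      obtain y where "y \<in> ball x e" "y \<in> E" using AE_lborel_open[OF aeE, of "ball x e"] e by auto
      then show ?thesis by (auto simp: dist_commute)
    qed
    then show ?thesis by (auto simp: closure_approachable)
  qed
  have mod: "\<bar>v x - v x'\<bar> \<le> \<omega> (norm (x - x'))" if x: "x \<in> E" "x' \<in> E" "x \<noteq> x'" for x x'
  proof (rule field_le_epsilon)
    fix e :: real assume e: "0 < e"
    have "\<forall>\<^sub>F t in at_right 0. \<omega> t < e / 2" using lim e by (intro order_tendstoD) auto
    then obtain d1 where d1: "d1 > 0" "\<And>t. 0 < t \<Longrightarrow> t < d1 \<Longrightarrow> \<omega> t < e / 2"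
      by (auto simp: eventually_at_right_field)
    have "isCont \<omega> (norm (x - x'))" using x by (intro cont) auto
    then have "((\<lambda>y. \<omega> (norm (y - x'))) \<longlongrightarrow> \<omega> (norm (x - x'))) (at x)"
      by (intro isCont_tendsto_compose[of _ \<omega>]) (auto intro!: tendsto_intros)
    then have "\<forall>\<^sub>F y in at x. \<omega> (norm (y - x')) < \<omega> (norm (x - x')) + e / 2" using e by (intro order_tendstoD) auto
    then obtain d2 where d2: "d2 > 0" "\<And>y. y \<noteq> x \<Longrightarrow> dist y x < d2 \<Longrightarrow> \<omega> (norm (y - x')) < \<omega> (norm (x - x')) + e / 2"
      by (auto simp: eventually_at)
    have "AE y in lborel. \<bar>v y - v x\<bar> \<le> \<omega> (norm (y - x)) \<and> \<bar>v y - v x'\<bar> \<le> \<omega> (norm (y - x'))"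
      using x by (auto simp: E_def)
    then obtain y where y: "y \<in> ball x (min d1 d2) - {x}" "\<bar>v y - v x\<bar> \<le> \<omega> (norm (y - x))" "\<bar>v y - v x'\<bar> \<le> \<omega> (norm (y - x'))"
    proof (rule AE_lborel_open)
      show "open (ball x (min d1 d2) - {x})" by (intro open_Diff) auto
      have "ball x (min d1 d2) \<noteq> {x}" using d1 d2 not_open_singleton[of x] by (metis open_ball)
      moreover have "x \<in> ball x (min d1 d2)" using d1 d2 by simp
      ultimately show "ball x (min d1 d2) - {x} \<noteq> {}" by blast
    qed auto
    have "\<omega> (norm (y - x)) < e / 2" using y(1) by (intro d1) (auto simp: dist_norm norm_minus_commute)
    moreover have "\<omega> (norm (y - x')) < \<omega> (norm (x - x')) + e / 2" using y(1) by (intro d2) (auto simp: dist_commute)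
    ultimately show "\<bar>v x - v x'\<bar> \<le> \<omega> (norm (x - x')) + e" using y(2,3) by linarith
  qed
  have "uniformly_continuous_on E v"
    unfolding uniformly_continuous_on_def
  proof (intro allI impI)
    fix e :: real assume e: "0 < e"
    have "\<forall>\<^sub>F t in at_right 0. \<omega> t < e" using lim e by (intro order_tendstoD) auto
    then obtain d where d: "d > 0" "\<And>t. 0 < t \<Longrightarrow> t < d \<Longrightarrow> \<omega> t < e"
      by (auto simp: eventually_at_right_field)
    show "\<exists>d>0. \<forall>x\<in>E. \<forall>x'\<in>E. dist x' x < d \<longrightarrow> dist (v x') (v x) < e"
    proof (intro exI[of _ d] conjI ballI impI d(1))
      fix x x' assume x: "x \<in> E" "x' \<in> E" "dist x' x < d"
      show "dist (v x') (v x) < e"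
      proof (cases "x = x'")
        case False
        have "\<omega> (norm (x' - x)) < e" using x False by (intro d(2)) (auto simp: dist_norm)
        then show ?thesis using mod[OF x(2,1)] False by (simp add: dist_real_def)
      qed (use e in simp)
    qed
  qed
  then obtain g where g: "uniformly_continuous_on (closure E) g" "\<And>x. x \<in> E \<Longrightarrow> v x = g x"
    using uniformly_continuous_on_extension_on_closure[of E v] by metis
  have gc: "continuous_on UNIV g" using g(1) dense uniformly_continuous_imp_continuous by auto
  have "AE x in lborel. v x = g x" using aeE by eventually_elim (rule g(2))
  moreover have "\<bar>g x - g y\<bar> \<le> \<omega> (norm (x - y))" if "x \<noteq> y" for x y
  proof -
    obtain a b where a: "\<And>n. a n \<in> E" "a \<longlonglongrightarrow> x" and b: "\<And>n. b n \<in> E" "b \<longlonglongrightarrow> y"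
      using dense closure_sequential by (metis UNIV_I)
    have gt: "(\<lambda>n. g (s n)) \<longlonglongrightarrow> g z" if "s \<longlonglongrightarrow> z" for s z
    proof (rule isCont_tendsto_compose[OF _ that])
      show "isCont g z" using gc by (simp add: continuous_on_eq_continuous_at)
    qed
    have ab: "(\<lambda>n. norm (a n - b n)) \<longlonglongrightarrow> norm (x - y)" by (intro tendsto_intros a b)
    have "(\<lambda>n. \<omega> (norm (a n - b n))) \<longlonglongrightarrow> \<omega> (norm (x - y))"
      using that by (intro isCont_tendsto_compose[OF cont ab]) auto
    moreover have "(\<lambda>n. \<bar>g (a n) - g (b n)\<bar>) \<longlonglongrightarrow> \<bar>g x - g y\<bar>" by (intro tendsto_intros gt a b)
    moreover have "\<forall>\<^sub>F n in sequentially. \<bar>g (a n) - g (b n)\<bar> \<le> \<omega> (norm (a n - b n))"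
    proof -
      have "\<forall>\<^sub>F n in sequentially. 0 < norm (a n - b n)" using ab that by (intro order_tendstoD) auto
      then show ?thesis
      proof eventually_elim
        case (elim n)
        then have "a n \<noteq> b n" by auto
        from mod[OF a(1) b(1) this] show ?case using g(2)[OF a(1)] g(2)[OF b(1)] by simp
      qed
    qed
    ultimately show ?thesis by (rule tendsto_le[OF sequentially_bot])
  qed
  ultimately show ?thesis using that gc by blast
qed

lemma isCont_ell_powr:
  assumes "0 < t"
  shows "isCont (\<lambda>t. C * ell t powr \<beta>) t"
proof -
  have ln: "ln (min t (1/10)) \<noteq> 0" using ell_pos_le_1[OF assms] by (auto simp: ell_def)
  then have "isCont ell t" unfolding ell_def[abs_def] using assms by (intro continuous_intros) auto
  then show ?thesis using ell_pos_le_1[OF assms] by (intro continuous_intros) auto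
qed

lemma tendsto_ell_powr_0:
  assumes "0 < \<beta>"
  shows "((\<lambda>t. C * ell t powr \<beta>) \<longlongrightarrow> 0) (at_right 0)"
proof -
  have "filterlim (\<lambda>t. - ln t) at_top (at_right (0::real))"
    using ln_at_0 by (simp add: filterlim_uminus_at_bot)
  then have "((\<lambda>t. (- ln t) powr (- \<beta>)) \<longlongrightarrow> 0) (at_right (0::real))"
    using assms by (intro tendsto_neg_powr) auto
  moreover have "\<forall>\<^sub>F t in at_right (0::real). (- ln t) powr (- \<beta>) = ell t powr \<beta>"
    unfolding eventually_at_right_field
  proof (intro exI[of _ "1/10"] conjI allI impI)
    fix t :: real assume t: "0 < t" "t < 1/10"
    show "(- ln t) powr (- \<beta>) = ell t powr \<beta>" using t by (simp add: ell_powr)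
  qed simp
  ultimately have "((\<lambda>t. ell t powr \<beta>) \<longlongrightarrow> 0) (at_right 0)" by (rule Lim_transform_eventually)
  from tendsto_mult_left[OF this, of C] show ?thesis by simp
qed

text \<open>Openness keeps the touching point outside \<open>\<Omega>\<close>, so the closed ball
  misses \<open>\<Omega>\<close> altogether. The point lies on the sphere: inside the open ball,
  being in the closure, it would force the ball to meet \<open>\<Omega>\<close>.\<close>

lemma uniform_exterior_sphereE:
  fixes \<Omega> :: "'a::euclidean_space set"
  assumes "uniform_exterior_sphere \<Omega>" "open \<Omega>"
  obtains R where "0 < R" "\<And>x0. x0 \<in> frontier \<Omega> \<Longrightarrow> \<exists>y0. norm (y0 - x0) = R \<and> cball y0 R \<inter> \<Omega> = {}"
proof -
  obtain R where R: "R > 0" and ex: "\<And>x0. x0 \<in> frontier \<Omega> \<Longrightarrow> \<exists>y. cball y R \<inter> closure \<Omega> = {x0}"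
    using assms(1) by (auto simp: uniform_exterior_sphere_def)
  have "\<exists>y0. norm (y0 - x0) = R \<and> cball y0 R \<inter> \<Omega> = {}" if x0: "x0 \<in> frontier \<Omega>" for x0
  proof -
    obtain y where y: "cball y R \<inter> closure \<Omega> = {x0}" using ex[OF x0] by blast
    have "x0 \<notin> \<Omega>" using x0 assms(2) by (simp add: frontier_def interior_open)
    have "cball y R \<inter> \<Omega> \<subseteq> {x0}" unfolding y[symmetric] by (intro Int_mono closure_subset order_refl)
    then have disj: "cball y R \<inter> \<Omega> = {}" using \<open>x0 \<notin> \<Omega>\<close> by fast
    have "dist y x0 \<le> R" using y by auto
    moreover have "\<not> dist y x0 < R"
    proof
      assume "dist y x0 < R"
      then have "x0 \<in> ball y R" by simp
      moreover have "x0 \<in> closure \<Omega>" using x0 by (simp add: frontier_def)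
      ultimately have "ball y R \<inter> \<Omega> \<noteq> {}" using open_Int_closure_eq_empty[of "ball y R" \<Omega>] by auto
      then show False using disj ball_subset_cball[of y R] by blast
    qed
    ultimately have "norm (y - x0) = R" by (simp add: dist_norm)
    then show ?thesis using disj by blast
  qed
  then show ?thesis using R that by blast
qed

text \<open>A closed condition on the continuous \<open>g\<close> can fail only on an open set,
  which would contain a point with \<open>v = g\<close>. For vanishing at a boundary point the
  argument needs an open set outside \<open>\<Omega>\<close> that accumulates there, and the
  exterior ball provides it.\<close>

lemma regular_representative:
  fixes \<Omega> :: "'a::euclidean_space set"
  assumes \<beta>: "0 < \<beta>" and \<Omega>: "open \<Omega>" and R: "0 < R"
    and ext: "\<And>x0. x0 \<in> frontier \<Omega> \<Longrightarrow> \<exists>y0. norm (y0 - x0) = R \<and> cball y0 R \<inter> \<Omega> = {}"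
    and [measurable]: "v \<in> borel_measurable borel" and vM: "\<And>x. \<bar>v x\<bar> \<le> M" and v0: "\<And>x. x \<notin> \<Omega> \<Longrightarrow> v x = 0"
    and tr: "\<And>h. h \<noteq> 0 \<Longrightarrow> AE x in lborel. \<bar>v (x + h) - v x\<bar> \<le> C * ell (norm h) powr \<beta>"
  obtains g where "AE x in lborel. v x = g x" "continuous_on UNIV g" "\<And>x. \<bar>g x\<bar> \<le> M" "\<And>x. x \<notin> \<Omega> \<Longrightarrow> g x = 0"
    "\<And>x y. x \<noteq> y \<Longrightarrow> \<bar>g x - g y\<bar> \<le> C * ell (norm (x - y)) powr \<beta>"
proof -
  have [measurable]: "(\<lambda>t. C * ell t powr \<beta>) \<in> borel_measurable borel" unfolding ell_def by measurable
  have "AE x in lborel. AE y in lborel. \<bar>v y - v x\<bar> \<le> C * ell (norm (y - x)) powr \<beta>"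
    by (rule ae_modulus_of_translations[OF _ _ tr]) measurable
  then obtain g where ae: "AE x in lborel. v x = g x" and gc: "continuous_on UNIV g"
    and gm: "\<And>x y. x \<noteq> y \<Longrightarrow> \<bar>g x - g y\<bar> \<le> C * ell (norm (x - y)) powr \<beta>"
    using continuous_representative[OF _ isCont_ell_powr tendsto_ell_powr_0[OF \<beta>], of v C] by blast
  have gM: "\<bar>g x\<bar> \<le> M" for x
  proof (rule ccontr)
    assume "\<not> \<bar>g x\<bar> \<le> M"
    then have "x \<in> {x. M < \<bar>g x\<bar>}" by simp
    then have ne: "{x. M < \<bar>g x\<bar>} \<noteq> {}" by blast
    have "open {x. M < \<bar>g x\<bar>}" by (intro open_Collect_less continuous_intros gc)
    then obtain y where "M < \<bar>g y\<bar>" "v y = g y" using AE_lborel_open[OF ae _ ne] by auto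
    then show False using vM[of y] by simp
  qed
  have g0: "g x = 0" if x: "x \<notin> \<Omega>" for x
  proof (rule ccontr)
    assume "g x \<noteq> 0"
    have oU: "open {y. g y \<noteq> 0}" by (intro open_Collect_neq continuous_intros gc)
    obtain W where W: "open W" "W \<inter> \<Omega> = {}" "x \<in> closure W"
    proof (cases "x \<in> closure \<Omega>")
      case False
      show ?thesis by (rule that[of "- closure \<Omega>"]) (use False closure_subset[of \<Omega>] closure_subset[of "- closure \<Omega>"] in auto)
    next
      case True
      then have "x \<in> frontier \<Omega>" using x \<Omega> by (simp add: frontier_def interior_open)
      then obtain y0 where y0: "norm (y0 - x) = R" "cball y0 R \<inter> \<Omega> = {}" using ext by blast
      show ?thesis
      proof (rule that[of "ball y0 R"])
        show "x \<in> closure (ball y0 R)" using y0(1) R by (simp add: dist_norm)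
        show "ball y0 R \<inter> \<Omega> = {}" using y0(2) ball_subset_cball[of y0 R] by blast
      qed simp
    qed
    have "{y. g y \<noteq> 0} \<inter> W \<noteq> {}" using open_Int_closure_eq_empty[OF oU, of W] W(3) \<open>g x \<noteq> 0\<close> by blast
    then obtain y where "y \<in> {y. g y \<noteq> 0} \<inter> W" "v y = g y" using AE_lborel_open[OF ae open_Int[OF oU W(1)]] by blast
    then show False using v0[of y] W(2) by auto
  qed
  show ?thesis by (rule that[OF ae gc gM g0 gm])
qed

section \<open>Least energy and the \<open>L2\<close> norm\<close>

lemma L2_norm_cong:
  fixes u v :: "'a::euclidean_space \<Rightarrow> real"
  assumes [measurable]: "u \<in> borel_measurable lebesgue" "v \<in> borel_measurable lebesgue" "\<Omega> \<in> sets lebesgue"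
    and ae: "AE x in lebesgue. v x = u x" and v0: "\<And>x. x \<notin> \<Omega> \<Longrightarrow> v x = 0"
  shows "L2_norm \<Omega> v = L2_norm \<Omega> u" "L2_norm UNIV v = L2_norm \<Omega> u"
proof -
  have "(LINT x:\<Omega>|lebesgue. (v x)\<^sup>2) = (LINT x:\<Omega>|lebesgue. (u x)\<^sup>2)"
    unfolding set_lebesgue_integral_def using ae by (intro integral_cong_AE) auto
  then show 1: "L2_norm \<Omega> v = L2_norm \<Omega> u" by (simp add: L2_norm_def)
  have "(LINT x:UNIV|lebesgue. (v x)\<^sup>2) = (LINT x:\<Omega>|lebesgue. (v x)\<^sup>2)"
    unfolding set_lebesgue_integral_def by (intro Bochner_Integration.integral_cong refl) (use v0 in \<open>auto simp: indicator_def\<close>)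
  then show "L2_norm UNIV v = L2_norm \<Omega> u" using 1 by (simp add: L2_norm_def)
qed

text \<open>This makes the norm a quantity determined by \<open>\<Omega>\<close>, \<open>k\<close>
  and \<open>lam\<close>, by which constants may be divided before a particular solution is
  given.\<close>

lemma least_energy_L2_norm_eq:
  assumes u: "global_least_energy_solution \<Omega> k lam u" and w: "global_least_energy_solution \<Omega> k lam w" and "k < 0"
  shows "L2_norm \<Omega> u = L2_norm \<Omega> w"
proof -
  have "J_ln \<Omega> k lam u = J_ln \<Omega> k lam w"
    using u w unfolding global_least_energy_solution_def by (metis ereal.inject)
  then show ?thesis
    using u w \<open>k < 0\<close> by (simp add: J_ln_weak_solution global_least_energy_solution_def L2_norm_def)
qed

lemma least_energy_L2_norm_pos:
  assumes u: "global_least_energy_solution \<Omega> k lam u" and \<Omega>: "open \<Omega>"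
  shows "0 < L2_norm \<Omega> u"
proof -
  have uH: "u \<in> H0_ln \<Omega>" and nz: "\<not> (AE x in lebesgue. u x = 0)"
    using u by (auto simp: global_least_energy_solution_def weak_solution_def)
  have [measurable]: "u \<in> borel_measurable lebesgue" and i: "integrable lebesgue (\<lambda>x. (u x)\<^sup>2)"
    and z: "AE x in lebesgue. x \<notin> \<Omega> \<longrightarrow> u x = 0" using uH by (auto simp: H0_ln_def H_ln_def)
  have [measurable]: "\<Omega> \<in> sets lebesgue" using \<Omega> by auto
  have eq: "(LINT x:\<Omega>|lebesgue. (u x)\<^sup>2) = (LINT x|lebesgue. (u x)\<^sup>2)"
    unfolding set_lebesgue_integral_def using z by (intro integral_cong_AE) (auto simp: indicator_def)
  have "(LINT x|lebesgue. (u x)\<^sup>2) \<noteq> 0"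
    using integral_nonneg_eq_0_iff_AE[OF i] nz by auto
  moreover have "0 \<le> (LINT x|lebesgue. (u x)\<^sup>2)" by simp
  ultimately show ?thesis unfolding L2_norm_def eq by (simp add: order_less_le)
qed

theorem proposition1p2:
  fixes \<Omega> :: "'a::euclidean_space set"
  assumes "bounded \<Omega>" and "open \<Omega>"
    and "lipschitz_boundary \<Omega>" and "uniform_exterior_sphere \<Omega>"
  shows "\<exists>\<beta>. 0 < \<beta> \<and> \<beta> < 1 \<and>
    (\<forall>k lam. k < 0 \<longrightarrow>
      (\<exists>C>0. \<forall>u. global_least_energy_solution \<Omega> k lam u \<longrightarrow>
        (\<exists>v. (AE x in lebesgue. v x = u x) \<and> (\<forall>x. x \<notin> \<Omega> \<longrightarrow> v x = 0) \<and>
          continuous_on \<Omega> v \<and> v \<in> Linf_space \<Omega> \<and>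
          (SUP (x, y) \<in> {(x, y). x \<noteq> y}. ereal (\<bar>v x - v y\<bar> / (ell (norm (x - y)) powr \<beta>)))
            \<le> ereal (C * L2_norm UNIV v) \<and>
          Linf_norm \<Omega> v \<le> ereal (C * L2_norm \<Omega> v))))"
proof -
  note \<Omega> = assms(1,2)
  have [measurable]: "\<Omega> \<in> sets lebesgue" using \<Omega> by auto
  obtain R where R: "0 < R" and ext: "\<And>x0. x0 \<in> frontier \<Omega> \<Longrightarrow> \<exists>y0. norm (y0 - x0) = R \<and> cball y0 R \<inter> \<Omega> = {}"
    using uniform_exterior_sphereE[OF assms(4,2)] by blast
  obtain \<beta> where \<beta>: "0 < \<beta>" "\<beta> \<le> 1/2" and decay: "\<forall>R>0. \<forall>M F. \<exists>K\<ge>0. \<forall>\<Omega> :: 'a set. decay_bound \<beta> R M F K \<Omega>"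
    using boundary_decay[where 'a='a] by (elim exE conjE)
  have "\<exists>C>0. \<forall>u. global_least_energy_solution \<Omega> k lam u \<longrightarrow>
        (\<exists>v. (AE x in lebesgue. v x = u x) \<and> (\<forall>x. x \<notin> \<Omega> \<longrightarrow> v x = 0) \<and>
          continuous_on \<Omega> v \<and> v \<in> Linf_space \<Omega> \<and>
          (SUP (x, y) \<in> {(x, y). x \<noteq> y}. ereal (\<bar>v x - v y\<bar> / (ell (norm (x - y)) powr \<beta>)))
            \<le> ereal (C * L2_norm UNIV v) \<and>
          Linf_norm \<Omega> v \<le> ereal (C * L2_norm \<Omega> v))" if k: "k < 0" for k lam
  \<comment> \<open>The constant involves the norm of a solution, so one is fixed before
    \<open>u\<close> is introduced; if there is none, the claim is vacuous.\<close>
  proof (cases "\<exists>u0. global_least_energy_solution \<Omega> k lam u0")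
    case False
    then show ?thesis by (intro exI[of _ 1]) auto
  next
    case True
    then obtain u0 where u0: "global_least_energy_solution \<Omega> k lam u0" by blast
    define s where "s = L2_norm \<Omega> u0"
    have s: "0 < s" unfolding s_def by (rule least_energy_L2_norm_pos[OF u0 \<Omega>(2)])
    define M where "M = exp (- lam / k)"
    \<comment> \<open>A bound for \<open>lam * t + k * t * ln \<bar>t\<bar>\<close> over
      \<open>\<bar>t\<bar> \<le> M\<close>, from \<open>abs_mult_ln_le\<close>.\<close>
    define F where "F = \<bar>lam\<bar> * M + \<bar>k\<bar> * (1 + M\<^sup>2)"
    have M: "0 \<le> M" and F: "0 \<le> F" by (simp_all add: M_def F_def)
    obtain K where K: "0 \<le> K" and KD: "\<forall>\<Omega> :: 'a set. decay_bound \<beta> R M F K \<Omega>"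
      using decay[THEN spec, THEN mp, OF R, THEN spec, of M, THEN spec, of F] by (elim exE conjE)
    have \<beta>1: "\<beta> \<le> 1" using \<beta> by simp
    obtain C where C: "0 \<le> C" and CD: "\<forall>\<Omega> :: 'a set. translate_bound \<beta> F M K C \<Omega>"
      using translate_modulus[OF \<beta>(1) \<beta>1 K M F, where 'a='a] by (elim exE conjE)
    \<comment> \<open>Division by the common norm \<open>s\<close> turns the absolute bounds
      \<open>C\<close> and \<open>M\<close> into multiples of the norm; the summand \<open>1\<close>
      secures positivity.\<close>
    define C' where "C' = (C + M + 1) / s"
    have C': "0 < C'" "C \<le> C' * s" "M \<le> C' * s" using s C M by (simp_all add: C'_def)
    have "\<exists>v. (AE x in lebesgue. v x = u x) \<and> (\<forall>x. x \<notin> \<Omega> \<longrightarrow> v x = 0) \<and>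
          continuous_on \<Omega> v \<and> v \<in> Linf_space \<Omega> \<and>
          (SUP (x, y) \<in> {(x, y). x \<noteq> y}. ereal (\<bar>v x - v y\<bar> / (ell (norm (x - y)) powr \<beta>)))
            \<le> ereal (C' * L2_norm UNIV v) \<and>
          Linf_norm \<Omega> v \<le> ereal (C' * L2_norm \<Omega> v)" if u: "global_least_energy_solution \<Omega> k lam u" for u
    proof -
      have su: "L2_norm \<Omega> u = s" unfolding s_def by (rule least_energy_L2_norm_eq[OF u u0 k])
      have sol: "weak_solution \<Omega> k lam u" using u by (simp add: global_least_energy_solution_def)
      then have um: "u \<in> borel_measurable lebesgue" by (simp add: weak_solution_def H0_ln_def H_ln_def)
      obtain w where uw: "AE x in lborel. u x = w x" and w: "wsol \<Omega> (\<lambda>x. lam * w x + k * w x * ln \<bar>w x\<bar>) w" and wM: "\<And>x. \<bar>w x\<bar> \<le> M"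
        using weak_solution_imp_wsol[OF sol k \<Omega>] unfolding M_def by blast
      have [measurable]: "w \<in> borel_measurable borel" using w by (auto simp: wsol_def)
      define f where "f x = lam * w x + k * w x * ln \<bar>w x\<bar>" for x
      have [measurable]: "f \<in> borel_measurable borel" unfolding f_def by measurable
      have w': "wsol \<Omega> f w" using w unfolding f_def .
      have fF: "\<bar>f x\<bar> \<le> F" for x
      proof -
        have "\<bar>f x\<bar> \<le> \<bar>lam\<bar> * \<bar>w x\<bar> + \<bar>k\<bar> * \<bar>w x * ln \<bar>w x\<bar>\<bar>"
          unfolding f_def abs_mult[symmetric] by (simp add: mult.assoc abs_triangle_ineq)
        also have "\<dots> \<le> F" unfolding F_def
          using abs_mult_ln_le[of "w x"] power_mono[OF wM[of x], of 2] by (intro add_mono mult_left_mono wM) auto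
        finally show ?thesis .
      qed
      obtain w2 where w2: "AE x in lborel. w x = w2 x" "wsol \<Omega> f w2" "\<And>x. \<bar>w2 x\<bar> \<le> M"
        "\<And>x0 x. x0 \<in> frontier \<Omega> \<Longrightarrow> \<bar>w2 x\<bar> \<le> K * gmod \<beta> (2 * norm (x - x0))"
      proof (rule boundary_decay_representative[OF w' \<Omega>(2) wM K])
        fix x0 \<eta> assume x0: "x0 \<in> frontier \<Omega>" and \<eta>: "0 < (\<eta>::real)"
        obtain y0 where "norm (y0 - x0) = R" "cball y0 R \<inter> \<Omega> = {}" using ext[OF x0] by blast
        then show "AE x in lborel. \<bar>w x\<bar> \<le> K * gmod \<beta> (norm (x - x0) + \<eta>)"
          using KD[unfolded decay_bound_def, THEN spec, THEN spec, THEN spec, THEN spec, THEN spec, THEN spec, of \<Omega> f w y0 x0 \<eta>] \<Omega> w' fF wM \<eta> \<open>f \<in> borel_measurable borel\<close> by blast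
      qed (use \<beta> in auto)
      have [measurable]: "w2 \<in> borel_measurable borel" using w2(2) by (auto simp: wsol_def)
      have w20: "w2 x = 0" if "x \<notin> \<Omega>" for x using w2(2) that by (auto simp: wsol_def test_fun_def)
      have tr: "AE x in lborel. \<bar>w2 (x + h) - w2 x\<bar> \<le> C * ell (norm h) powr \<beta>" if "h \<noteq> 0" for h
        using CD[unfolded translate_bound_def, THEN spec, THEN spec, THEN spec, of \<Omega> f w2] \<Omega> w2 fF that \<open>f \<in> borel_measurable borel\<close> by blast
      obtain v where wv: "AE x in lborel. w2 x = v x" and vc: "continuous_on UNIV v" and vM: "\<And>x. \<bar>v x\<bar> \<le> M"
        and v0: "\<And>x. x \<notin> \<Omega> \<Longrightarrow> v x = 0" and vm: "\<And>x y. x \<noteq> y \<Longrightarrow> \<bar>v x - v y\<bar> \<le> C * ell (norm (x - y)) powr \<beta>"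
        using regular_representative[OF \<beta>(1) \<Omega>(2) R ext \<open>w2 \<in> borel_measurable borel\<close> w2(3) w20 tr] by blast
      have "AE x in lborel. v x = u x" using uw w2(1) wv by eventually_elim simp
      then have vu: "AE x in lebesgue. v x = u x" by (rule AE_completion)
      have "v \<in> borel_measurable borel" by (rule borel_measurable_continuous_onI[OF vc])
      then have vl: "v \<in> borel_measurable lebesgue" by (intro measurable_completion) simp
      then have vl\<Omega>: "v \<in> borel_measurable (lebesgue_on \<Omega>)" by (rule measurable_restrict_space1)
      note L2 = L2_norm_cong[OF um vl \<open>\<Omega> \<in> sets lebesgue\<close> vu v0, unfolded su]
      have Linf: "Linf_norm \<Omega> v \<le> ereal M"
        unfolding Linf_norm_def using vl\<Omega> vM by (intro esssup_I) auto
      show ?thesis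
      proof (intro exI[of _ v] conjI allI impI vu v0)
        show "continuous_on \<Omega> v" using vc continuous_on_subset by blast
        show "v \<in> Linf_space \<Omega>" using vl\<Omega> Linf by (auto simp: Linf_space_def intro: le_less_trans)
        show "Linf_norm \<Omega> v \<le> ereal (C' * L2_norm \<Omega> v)"
          using Linf C'(3) by (simp add: L2 order_trans[OF Linf])
        show "(SUP (x, y) \<in> {(x, y). x \<noteq> y}. ereal (\<bar>v x - v y\<bar> / (ell (norm (x - y)) powr \<beta>))) \<le> ereal (C' * L2_norm UNIV v)"
        proof (rule SUP_least, clarify)
          fix x y :: 'a assume xy: "x \<noteq> y"
          have "0 < ell (norm (x - y)) powr \<beta>" using ell_pos_le_1(1)[of "norm (x - y)"] xy by simp
          then have "\<bar>v x - v y\<bar> / (ell (norm (x - y)) powr \<beta>) \<le> C" using vm[OF xy] by (simp add: pos_divide_le_eq)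
          then show "ereal (\<bar>v x - v y\<bar> / (ell (norm (x - y)) powr \<beta>)) \<le> ereal (C' * L2_norm UNIV v)"
            using C'(2) by (simp add: L2)
        qed
      qed
    qed
    then show ?thesis using C'(1) by blast
  qed
  then show ?thesis using \<beta> by (intro exI[of _ \<beta>]) auto
qed

end
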